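(* Let $1\le m\le n\le L$ be integers, and consider the growing-dynamic-anomaly quickest change detection problem described in the context, with delay $\mathrm{WADD}_{\bm d}$, class $\mathcal C_\gamma=\{\tau:\mathbb E_\infty[\tau]\ge\gamma\}$, and the mixture-WD-CuSum stopping time $\tau_W$ with threshold $b$ and parameters $\rho_i$. Then: (i) If $b=\log\gamma$, then $\mathbb{E}_\infty[\tau_W]\ge\gamma$. (ii) Suppose $b=\log\gamma$; suppose that, for some constants $c_i\in[0,\infty)\cup\{\infty\}$, $1\le i\le n-m$, and with $c_{n-m+1}\triangleq\infty$, the vector of transient durations $\bm d=[d_1,\dots,d_{n-m}]^\top$ (which depends on $\gamma$) satisfies $$d_i\sim c_i\frac{\log\gamma}{I_i}\qquad\text{as }\gamma\to\infty,\quad 1\le i\le n-m;$$ and suppose that the parameters $\rho_i$ (which depend on $\gamma$) are chosen such that, for $1\le i\le n-m$, $$\rho_i\to0\quad\text{and}\quad\frac{-\log\rho_i}{\log\gamma}\to0\qquad\text{as }\gamma\to\infty.$$ Then, as $\gamma\to\infty$, $$\inf_{\tau\in\mathcal C_\gamma}\mathrm{WADD}_{\bm d}(\tau)\ \sim\ \mathrm{WADD}_{\bm d}(\tau_W)\ \sim\ \log\gamma\left(\sum_{i=1}^{h-1}\frac{c_i}{I_i}+\frac{1-\sum_{i=1}^{h-1}c_i}{I_h}\right),$$ where $h=\min\{1\le j\le n-m+1:\ \sum_{i=1}^{j}c_i\ge1\}$.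
   Context: **Observation model.** There are $L$ sensors $[L]=\{1,\dots,L\}$; at each time $k\ge1$ a vector $\bm X[k]=[X_1[k],\dots,X_L[k]]^\top$ is observed. $g$ and $f$ are the pre- and post-change probability density functions, the same for all sensors. The integers $m\le n$ are the initial and final anomaly sizes. There are deterministic changepoints $\nu_1\le\nu_2\le\dots\le\nu_{n-m+1}$, with $\nu_{n-m+2}\triangleq\infty$; the transient durations are $d_i=\nu_{i+1}-\nu_i$ for $1\le i\le n-m$, and $\bm d=[d_1,\dots,d_{n-m}]^\top$ is a vector of nonnegative integers. For each phase $1\le i\le n-m+1$ there is a deterministic trajectory $\bm S^{(i)}=\{\bm S^{(i)}[k]\}_{k\ge1}$, where each $\bm S^{(i)}[k]$ is a subset of $[L]$ of size $m+i-1$; write $\bm S=\{\bm S^{(i)}\}_{i=1}^{n-m+1}$. The vectors $\bm X[k]$ are independent over $k$. For $1\le k<\nu_1$, $\bm X[k]\sim g(\bm X[k])\triangleq\prod_{\ell=1}^L g(X_\ell[k])$. For $\nu_i\le k<\nu_{i+1}$, $\bm X[k]\sim p_{\bm S^{(i)}[k]}(\bm X[k])$, where for $\bm A\subseteq[L]$, $p_{\bm A}(\bm X)\triangleq\prod_{\ell\in \bm A}f(X_\ell)\prod_{\ell\notin \bm A}g(X_\ell)$. $\mathbb P^{\bm S}_{\nu,\bm d},\mathbb E^{\bm S}_{\nu,\bm d}$ denote probability and expectation under this model with $\nu_1=\nu$, durations $\bm d$ and trajectories $\bm S$. $\mathbb E_\infty$ is the expectation when no anomaly ever appears (all $\bm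 X[k]$ i.i.d. with density $\prod_\ell g(X_\ell)$). **Delay.** $\mathcal F_k=\sigma(\bm X[1],\dots,\bm X[k])$; stopping times are with respect to $\{\mathcal F_k\}$. Define $$\mathrm{WADD}_{\bm d}(\tau)=\sup_{\bm S}\sup_{\nu\ge1}\operatorname{ess\,sup}\ \mathbb E^{\bm S}_{\nu,\bm d}[\tau-\nu+1\mid\mathcal F_{\nu-1},\tau\ge\nu],$$ where the conditional expectation is set to $1$ when $\mathbb P^{\bm S}_{\nu,\bm d}(\tau\ge\nu)=0$. **Mixtures and KL numbers.** For $1\le i\le n-m+1$, $\overline p^{(i)}(\bm X)\triangleq\binom{L}{m+i-1}^{-1}\sum_{\bm A}p_{\bm A}(\bm X)$, the sum over all subsets $\bm A\subseteq[L]$ of size $m+i-1$, and $I_i\triangleq\mathbb E_{\overline p^{(i)}}\left[\log\frac{\overline p^{(i)}(\bm X)}{g(\bm X)}\right]$, the Kullback–Leibler divergence between the phase-$i$ mixture and the pre-change density. **Mixture-WD-CuSum test.** Let $\rho_0\triangleq1$, $\rho_i\in(0,1)$ for $1\le i\le n-m$, $\rho_{n-m+1}\triangleq0$, $\Omega^{(i)}[0]\triangleq0$ for $1\le i\le n-m+1$, and $\Omega^{(0)}[k]\triangleq0$ for all $k$. For $k\ge1$ and $1\le i\le n-m+1$, $$\Omega^{(i)}[k]=\max_{0\le j\le i}\Big(\Omega^{(j)}[k-1]+\sum_{r=j}^{i-1}\log\rho_r\Big)+\log\frac{\overline p^{(i)}(\bm X[k])}{g(\bm X[k])}+\log(1-\rho_i)$$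 (empty sums are $0$), $W[k]=\max\{\Omega^{(1)}[k],\dots,\Omega^{(n-m+1)}[k],0\}$, and $\tau_W=\inf\{k\ge1:W[k]\ge b\}$. **Asymptotics.** $x\sim y$ means $x/y\to1$; $d_i\sim c_i\log\gamma/I_i$ is understood as $d_iI_i/\log\gamma\to c_i$ (including $c_i=0$ and $c_i=\infty$). *)

theory Defs
  imports "HOL-Probability.Probability"
begin

section \<open>Observation model\<close>

text \<open>
  Conventions: \<open>L\<close> is the number of sensors, \<open>m\<close> and \<open>n\<close> are the initial and the final anomaly
  size, \<open>g\<close> and \<open>f\<close> are the pre- and post-change densities. Sensors, time instants and phases
  are all numbered from 1, so the phases are \<open>1, \<dots>, n - m + 1\<close>.
\<close>

definition is_pdf :: "(real \<Rightarrow> real) \<Rightarrow> bool" where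
  "is_pdf h \<longleftrightarrow>
     h \<in> borel_measurable borel \<and> (\<forall>x. 0 \<le> h x) \<and> (\<integral>\<^sup>+ x. ennreal (h x) \<partial>lborel) = 1"

definition obs_space :: "nat \<Rightarrow> (nat \<Rightarrow> real) measure" where
  "obs_space L = Pi\<^sub>M {1..L} (\<lambda>_. lborel)"

definition anomaly_density ::
  "(real \<Rightarrow> real) \<Rightarrow> (real \<Rightarrow> real) \<Rightarrow> nat \<Rightarrow> nat set \<Rightarrow> (nat \<Rightarrow> real) \<Rightarrow> real" where
  "anomaly_density g f L A x = (\<Prod>l\<in>A. f (x l)) * (\<Prod>l\<in>{1..L} - A. g (x l))"

definition null_density :: "(real \<Rightarrow> real) \<Rightarrow> nat \<Rightarrow> (nat \<Rightarrow> real) \<Rightarrow> real" where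
  "null_density g L x = (\<Prod>l\<in>{1..L}. g (x l))"

definition obs_law :: "nat \<Rightarrow> ((nat \<Rightarrow> real) \<Rightarrow> real) \<Rightarrow> (nat \<Rightarrow> real) measure" where
  "obs_law L p = density (obs_space L) (\<lambda>x. ennreal (p x))"

text \<open>
  The changepoint \<open>\<nu>\<^sub>i = \<nu> + d\<^sub>1 + \<dots> + d\<^sub>i\<^sub>-\<^sub>1\<close>. The last phase never ends, so
  \<open>\<nu>\<^sub>i\<close> is only used for \<open>i \<le> n - m + 1\<close>.
\<close>

definition changepoint :: "nat \<Rightarrow> (nat \<Rightarrow> nat) \<Rightarrow> nat \<Rightarrow> nat" where
  "changepoint \<nu> d i = \<nu> + (\<Sum>j\<in>{1..<i}. d j)"

text \<open>
  The phase at a time \<open>k \<ge> \<nu>\<close>. Taking the largest \<open>i\<close> with \<open>\<nu>\<^sub>i \<le> k\<close> skips the phases of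
  duration 0; the lemma below shows that this is the \<open>i\<close> with \<open>\<nu>\<^sub>i \<le> k < \<nu>\<^sub>i\<^sub>+\<^sub>1\<close>.
\<close>

definition phase_at :: "nat \<Rightarrow> nat \<Rightarrow> nat \<Rightarrow> (nat \<Rightarrow> nat) \<Rightarrow> nat \<Rightarrow> nat" where
  "phase_at m n \<nu> d k = Max {i \<in> {1..n - m + 1}. changepoint \<nu> d i \<le> k}"

lemma changepoint_mono: "i \<le> j \<Longrightarrow> changepoint \<nu> d i \<le> changepoint \<nu> d j"
  unfolding changepoint_def by (intro add_left_mono sum_mono2) auto

lemma phase_at_eq_iff:
  assumes "\<nu> \<le> k"
  shows "phase_at m n \<nu> d k = i \<longleftrightarrow>
    1 \<le> i \<and> i \<le> n - m + 1 \<and> changepoint \<nu> d i \<le> k \<and>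
    (i \<le> n - m \<longrightarrow> k < changepoint \<nu> d (Suc i))"
proof -
  let ?A = "{i \<in> {1..n - m + 1}. changepoint \<nu> d i \<le> k}"
  have fin: "finite ?A" by simp
  have ne: "?A \<noteq> {}"
    using assms by (auto intro!: exI[of _ 1] simp: changepoint_def)
  have "phase_at m n \<nu> d k = i \<longleftrightarrow> i \<in> ?A \<and> (\<forall>j\<in>?A. j \<le> i)"
    unfolding phase_at_def using Max_eq_iff[OF fin ne] by simp
  also have "\<dots> \<longleftrightarrow> i \<in> ?A \<and> (i \<le> n - m \<longrightarrow> k < changepoint \<nu> d (Suc i))"
  proof (intro conj_cong refl iffI)
    assume "\<forall>j\<in>?A. j \<le> i"
    then show "i \<le> n - m \<longrightarrow> k < changepoint \<nu> d (Suc i)"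
      by (auto simp: not_le[symmetric] dest!: bspec[of _ _ "Suc i"])
  next
    assume *: "i \<le> n - m \<longrightarrow> k < changepoint \<nu> d (Suc i)"
    show "\<forall>j\<in>?A. j \<le> i"
    proof (rule ballI, rule ccontr)
      fix j assume j: "j \<in> ?A" "\<not> j \<le> i"
      then have "changepoint \<nu> d (Suc i) \<le> changepoint \<nu> d j" "i \<le> n - m"
        by (auto intro: changepoint_mono)
      with * j show False by auto
    qed
  qed
  finally show ?thesis by auto
qed

definition trajectories :: "nat \<Rightarrow> nat \<Rightarrow> nat \<Rightarrow> (nat \<Rightarrow> nat \<Rightarrow> nat set) set" where
  "trajectories L m n =
     {S. \<forall>i\<in>{1..n - m + 1}. \<forall>k\<ge>1. S i k \<subseteq> {1..L} \<and> card (S i k) = m + i - 1}"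

text \<open>
  The laws of the whole sequence \<open>X[1], X[2], \<dots>\<close> on the canonical space: a sample \<open>\<omega>\<close> has
  \<open>X[k] = \<omega> k\<close> for \<open>k \<ge> 1\<close>.
\<close>

definition seq_space :: "nat \<Rightarrow> (nat \<Rightarrow> nat \<Rightarrow> real) measure" where
  "seq_space L = Pi\<^sub>M {1..} (\<lambda>_. obs_space L)"

definition null_prob :: "(real \<Rightarrow> real) \<Rightarrow> nat \<Rightarrow> (nat \<Rightarrow> nat \<Rightarrow> real) measure" where
  "null_prob g L = Pi\<^sub>M {1..} (\<lambda>_. obs_law L (null_density g L))"

definition anomaly_prob ::
  "(real \<Rightarrow> real) \<Rightarrow> (real \<Rightarrow> real) \<Rightarrow> nat \<Rightarrow> nat \<Rightarrow> nat \<Rightarrow>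
   nat \<Rightarrow> (nat \<Rightarrow> nat) \<Rightarrow> (nat \<Rightarrow> nat \<Rightarrow> nat set) \<Rightarrow> (nat \<Rightarrow> nat \<Rightarrow> real) measure" where
  "anomaly_prob g f L m n \<nu> d S =
     Pi\<^sub>M {1..} (\<lambda>k. obs_law L
       (if k < \<nu> then null_density g L
        else anomaly_density g f L (S (phase_at m n \<nu> d k) k)))"


section \<open>Stopping times, false alarms and delay\<close>

text \<open>
  The filtration \<open>\<F>\<^sub>k = \<sigma>(X[1], \<dots>, X[k])\<close>. It is indexed by \<^typ>\<open>enat\<close>, the type of the
  values of stopping times, which may be infinite.
\<close>

definition obs_filtration :: "nat \<Rightarrow> enat \<Rightarrow> (nat \<Rightarrow> nat \<Rightarrow> real) measure" where
  "obs_filtration L t = sigma (space (seq_space L))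
     (\<Union>k\<in>{k. 1 \<le> k \<and> enat k \<le> t}.
        {(\<lambda>\<omega>. \<omega> k) -` B \<inter> space (seq_space L) | B. B \<in> sets (obs_space L)})"

definition null_expectation ::
  "(real \<Rightarrow> real) \<Rightarrow> nat \<Rightarrow> ((nat \<Rightarrow> nat \<Rightarrow> real) \<Rightarrow> enat) \<Rightarrow> ennreal" where
  "null_expectation g L \<tau> = (\<integral>\<^sup>+ \<omega>. ennreal_of_enat (\<tau> \<omega>) \<partial>null_prob g L)"

definition false_alarm_class ::
  "(real \<Rightarrow> real) \<Rightarrow> nat \<Rightarrow> real \<Rightarrow> ((nat \<Rightarrow> nat \<Rightarrow> real) \<Rightarrow> enat) set" where
  "false_alarm_class g L \<gamma> =
     {\<tau>. stopping_time (obs_filtration L) \<tau> \<and> null_expectation g L \<tau> \<ge> ennreal \<gamma>}"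

text \<open>
  \<open>ess sup E[\<tau> - \<nu> + 1 | \<F>\<^sub>\<nu>\<^sub>-\<^sub>1, \<tau> \<ge> \<nu>]\<close> for a given law \<open>P\<close>. Conditioning on the event
  \<open>\<tau> \<ge> \<nu>\<close> is passing to the conditional law given this event, under which the truncated
  subtraction is exact.
\<close>

definition worst_history_delay ::
  "(nat \<Rightarrow> nat \<Rightarrow> real) measure \<Rightarrow> nat \<Rightarrow> ((nat \<Rightarrow> nat \<Rightarrow> real) \<Rightarrow> enat) \<Rightarrow> nat \<Rightarrow> ennreal" where
  "worst_history_delay P L \<tau> \<nu> =
     (let E = {\<omega> \<in> space P. enat \<nu> \<le> \<tau> \<omega>} in
      if emeasure P E = 0 then 1
      else esssup (uniform_measure P E)
             (nn_cond_exp (uniform_measure P E) (obs_filtration L (enat (\<nu> - 1)))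
                (\<lambda>\<omega>. ennreal_of_enat (\<tau> \<omega> + 1 - enat \<nu>))))"

definition WADD ::
  "(real \<Rightarrow> real) \<Rightarrow> (real \<Rightarrow> real) \<Rightarrow> nat \<Rightarrow> nat \<Rightarrow> nat \<Rightarrow>
   (nat \<Rightarrow> nat) \<Rightarrow> ((nat \<Rightarrow> nat \<Rightarrow> real) \<Rightarrow> enat) \<Rightarrow> ennreal" where
  "WADD g f L m n d \<tau> =
     (SUP S\<in>trajectories L m n. SUP \<nu>\<in>{1..}.
        worst_history_delay (anomaly_prob g f L m n \<nu> d S) L \<tau> \<nu>)"


section \<open>Mixtures and Kullback--Leibler numbers\<close>

definition mixture_density ::
  "(real \<Rightarrow> real) \<Rightarrow> (real \<Rightarrow> real) \<Rightarrow> nat \<Rightarrow> nat \<Rightarrow> nat \<Rightarrow> (nat \<Rightarrow> real) \<Rightarrow> real" where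
  "mixture_density g f L m i x =
     (\<Sum>A | A \<subseteq> {1..L} \<and> card A = m + i - 1. anomaly_density g f L A x)
       / real (L choose (m + i - 1))"

text \<open>
  The logarithm of the likelihood ratio \<open>p / q\<close> of nonnegative reals. Densities may vanish, so it
  is extended-real valued (\<^term>\<open>ln (0::real)\<close> is 0 in the library, not \<open>-\<infinity>\<close>). The value at
  \<open>p = q = 0\<close> is immaterial.
\<close>

definition log_ratio :: "real \<Rightarrow> real \<Rightarrow> ereal" where
  "log_ratio p q = (if p = 0 then -\<infinity> else if q = 0 then \<infinity> else ereal (ln (p / q)))"

definition mixture_llr ::
  "(real \<Rightarrow> real) \<Rightarrow> (real \<Rightarrow> real) \<Rightarrow> nat \<Rightarrow> nat \<Rightarrow> nat \<Rightarrow> (nat \<Rightarrow> real) \<Rightarrow> ereal" where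
  "mixture_llr g f L m i x = log_ratio (mixture_density g f L m i x) (null_density g L x)"

text \<open>
  The divergence \<open>I\<^sub>i\<close> is the expectation of an extended-real random variable whose negative
  part is always integrable; it is \<open>\<infinity>\<close> if the positive part is not integrable. (\<open>e2ennreal\<close>
  maps negative arguments to 0.)
\<close>

definition KL_number ::
  "(real \<Rightarrow> real) \<Rightarrow> (real \<Rightarrow> real) \<Rightarrow> nat \<Rightarrow> nat \<Rightarrow> nat \<Rightarrow> ereal" where
  "KL_number g f L m i =
     (let P = obs_law L (mixture_density g f L m i) in
      enn2ereal (\<integral>\<^sup>+ x. e2ennreal (mixture_llr g f L m i x) \<partial>P)
      - enn2ereal (\<integral>\<^sup>+ x. e2ennreal (- mixture_llr g f L m i x) \<partial>P))"


section \<open>The mixture-WD-CuSum test\<close>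

text \<open>Extends \<open>\<rho>\<^sub>1, \<dots>, \<rho>\<^sub>n\<^sub>-\<^sub>m\<close> by \<open>\<rho>\<^sub>0 = 1\<close> and \<open>\<rho>\<^sub>n\<^sub>-\<^sub>m\<^sub>+\<^sub>1 = 0\<close>.\<close>

definition ext_rho :: "nat \<Rightarrow> nat \<Rightarrow> (nat \<Rightarrow> real) \<Rightarrow> nat \<Rightarrow> real" where
  "ext_rho m n \<rho> i = (if i = 0 then 1 else if i = n - m + 1 then 0 else \<rho> i)"

fun WD_stat ::
  "(real \<Rightarrow> real) \<Rightarrow> (real \<Rightarrow> real) \<Rightarrow> nat \<Rightarrow> nat \<Rightarrow> nat \<Rightarrow> (nat \<Rightarrow> real) \<Rightarrow>
   (nat \<Rightarrow> nat \<Rightarrow> real) \<Rightarrow> nat \<Rightarrow> nat \<Rightarrow> ereal" where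
  "WD_stat g f L m n \<rho> \<omega> 0 i = 0"
| "WD_stat g f L m n \<rho> \<omega> (Suc k) i =
     (if i = 0 then 0
      else Max ((\<lambda>j. WD_stat g f L m n \<rho> \<omega> k j
                      + ereal (\<Sum>r\<in>{j..<i}. ln (ext_rho m n \<rho> r))) ` {0..i})
           + mixture_llr g f L m i (\<omega> (Suc k))
           + ereal (ln (1 - ext_rho m n \<rho> i)))"

definition WD_max ::
  "(real \<Rightarrow> real) \<Rightarrow> (real \<Rightarrow> real) \<Rightarrow> nat \<Rightarrow> nat \<Rightarrow> nat \<Rightarrow> (nat \<Rightarrow> real) \<Rightarrow>
   (nat \<Rightarrow> nat \<Rightarrow> real) \<Rightarrow> nat \<Rightarrow> ereal" where
  "WD_max g f L m n \<rho> \<omega> k =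
     Max (insert 0 ((\<lambda>i. WD_stat g f L m n \<rho> \<omega> k i) ` {1..n - m + 1}))"

definition WD_CuSum ::
  "(real \<Rightarrow> real) \<Rightarrow> (real \<Rightarrow> real) \<Rightarrow> nat \<Rightarrow> nat \<Rightarrow> nat \<Rightarrow> (nat \<Rightarrow> real) \<Rightarrow> real \<Rightarrow>
   (nat \<Rightarrow> nat \<Rightarrow> real) \<Rightarrow> enat" where
  "WD_CuSum g f L m n \<rho> b \<omega> = Inf (enat ` {k. 1 \<le> k \<and> ereal b \<le> WD_max g f L m n \<rho> \<omega> k})"


section \<open>Asymptotics\<close>

definition asymp_at_infinity :: "(real \<Rightarrow> ereal) \<Rightarrow> (real \<Rightarrow> ereal) \<Rightarrow> bool" where
  "asymp_at_infinity u v \<longleftrightarrow> ((\<lambda>\<gamma>. u \<gamma> / v \<gamma>) \<longlongrightarrow> 1) at_top"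

definition crossing_phase :: "nat \<Rightarrow> nat \<Rightarrow> (nat \<Rightarrow> ereal) \<Rightarrow> nat" where
  "crossing_phase m n c = Min {j \<in> {1..n - m + 1}. 1 \<le> (\<Sum>i\<in>{1..j}. c i)}"

definition delay_constant :: "nat \<Rightarrow> nat \<Rightarrow> (nat \<Rightarrow> ereal) \<Rightarrow> (nat \<Rightarrow> ereal) \<Rightarrow> ereal" where
  "delay_constant m n c I =
     (let h = crossing_phase m n c in
      (\<Sum>i\<in>{1..<h}. c i / I i) + (1 - (\<Sum>i\<in>{1..<h}. c i)) / I h)"

end

(*
False alarms.  A likelihood ratio of the test that reaches gamma at time k is dominated by the
likelihood ratio of a path that starts afresh at some time before k.  Ordered by starting time and
initial phase, these path densities are stochastically monotone with respect to the sensorwise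
ratios f / g, and the absence of earlier alarms is a decreasing event.  Hence, given no earlier
alarm, an alarm at time k has probability at most 1 / gamma, and the mean time to the first alarm
is at least the sum of (1 - 1 / gamma)^k over k, which is gamma.

Delay of the test.  After the changepoint, the path that starts at nu and follows the true phases
gains I_i per step up to o(t), by a weak law of large numbers.  It therefore passes log gamma
within the first (1 + o(1)) K log gamma steps with high probability, where K is the delay constant;
otherwise each of the following independent blocks of length O(log gamma) gives a new chance.  The
law of the mixture log-likelihood ratio under p_A depends on the size of A only, so nothing
depends on the trajectories.

Lower bound.  If the mean of tau is at least gamma, then there is a nu such that, given tau >= nu,
an alarm in the next t steps has pre-change probability at most 2 t / gamma.  For
t = kappa log gamma with kappa < K, changing the measure to the mixtures costs a factor of at most
gamma^(1 - eta), so the alarm remains unlikely under the mixtures.  Their product is the average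
over all trajectories, so it remains unlikely for some deterministic trajectory as well.
*)

theory Submission
  imports Defs
begin

text \<open>The bound \<gamma> for the mean time to false alarm is exact, and this rules out the
  usual arguments. For normalised ratios the Shiryaev-Roberts sum of all path densities, minus k, is
  a null martingale; but Omega^(i)[0] = 0 in every phase makes it start at n - m + 1, so optional
  stopping yields only \<gamma> - (n - m + 1). A union bound over the starting points loses a factor
  that grows with k. Ordering the starts avoids both losses: on a decreasing event, the mass left
  below \<gamma> by one path density can only shrink under the next one, so all starts together
  spend a single unit of mass. Path densities have unit mass because \<rho>_i and 1 - \<rho>_i act
  as the transition probabilities of a hidden chain of phases. For the delay, the durations and
  hence the whole process change with \<gamma>, so no limit theorem for one fixed sequence applies.
  Only one law per phase occurs, however, and the sample size in the weak law depends on these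
  finitely many laws alone. It therefore serves all \<gamma>, changepoints and trajectories at
  once.\<close>

section \<open>Product densities, resampling of a coordinate, and an association inequality\<close>

lemma density_PiM_lborel:
  fixes h :: "'i \<Rightarrow> real \<Rightarrow> real"
  assumes I: "finite I" and h: "\<And>l. l \<in> I \<Longrightarrow> is_pdf (h l)"
  shows "density (Pi\<^sub>M I (\<lambda>_. lborel)) (\<lambda>x. ennreal (\<Prod>l\<in>I. h l (x l)))
       = Pi\<^sub>M I (\<lambda>l. density lborel (\<lambda>y. ennreal (h l y)))"
proof -
  \<comment> \<open>The uniform density on [0, 1] fills the indices outside \<open>I\<close>, since
    the product locale wants a sigma-finite factor at every index.\<close>
  define h' where "h' l = (if l \<in> I then h l else indicator {0..1})" for l
  have "(\<integral>\<^sup>+ x. ennreal (indicat_real {0..1::real} x) \<partial>lborel) = emeasure lborel {0..1::real}"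
    unfolding ennreal_indicator by (rule nn_integral_indicator) simp
  also have "\<dots> = 1" by simp
  finally have "(\<integral>\<^sup>+ x. ennreal (indicat_real {0..1::real} x) \<partial>lborel) = 1" .
  then have pdf: "is_pdf (h' l)" for l
    using h by (auto simp: h'_def is_pdf_def)
  have [measurable]: "h' l \<in> borel_measurable borel" and h'0: "0 \<le> h' l y" for l y
    using pdf[of l] by (auto simp: is_pdf_def)
  have sf: "sigma_finite_measure (density lborel (\<lambda>y. ennreal (h' l y)))" for l
  proof -
    have "prob_space (density lborel (\<lambda>y. ennreal (h' l y)))"
      using pdf[of l] by (intro prob_spaceI) (auto simp: is_pdf_def emeasure_density)
    then show ?thesis
      by (simp add: prob_space_imp_sigma_finite)
  qed
  interpret D: product_sigma_finite "\<lambda>l. density lborel (\<lambda>y. ennreal (h' l y))"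
    by (rule product_sigma_finite.intro) (rule sf)
  interpret B: product_sigma_finite "\<lambda>_::'i. lborel :: real measure"
    by (rule product_sigma_finite.intro) (rule lborel.sigma_finite_measure_axioms)
  have "density (Pi\<^sub>M I (\<lambda>_. lborel)) (\<lambda>x. ennreal (\<Prod>l\<in>I. h' l (x l)))
      = Pi\<^sub>M I (\<lambda>l. density lborel (\<lambda>y. ennreal (h' l y)))"
  proof (rule D.PiM_eqI[OF I])
    show "sets (density (Pi\<^sub>M I (\<lambda>_. lborel)) (\<lambda>x. ennreal (\<Prod>l\<in>I. h' l (x l))))
      = sets (Pi\<^sub>M I (\<lambda>l. density lborel (\<lambda>y. ennreal (h' l y))))"
      by (simp cong: sets_PiM_cong)
    fix A assume A: "\<And>i. i \<in> I \<Longrightarrow> A i \<in> sets (density lborel (\<lambda>y. ennreal (h' i y)))"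
    then have A': "\<And>i. i \<in> I \<Longrightarrow> A i \<in> sets lborel" by simp
    have "emeasure (density (Pi\<^sub>M I (\<lambda>_. lborel)) (\<lambda>x. ennreal (\<Prod>l\<in>I. h' l (x l)))) (Pi\<^sub>E I A)
       = (\<integral>\<^sup>+ x. ennreal (\<Prod>l\<in>I. h' l (x l)) * indicator (Pi\<^sub>E I A) x \<partial>Pi\<^sub>M I (\<lambda>_. lborel))"
      using A' I by (intro emeasure_density) (auto intro!: sets_PiM_I_finite)
    also have "\<dots> = (\<integral>\<^sup>+ x. (\<Prod>l\<in>I. ennreal (h' l (x l)) * indicator (A l) (x l)) \<partial>Pi\<^sub>M I (\<lambda>_. lborel))"
    proof (rule nn_integral_cong)
      fix x assume "x \<in> space (Pi\<^sub>M I (\<lambda>_. lborel :: real measure))"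
      then have x: "x \<in> extensional I" by (auto simp: space_PiM PiE_def)
      have "indicator (Pi\<^sub>E I A) x = (\<Prod>l\<in>I. indicator (A l) (x l) :: ennreal)"
        using x I by (auto simp: indicator_def PiE_iff prod_zero_iff extensional_def)
      then show "ennreal (\<Prod>l\<in>I. h' l (x l)) * indicator (Pi\<^sub>E I A) x
          = (\<Prod>l\<in>I. ennreal (h' l (x l)) * indicator (A l) (x l))"
        by (simp add: prod.distrib prod_ennreal h'0)
    qed
    also have "\<dots> = (\<Prod>l\<in>I. \<integral>\<^sup>+ y. ennreal (h' l y) * indicator (A l) y \<partial>lborel)"
      using A' I by (intro B.product_nn_integral_prod) auto
    also have "\<dots> = (\<Prod>l\<in>I. emeasure (density lborel (\<lambda>y. ennreal (h' l y))) (A l))"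
      using A' by (intro prod.cong) (auto simp: emeasure_density)
    finally show "emeasure (density (Pi\<^sub>M I (\<lambda>_. lborel)) (\<lambda>x. ennreal (\<Prod>l\<in>I. h' l (x l)))) (Pi\<^sub>E I A)
       = (\<Prod>l\<in>I. emeasure (density lborel (\<lambda>y. ennreal (h' l y))) (A l))" .
  qed
  then show ?thesis
    by (simp add: h'_def cong: PiM_cong prod.cong)
qed

lemma prob_space_density_pdf: "is_pdf h \<Longrightarrow> prob_space (density lborel (\<lambda>y. ennreal (h y)))"
  by (intro prob_spaceI) (auto simp: is_pdf_def emeasure_density)

lemma obs_law_null:
  assumes "is_pdf g"
  shows "obs_law L (null_density g L) = Pi\<^sub>M {1..L} (\<lambda>_. density lborel (\<lambda>y. ennreal (g y)))"
  unfolding obs_law_def obs_space_def null_density_def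
  using assms by (intro density_PiM_lborel[where h = "\<lambda>_. g"]) auto

lemma anomaly_density_prod:
  assumes "A \<subseteq> {1..L}"
  shows "anomaly_density g f L A x = (\<Prod>l\<in>{1..L}. (if l \<in> A then f else g) (x l))"
proof -
  have "(\<Prod>l\<in>{1..L}. (if l \<in> A then f else g) (x l))
     = (\<Prod>l\<in>A. (if l \<in> A then f else g) (x l)) * (\<Prod>l\<in>{1..L} - A. (if l \<in> A then f else g) (x l))"
    using assms by (intro prod.subset_diff[THEN trans]) (auto simp: mult.commute)
  then show ?thesis
    unfolding anomaly_density_def by simp
qed

lemma obs_law_anomaly:
  assumes "is_pdf g" "is_pdf f" "A \<subseteq> {1..L}"
  shows "obs_law L (anomaly_density g f L A)
       = Pi\<^sub>M {1..L} (\<lambda>l. density lborel (\<lambda>y. ennreal ((if l \<in> A then f else g) y)))"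
  unfolding obs_law_def obs_space_def anomaly_density_prod[OF assms(3)]
  using assms by (intro density_PiM_lborel) auto

lemma prob_space_obs_null: "is_pdf g \<Longrightarrow> prob_space (obs_law L (null_density g L))"
  by (simp add: obs_law_null prob_space_PiM prob_space_density_pdf)

lemma prob_space_obs_anomaly:
  "is_pdf g \<Longrightarrow> is_pdf f \<Longrightarrow> A \<subseteq> {1..L} \<Longrightarrow> prob_space (obs_law L (anomaly_density g f L A))"
  by (simp add: obs_law_anomaly prob_space_PiM prob_space_density_pdf)

text \<open>Overwriting one coordinate by an independent draw from its own law preserves the product
  law. As \<open>I\<close> may be infinite, this serves the time axis as well as the sensors, and it
  reduces inequalities on sequence space to inequalities in one real variable.\<close>

lemma nn_integral_PiM_resample:
  assumes M: "\<And>i. i \<in> I \<Longrightarrow> prob_space (M i)" and i: "i \<in> I"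
    and f [measurable]: "f \<in> borel_measurable (Pi\<^sub>M I M)"
  shows "(\<integral>\<^sup>+ x. f x \<partial>Pi\<^sub>M I M) = (\<integral>\<^sup>+ x. (\<integral>\<^sup>+ y. f (x(i := y)) \<partial>M i) \<partial>Pi\<^sub>M I M)"
proof -
  have ins: "insert i I = I" using i by auto
  interpret Mi: prob_space "M i" by (rule M[OF i])
  interpret P: prob_space "Pi\<^sub>M I M" by (rule prob_space_PiM) (rule M)
  interpret pair_sigma_finite "M i" "Pi\<^sub>M I M" ..
  have eq: "distr (M i \<Otimes>\<^sub>M Pi\<^sub>M I M) (Pi\<^sub>M I M) (\<lambda>(x, X). X(i := x)) = Pi\<^sub>M I M"
    using distr_pair_PiM_eq_PiM[of I M i, OF M M[OF i]] by (simp add: ins)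
  have meas: "(\<lambda>(x, X). X(i := x)) \<in> measurable (M i \<Otimes>\<^sub>M Pi\<^sub>M I M) (Pi\<^sub>M I M)"
    using measurable_fun_upd[of I I i "\<lambda>p. snd p" "M i \<Otimes>\<^sub>M Pi\<^sub>M I M" M "\<lambda>p. fst p"] i
    by (auto simp: ins split_beta')
  have "(\<integral>\<^sup>+ x. f x \<partial>Pi\<^sub>M I M) = (\<integral>\<^sup>+ x. f x \<partial>distr (M i \<Otimes>\<^sub>M Pi\<^sub>M I M) (Pi\<^sub>M I M) (\<lambda>(x, X). X(i := x)))"
    by (simp only: eq)
  also have "\<dots> = (\<integral>\<^sup>+ p. f ((\<lambda>(x, X). X(i := x)) p) \<partial>(M i \<Otimes>\<^sub>M Pi\<^sub>M I M))"
    by (rule nn_integral_distr[OF meas]) simp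
  also have "\<dots> = (\<integral>\<^sup>+ X. (\<integral>\<^sup>+ x. f (X(i := x)) \<partial>M i) \<partial>Pi\<^sub>M I M)"
    using meas by (subst nn_integral_snd[symmetric]) (auto simp: split_beta' intro: measurable_compose)
  finally show ?thesis .
qed

text \<open>Chebyshev's association inequality for comonotone functions, with \<open>R\<close>
  normalised to mean 1. The order is that of the values of \<open>R\<close>, not of the real
  line.\<close>

lemma nn_integral_le_mult_comonotone:
  fixes \<phi> R :: "'a \<Rightarrow> real"
  assumes "prob_space G"
    and [measurable]: "\<phi> \<in> borel_measurable G" "R \<in> borel_measurable G"
    and \<phi>0: "\<And>y. 0 \<le> \<phi> y" and R0: "\<And>y. 0 \<le> R y"
    and R1: "(\<integral>\<^sup>+ y. ennreal (R y) \<partial>G) = 1"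
    and mono: "\<And>y y'. R y \<le> R y' \<Longrightarrow> \<phi> y \<le> \<phi> y'"
  shows "(\<integral>\<^sup>+ y. ennreal (\<phi> y) \<partial>G) \<le> (\<integral>\<^sup>+ y. ennreal (\<phi> y * R y) \<partial>G)"
proof -
  interpret prob_space G by fact
  \<comment> \<open>Otherwise \<open>1 - R\<close> would be a positive function with integral 0.
    Such a point bounds \<open>\<phi>\<close> on \<open>{y. R y < 1}\<close>, so the supremum
    \<open>c\<close> below is finite.\<close>
  have "\<exists>y. 1 \<le> R y"
  proof (rule ccontr)
    assume "\<nexists>y. 1 \<le> R y"
    then have lt: "R y < 1" for y by (auto simp: not_le)
    have "(\<integral>\<^sup>+ y. ennreal (1 - R y) \<partial>G) + (\<integral>\<^sup>+ y. ennreal (R y) \<partial>G) = (\<integral>\<^sup>+ y. ennreal (1 - R y) + ennreal (R y) \<partial>G)"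
      by (rule nn_integral_add[symmetric]) auto
    also have "\<dots> = 1"
      using lt R0 by (simp add: ennreal_plus[symmetric] less_imp_le emeasure_space_1 del: ennreal_plus)
    finally have "1 + (\<integral>\<^sup>+ y. ennreal (1 - R y) \<partial>G) = 1 + 0"
      by (simp add: R1 add.commute)
    then have "(\<integral>\<^sup>+ y. ennreal (1 - R y) \<partial>G) = 0"
      by (simp only: ennreal_add_left_cancel) simp
    then have "AE y in G. ennreal (1 - R y) = 0"
      by (subst (asm) nn_integral_0_iff_AE) auto
    then have "AE y in G. False"
      using lt by (auto simp: ennreal_eq_0_iff not_le[symmetric])
    then show False by simp
  qed
  then obtain y1 where y1: "1 \<le> R y1" by auto
  \<comment> \<open>\<open>c\<close> separates the values of \<open>\<phi>\<close> where
    \<open>R < 1\<close> from those where \<open>1 \<le> R\<close>, so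
    \<open>(\<phi> - c) * (R - 1)\<close> is nonnegative; integrating it gives the claim, since
    \<open>c\<close> cancels. The inserted 0 is for the case of an empty set.\<close>
  define c where "c = Sup (insert 0 (\<phi> ` {y. R y < 1}))"
  have bdd: "bdd_above (insert 0 (\<phi> ` {y. R y < 1}))"
    using y1 \<phi>0[of y1] by (intro bdd_aboveI[of _ "\<phi> y1"]) (auto intro!: mono)
  have c0: "0 \<le> c" unfolding c_def by (rule cSup_upper) (use bdd in auto)
  have lo: "\<phi> y \<le> c" if "R y < 1" for y
    unfolding c_def by (rule cSup_upper) (use bdd that in auto)
  have hi: "c \<le> \<phi> y" if "1 \<le> R y" for y
    unfolding c_def using \<phi>0 that by (intro cSup_least) (auto intro!: mono)
  have pt: "\<phi> y + c * R y \<le> \<phi> y * R y + c" for y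
  proof -
    have "0 \<le> (\<phi> y - c) * (R y - 1)"
      using lo[of y] hi[of y] by (cases "R y < 1") (auto intro: mult_nonpos_nonpos mult_nonneg_nonneg)
    then show ?thesis by (simp add: algebra_simps)
  qed
  have "(\<integral>\<^sup>+ y. ennreal (\<phi> y) \<partial>G) + ennreal c = (\<integral>\<^sup>+ y. ennreal (\<phi> y) \<partial>G) + (\<integral>\<^sup>+ y. ennreal c * ennreal (R y) \<partial>G)"
    by (simp add: nn_integral_cmult R1)
  also have "\<dots> = (\<integral>\<^sup>+ y. ennreal (\<phi> y) + ennreal c * ennreal (R y) \<partial>G)"
    by (rule nn_integral_add[symmetric]) auto
  also have "\<dots> \<le> (\<integral>\<^sup>+ y. ennreal (\<phi> y * R y) + ennreal c \<partial>G)"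
    using pt \<phi>0 R0 c0
    by (intro nn_integral_mono) (simp add: ennreal_mult[symmetric] ennreal_plus[symmetric] del: ennreal_plus)
  also have "\<dots> = (\<integral>\<^sup>+ y. ennreal (\<phi> y * R y) \<partial>G) + ennreal c"
    by (subst nn_integral_add) (auto simp: emeasure_space_1)
  finally show ?thesis
    by (simp add: add.commute[of _ "ennreal c"] ennreal_add_left_cancel_le)
qed

section \<open>Stochastic monotonicity of sensorwise likelihood ratios\<close>

text \<open>The normalised elementary symmetric polynomial of degree \<open>s\<close> in the
  sensorwise ratios. For \<open>R = f / g\<close> it is the likelihood ratio of the mixture over all
  anomalies of size \<open>s\<close> against the null density.\<close>

definition esym_mean :: "nat \<Rightarrow> (real \<Rightarrow> real) \<Rightarrow> nat \<Rightarrow> (nat \<Rightarrow> real) \<Rightarrow> real" where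
  "esym_mean L R s x = (\<Sum>A | A \<subseteq> {1..L} \<and> card A = s. \<Prod>l\<in>A. R (x l)) / real (L choose s)"

text \<open>Double counting: a set of size \<open>Suc s\<close> arises as \<open>insert a A\<close>
  in exactly \<open>Suc s\<close> ways, one for each choice of its element \<open>a\<close>.\<close>

lemma sum_card_Suc_subsets:
  fixes F :: "'a set \<Rightarrow> 'b::comm_semiring_1"
  assumes "finite X"
  shows "(\<Sum>A | A \<subseteq> X \<and> card A = s. \<Sum>a\<in>X - A. F (insert a A))
       = of_nat (Suc s) * (\<Sum>A | A \<subseteq> X \<and> card A = Suc s. F A)"
proof -
  have fin: "finite {A. A \<subseteq> X \<and> card A = k}" for k
    using assms by simp
  have finA: "finite A" if "A \<subseteq> X" for A using that assms finite_subset by auto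
  have "(\<Sum>A | A \<subseteq> X \<and> card A = s. \<Sum>a\<in>X - A. F (insert a A))
      = (\<Sum>(A, a)\<in>Sigma {A. A \<subseteq> X \<and> card A = s} (\<lambda>A. X - A). F (insert a A))"
    using fin assms by (subst sum.Sigma) auto
  also have "\<dots> = (\<Sum>(B, a)\<in>Sigma {A. A \<subseteq> X \<and> card A = Suc s} (\<lambda>A. A). F B)"
    by (rule sum.reindex_bij_witness[where j = "\<lambda>(A, a). (insert a A, a)" and i = "\<lambda>(B, a). (B - {a}, a)"])
       (auto simp: finA card_insert_if insert_absorb)
  also have "\<dots> = (\<Sum>A | A \<subseteq> X \<and> card A = Suc s. \<Sum>a\<in>A. F A)"
    using fin finA by (subst sum.Sigma) auto
  also have "\<dots> = of_nat (Suc s) * (\<Sum>A | A \<subseteq> X \<and> card A = Suc s. F A)"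
    by (simp add: sum_distrib_left)
  finally show ?thesis .
qed

text \<open>\<open>G\<close> is the pre-change law of one sensor and \<open>R\<close> a substitute
  for f / g. Only its mean 1 is assumed, so that it can be chosen larger than f / g when f / g
  itself has a smaller mean under \<open>G\<close>.\<close>

locale ratio_product =
  fixes G :: "real measure" and R :: "real \<Rightarrow> real" and L :: nat
  assumes prob_G: "prob_space G" and sets_G: "sets G = sets borel"
    and R_meas [measurable]: "R \<in> borel_measurable borel" and R_nonneg: "\<And>y. 0 \<le> R y"
    and R_mean: "(\<integral>\<^sup>+ y. ennreal (R y) \<partial>G) = 1"
begin

definition "obs = Pi\<^sub>M {1..L} (\<lambda>_. G)"
definition "\<mu> = Pi\<^sub>M {1::nat..} (\<lambda>_. obs)"

lemma prob_obs: "prob_space obs"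
  unfolding obs_def by (intro prob_space_PiM prob_G)

lemma prob_\<mu>: "prob_space \<mu>"
  unfolding \<mu>_def by (intro prob_space_PiM prob_obs)

lemma R_meas_G [measurable]: "R \<in> borel_measurable G"
  using sets_G R_meas measurable_cong_sets by blast

lemma meas_component [measurable]: "1 \<le> k \<Longrightarrow> (\<lambda>w. w k) \<in> measurable \<mu> obs"
  unfolding \<mu>_def by (rule measurable_component_singleton) auto

lemma meas_sensor [measurable]: "l \<in> {1..L} \<Longrightarrow> (\<lambda>x. x l) \<in> measurable obs G"
  unfolding obs_def by (rule measurable_component_singleton)

lemma esym_meas [measurable]: "esym_mean L R s \<in> borel_measurable obs"
proof -
  have "(\<lambda>x. R (x l)) \<in> borel_measurable obs" if "l \<in> {1..L}" for l
    using that by measurable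
  then show ?thesis
    unfolding esym_mean_def by (intro borel_measurable_divide borel_measurable_sum borel_measurable_prod) auto
qed

lemma esym_nonneg: "0 \<le> esym_mean L R s x"
  unfolding esym_mean_def by (intro divide_nonneg_nonneg sum_nonneg prod_nonneg) (auto simp: R_nonneg)

lemma esym_0: "esym_mean L R 0 x = 1"
proof -
  have "{A. A \<subseteq> {1..L} \<and> card A = 0} = {{}}"
    using finite_subset by (auto simp: card_eq_0_iff)
  then show ?thesis by (simp add: esym_mean_def)
qed

lemma update_meas:
  assumes "1 \<le> k" "a \<in> {1..L}" "w \<in> space \<mu>" "z \<in> space obs"
  shows "(\<lambda>y. w(k := (z(a := y)))) \<in> measurable G \<mu>"
proof -
  have 1: "{1..L} = {1..L} \<union> {a}" using assms by auto
  have 2: "{1::nat..} = {1..} \<union> {k}" using assms by auto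
  have "(\<lambda>y. z(a := y)) \<in> measurable G obs"
    unfolding obs_def using assms
    by (intro measurable_fun_upd[OF 1]) (auto simp: obs_def)
  then show ?thesis
    unfolding \<mu>_def using assms
    by (intro measurable_fun_upd[OF 2]) (auto simp: \<mu>_def)
qed

lemma resample:
  assumes k: "1 \<le> k" "a \<in> {1..L}" and f [measurable]: "f \<in> borel_measurable \<mu>"
  shows "(\<integral>\<^sup>+ w. f w \<partial>\<mu>) = (\<integral>\<^sup>+ w. (\<integral>\<^sup>+ z. (\<integral>\<^sup>+ y. f (w(k := (z(a := y)))) \<partial>G) \<partial>obs) \<partial>\<mu>)"
proof -
  have 2: "{1::nat..} = {1..} \<union> {k}" using k by auto
  have "(\<integral>\<^sup>+ w. f w \<partial>\<mu>) = (\<integral>\<^sup>+ w. (\<integral>\<^sup>+ z. f (w(k := z)) \<partial>obs) \<partial>\<mu>)"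
    using f k unfolding \<mu>_def by (intro nn_integral_PiM_resample) (auto simp: prob_obs)
  also have "\<dots> = (\<integral>\<^sup>+ w. (\<integral>\<^sup>+ z. (\<integral>\<^sup>+ y. f (w(k := (z(a := y)))) \<partial>G) \<partial>obs) \<partial>\<mu>)"
  proof (rule nn_integral_cong)
    fix w assume w: "w \<in> space \<mu>"
    have "(\<lambda>z. w(k := z)) \<in> measurable obs \<mu>"
      unfolding \<mu>_def using w k by (intro measurable_fun_upd[OF 2]) (auto simp: \<mu>_def)
    then have "(\<lambda>z. f (w(k := z))) \<in> borel_measurable obs"
      by (rule measurable_compose) simp
    then show "(\<integral>\<^sup>+ z. f (w(k := z)) \<partial>obs) = (\<integral>\<^sup>+ z. (\<integral>\<^sup>+ y. f (w(k := (z(a := y)))) \<partial>G) \<partial>obs)"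
      using k prob_G unfolding obs_def by (intro nn_integral_PiM_resample) auto
  qed
  finally show ?thesis .
qed

text \<open>Monotone in each single observation, ordered by its ratio \<open>R\<close>. Since equal
  ratios can be exchanged both ways, such a function depends on an observation at a time
  \<open>k \<ge> 1\<close> only through its ratio.\<close>

definition inc :: "((nat \<Rightarrow> nat \<Rightarrow> real) \<Rightarrow> real) \<Rightarrow> bool" where
  "inc \<Phi> \<longleftrightarrow> (\<forall>w k l y. 1 \<le> k \<longrightarrow> l \<in> {1..L} \<longrightarrow> R (w k l) \<le> R y \<longrightarrow>
     \<Phi> w \<le> \<Phi> (w(k := (w k)(l := y))))"

lemma inc_mult: "inc \<Phi> \<Longrightarrow> inc \<Psi> \<Longrightarrow> (\<And>w. 0 \<le> \<Phi> w) \<Longrightarrow> (\<And>w. 0 \<le> \<Psi> w) \<Longrightarrow> inc (\<lambda>w. \<Phi> w * \<Psi> w)"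
  unfolding inc_def by (metis mult_mono order_trans)

lemma inc_sum: "(\<And>i. i \<in> I \<Longrightarrow> inc (F i)) \<Longrightarrow> inc (\<lambda>w. \<Sum>i\<in>I. F i w)"
  unfolding inc_def by (auto intro!: sum_mono)

lemma inc_prod: "(\<And>i. i \<in> I \<Longrightarrow> inc (F i)) \<Longrightarrow> (\<And>i w. i \<in> I \<Longrightarrow> 0 \<le> F i w) \<Longrightarrow> inc (\<lambda>w. \<Prod>i\<in>I. F i w)"
  unfolding inc_def by (auto intro!: prod_mono)

lemma inc_const: "inc (\<lambda>_. c)"
  by (simp add: inc_def)

lemma inc_cmult: "inc \<Phi> \<Longrightarrow> 0 \<le> c \<Longrightarrow> inc (\<lambda>w. c * \<Phi> w)"
  unfolding inc_def by (auto intro!: mult_left_mono)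

lemma inc_R: "inc (\<lambda>w. R (w k l))"
  unfolding inc_def by auto

lemma inc_esym: "inc (\<lambda>w. esym_mean L R s (w k))"
proof -
  have "inc (\<lambda>w. (1 / real (L choose s)) * (\<Sum>A | A \<subseteq> {1..L} \<and> card A = s. \<Prod>l\<in>A. R (w k l)))"
    by (intro inc_cmult inc_sum inc_prod inc_R) (auto simp: R_nonneg)
  then show ?thesis by (simp add: esym_mean_def)
qed

text \<open>The association inequality for one sensor at one time: all other observations are frozen
  and this one is drawn afresh.\<close>

lemma nn_integral_le_mult_R:
  assumes k: "1 \<le> k" "a \<in> {1..L}"
    and [measurable]: "\<Psi> \<in> borel_measurable \<mu>" and \<Psi>0: "\<And>w. 0 \<le> \<Psi> w"
    and mono: "\<And>w y. R (w k a) \<le> R y \<Longrightarrow> \<Psi> w \<le> \<Psi> (w(k := (w k)(a := y)))"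
  shows "(\<integral>\<^sup>+ w. ennreal (\<Psi> w) \<partial>\<mu>) \<le> (\<integral>\<^sup>+ w. ennreal (\<Psi> w * R (w k a)) \<partial>\<mu>)"
proof -
  have [measurable]: "(\<lambda>w. R (w k a)) \<in> borel_measurable \<mu>" using k by measurable
  have "(\<integral>\<^sup>+ w. ennreal (\<Psi> w) \<partial>\<mu>)
     = (\<integral>\<^sup>+ w. (\<integral>\<^sup>+ z. (\<integral>\<^sup>+ y. ennreal (\<Psi> (w(k := (z(a := y))))) \<partial>G) \<partial>obs) \<partial>\<mu>)"
    by (rule resample[OF k]) simp
  also have "\<dots> \<le> (\<integral>\<^sup>+ w. (\<integral>\<^sup>+ z. (\<integral>\<^sup>+ y. ennreal (\<Psi> (w(k := (z(a := y)))) * R y) \<partial>G) \<partial>obs) \<partial>\<mu>)"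
  proof (rule nn_integral_mono, rule nn_integral_mono)
    fix w z assume w: "w \<in> space \<mu>" "z \<in> space obs"
    have m: "(\<lambda>y. \<Psi> (w(k := (z(a := y))))) \<in> borel_measurable G"
      using update_meas[OF k w] by (rule measurable_compose) simp
    show "(\<integral>\<^sup>+ y. ennreal (\<Psi> (w(k := (z(a := y))))) \<partial>G) \<le> (\<integral>\<^sup>+ y. ennreal (\<Psi> (w(k := (z(a := y)))) * R y) \<partial>G)"
    proof (rule nn_integral_le_mult_comonotone[OF prob_G m R_meas_G \<Psi>0 R_nonneg R_mean])
      fix y y' assume "R y \<le> R y'"
      then show "\<Psi> (w(k := (z(a := y)))) \<le> \<Psi> (w(k := (z(a := y'))))"
        using mono[of "w(k := (z(a := y)))" y'] by simp
    qed
  qed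
  also have "\<dots> = (\<integral>\<^sup>+ w. (\<integral>\<^sup>+ z. (\<integral>\<^sup>+ y. ennreal (\<Psi> (w(k := (z(a := y)))) * R ((w(k := (z(a := y)))) k a)) \<partial>G) \<partial>obs) \<partial>\<mu>)"
    by simp
  also have "\<dots> = (\<integral>\<^sup>+ w. ennreal (\<Psi> w * R (w k a)) \<partial>\<mu>)"
    by (rule resample[OF k, symmetric]) simp
  finally show ?thesis .
qed

lemma nn_integral_mult_R_indep:
  assumes k: "1 \<le> k" "a \<in> {1..L}"
    and [measurable]: "\<Psi> \<in> borel_measurable \<mu>" and \<Psi>0: "\<And>w. 0 \<le> \<Psi> w"
    and indep: "\<And>w y. \<Psi> (w(k := (w k)(a := y))) = \<Psi> w"
  shows "(\<integral>\<^sup>+ w. ennreal (\<Psi> w * R (w k a)) \<partial>\<mu>) = (\<integral>\<^sup>+ w. ennreal (\<Psi> w) \<partial>\<mu>)"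
proof -
  interpret G: prob_space G by (rule prob_G)
  have [measurable]: "(\<lambda>w. R (w k a)) \<in> borel_measurable \<mu>" using k by measurable
  have c: "\<Psi> (w(k := (z(a := y)))) = \<Psi> (w(k := z))" for w z y
    using indep[of "w(k := z)" y] by simp
  have "(\<integral>\<^sup>+ w. ennreal (\<Psi> w * R (w k a)) \<partial>\<mu>)
     = (\<integral>\<^sup>+ w. (\<integral>\<^sup>+ z. (\<integral>\<^sup>+ y. ennreal (\<Psi> (w(k := (z(a := y)))) * R ((w(k := (z(a := y)))) k a)) \<partial>G) \<partial>obs) \<partial>\<mu>)"
    by (rule resample[OF k]) simp
  also have "\<dots> = (\<integral>\<^sup>+ w. (\<integral>\<^sup>+ z. ennreal (\<Psi> (w(k := z))) * (\<integral>\<^sup>+ y. ennreal (R y) \<partial>G) \<partial>obs) \<partial>\<mu>)"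
    by (simp add: c \<Psi>0 R_nonneg ennreal_mult nn_integral_cmult)
  also have "\<dots> = (\<integral>\<^sup>+ w. (\<integral>\<^sup>+ z. (\<integral>\<^sup>+ y. ennreal (\<Psi> (w(k := (z(a := y))))) \<partial>G) \<partial>obs) \<partial>\<mu>)"
    by (simp add: R_mean c G.emeasure_space_1)
  also have "\<dots> = (\<integral>\<^sup>+ w. ennreal (\<Psi> w) \<partial>\<mu>)"
    by (rule resample[OF k, symmetric]) simp
  finally show ?thesis .
qed

definition E :: "((nat \<Rightarrow> nat \<Rightarrow> real) \<Rightarrow> real) \<Rightarrow> ennreal" where
  "E \<Phi> = (\<integral>\<^sup>+ w. ennreal (\<Phi> w) \<partial>\<mu>)"

lemma E_cmult: "0 \<le> c \<Longrightarrow> (\<And>w. 0 \<le> \<Phi> w) \<Longrightarrow> \<Phi> \<in> borel_measurable \<mu> \<Longrightarrow> E (\<lambda>w. c * \<Phi> w) = ennreal c * E \<Phi>"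
  unfolding E_def by (simp add: ennreal_mult nn_integral_cmult)

lemma E_sum: "finite I \<Longrightarrow> (\<And>i w. i \<in> I \<Longrightarrow> 0 \<le> F i w) \<Longrightarrow> (\<And>i. i \<in> I \<Longrightarrow> F i \<in> borel_measurable \<mu>) \<Longrightarrow>
    E (\<lambda>w. \<Sum>i\<in>I. F i w) = (\<Sum>i\<in>I. E (F i))"
  unfolding E_def by (subst nn_integral_sum[symmetric]) (auto simp: sum_ennreal intro!: nn_integral_cong)

lemma prod_R_meas: "1 \<le> k \<Longrightarrow> A \<subseteq> {1..L} \<Longrightarrow> (\<lambda>w. \<Prod>l\<in>A. R (w k l)) \<in> borel_measurable \<mu>"
proof (intro borel_measurable_prod)
  fix l assume "1 \<le> k" "A \<subseteq> {1..L}" "l \<in> A"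
  then have "l \<in> {1..L}" by auto
  with \<open>1 \<le> k\<close> show "(\<lambda>w. R (w k l)) \<in> borel_measurable \<mu>" by measurable
qed

lemma E_mult_esym_sum:
  assumes "1 \<le> k" "\<Psi> \<in> borel_measurable \<mu>" "\<And>w. 0 \<le> \<Psi> w"
  shows "E (\<lambda>w. \<Psi> w * esym_mean L R s (w k))
     = ennreal (1 / real (L choose s)) * (\<Sum>A | A \<subseteq> {1..L} \<and> card A = s. E (\<lambda>w. \<Psi> w * (\<Prod>l\<in>A. R (w k l))))"
proof -
  have "E (\<lambda>w. \<Psi> w * esym_mean L R s (w k))
    = E (\<lambda>w. (1 / real (L choose s)) * (\<Sum>A | A \<subseteq> {1..L} \<and> card A = s. \<Psi> w * (\<Prod>l\<in>A. R (w k l))))"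
    by (simp add: esym_mean_def sum_distrib_left[symmetric] mult_ac)
  also have "\<dots> = ennreal (1 / real (L choose s)) * E (\<lambda>w. \<Sum>A | A \<subseteq> {1..L} \<and> card A = s. \<Psi> w * (\<Prod>l\<in>A. R (w k l)))"
    using assms prod_R_meas by (intro E_cmult) (auto intro!: sum_nonneg mult_nonneg_nonneg prod_nonneg simp: R_nonneg)
  also have "E (\<lambda>w. \<Sum>A | A \<subseteq> {1..L} \<and> card A = s. \<Psi> w * (\<Prod>l\<in>A. R (w k l)))
     = (\<Sum>A | A \<subseteq> {1..L} \<and> card A = s. E (\<lambda>w. \<Psi> w * (\<Prod>l\<in>A. R (w k l))))"
    using assms prod_R_meas by (intro E_sum) (auto intro!: mult_nonneg_nonneg prod_nonneg simp: R_nonneg)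
  finally show ?thesis .
qed

text \<open>One more anomalous sensor \<open>a\<close> multiplies the integrand by its ratio, which
  does not lower the mean because the rest is still nondecreasing in that ratio. Summing over all
  pairs of \<open>A\<close> and \<open>a\<close> passes from size \<open>s\<close> to size
  \<open>Suc s\<close>, and the normalisations agree because
  \<open>(L - s) * (L choose s) = Suc s * (L choose Suc s)\<close>.\<close>

lemma E_esym_mono_Suc:
  assumes k: "1 \<le> k" and s: "Suc s \<le> L"
    and \<Psi> [measurable]: "\<Psi> \<in> borel_measurable \<mu>" and \<Psi>0: "\<And>w. 0 \<le> \<Psi> w" and inc: "inc \<Psi>"
  shows "E (\<lambda>w. \<Psi> w * esym_mean L R s (w k)) \<le> E (\<lambda>w. \<Psi> w * esym_mean L R (Suc s) (w k))"
proof -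
  let ?F = "\<lambda>A. E (\<lambda>w. \<Psi> w * (\<Prod>l\<in>A. R (w k l)))"
  let ?S = "\<lambda>s. {A. A \<subseteq> {1..L} \<and> card A = s}"
  have step: "?F A \<le> ?F (insert a A)" if A: "A \<subseteq> {1..L}" "a \<in> {1..L} - A" for A a
  proof -
    have fin: "finite A" using A finite_subset by auto
    have "?F A \<le> E (\<lambda>w. (\<Psi> w * (\<Prod>l\<in>A. R (w k l))) * R (w k a))"
      unfolding E_def
    proof (rule nn_integral_le_mult_R[OF k])
      show "a \<in> {1..L}" using A by auto
      show "(\<lambda>w. \<Psi> w * (\<Prod>l\<in>A. R (w k l))) \<in> borel_measurable \<mu>"
        using prod_R_meas[OF k A(1)] by measurable
      show "0 \<le> \<Psi> w * (\<Prod>l\<in>A. R (w k l))" for w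
        by (intro mult_nonneg_nonneg \<Psi>0 prod_nonneg) (auto simp: R_nonneg)
      fix w y assume "R (w k a) \<le> R y"
      then have "\<Psi> w \<le> \<Psi> (w(k := (w k)(a := y)))"
        using inc k A unfolding inc_def by auto
      moreover have "(\<Prod>l\<in>A. R ((w(k := (w k)(a := y))) k l)) = (\<Prod>l\<in>A. R (w k l))"
        using A by (intro prod.cong) auto
      ultimately show "\<Psi> w * (\<Prod>l\<in>A. R (w k l))
          \<le> \<Psi> (w(k := (w k)(a := y))) * (\<Prod>l\<in>A. R ((w(k := (w k)(a := y))) k l))"
        by (auto intro!: mult_right_mono prod_nonneg simp: R_nonneg)
    qed
    also have "\<dots> = ?F (insert a A)"
      using A fin by (simp add: mult_ac)
    finally show ?thesis .
  qed
  have cardX: "card ({1..L} - A) = L - s" if "A \<in> ?S s" for A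
    using that finite_subset[of A] by (subst card_Diff_subset) auto
  have "ennreal (real (L - s)) * (\<Sum>A\<in>?S s. ?F A) = (\<Sum>A\<in>?S s. \<Sum>a\<in>{1..L} - A. ?F A)"
    unfolding sum_distrib_left
    by (intro sum.cong refl) (simp only: sum_constant cardX ennreal_of_nat_eq_real_of_nat)
  also have "\<dots> \<le> (\<Sum>A\<in>?S s. \<Sum>a\<in>{1..L} - A. ?F (insert a A))"
    by (intro sum_mono step) auto
  also have "\<dots> = ennreal (real (Suc s)) * (\<Sum>A\<in>?S (Suc s). ?F A)"
    unfolding ennreal_of_nat_eq_real_of_nat[symmetric] by (rule sum_card_Suc_subsets) simp
  finally have main: "ennreal (real (L - s)) * (\<Sum>A\<in>?S s. ?F A) \<le> ennreal (real (Suc s)) * (\<Sum>A\<in>?S (Suc s). ?F A)" .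
  have ch: "(L - s) * (L choose s) = Suc s * (L choose Suc s)"
    by (metis binomial_absorb_comp binomial_absorption)
  have Ls: "0 < L - s" "0 < L choose s" "0 < L choose Suc s" using s by auto
  have ch': "1 / real (L choose s) = (1 / (real (Suc s) * real (L choose Suc s))) * real (L - s)"
  proof -
    have "real (L - s) * real (L choose s) = real (Suc s) * real (L choose Suc s)"
      using ch by (metis of_nat_mult)
    moreover have "real (L choose s) \<noteq> 0" "real (Suc s) * real (L choose Suc s) \<noteq> 0"
      using Ls by auto
    ultimately show ?thesis by (simp add: field_simps)
  qed
  have "E (\<lambda>w. \<Psi> w * esym_mean L R s (w k)) = ennreal (1 / real (L choose s)) * (\<Sum>A\<in>?S s. ?F A)"
    by (rule E_mult_esym_sum[OF k \<Psi> \<Psi>0])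
  also have "\<dots> = ennreal (1 / (real (Suc s) * real (L choose Suc s))) * (ennreal (real (L - s)) * (\<Sum>A\<in>?S s. ?F A))"
    unfolding ch' by (subst ennreal_mult) (auto simp: mult_ac)
  also have "\<dots> \<le> ennreal (1 / (real (Suc s) * real (L choose Suc s))) * (ennreal (real (Suc s)) * (\<Sum>A\<in>?S (Suc s). ?F A))"
    by (intro mult_left_mono main) simp
  also have "\<dots> = ennreal (1 / real (L choose Suc s)) * (\<Sum>A\<in>?S (Suc s). ?F A)"
  proof -
    have "1 / (real (Suc s) * c) * real (Suc s) = 1 / c" for c
      by (simp del: of_nat_Suc)
    then have "ennreal (1 / (real (Suc s) * real (L choose Suc s))) * ennreal (real (Suc s)) = ennreal (1 / real (L choose Suc s))"
      by (subst ennreal_mult[symmetric]) (auto simp del: of_nat_Suc)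
    then show ?thesis by (simp add: mult.assoc[symmetric])
  qed
  also have "\<dots> = E (\<lambda>w. \<Psi> w * esym_mean L R (Suc s) (w k))"
    by (rule E_mult_esym_sum[OF k \<Psi> \<Psi>0, symmetric])
  finally show ?thesis .
qed

lemma E_esym_ge:
  assumes k: "1 \<le> k" and s: "s \<le> L"
    and \<Psi> [measurable]: "\<Psi> \<in> borel_measurable \<mu>" and \<Psi>0: "\<And>w. 0 \<le> \<Psi> w" and inc: "inc \<Psi>"
  shows "E \<Psi> \<le> E (\<lambda>w. \<Psi> w * esym_mean L R s (w k))"
  using s
proof (induction s)
  case 0
  then show ?case by (simp add: esym_0)
next
  case (Suc s)
  then show ?case
    using E_esym_mono_Suc[OF k _ \<Psi> \<Psi>0 inc, of s] by auto
qed

lemma E_esym_indep: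
  assumes k: "1 \<le> k" and s: "s \<le> L"
    and \<Psi> [measurable]: "\<Psi> \<in> borel_measurable \<mu>" and \<Psi>0: "\<And>w. 0 \<le> \<Psi> w"
    and indep: "\<And>w z. \<Psi> (w(k := z)) = \<Psi> w"
  shows "E (\<lambda>w. \<Psi> w * esym_mean L R s (w k)) = E \<Psi>"
proof -
  have F: "E (\<lambda>w. \<Psi> w * (\<Prod>l\<in>A. R (w k l))) = E \<Psi>" if "finite A" "A \<subseteq> {1..L}" for A
    using that
  proof (induction A)
    case (insert a A)
    have "E (\<lambda>w. \<Psi> w * (\<Prod>l\<in>insert a A. R (w k l))) = E (\<lambda>w. (\<Psi> w * (\<Prod>l\<in>A. R (w k l))) * R (w k a))"
      using insert by (simp add: mult_ac)
    also have "\<dots> = E (\<lambda>w. \<Psi> w * (\<Prod>l\<in>A. R (w k l)))"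
      unfolding E_def
    proof (rule nn_integral_mult_R_indep[OF k])
      show "a \<in> {1..L}" using insert by auto
      show "(\<lambda>w. \<Psi> w * (\<Prod>l\<in>A. R (w k l))) \<in> borel_measurable \<mu>"
        using prod_R_meas[OF k, of A] insert by simp
      show "0 \<le> \<Psi> w * (\<Prod>l\<in>A. R (w k l))" for w
        by (intro mult_nonneg_nonneg \<Psi>0 prod_nonneg) (auto simp: R_nonneg)
      fix w :: "nat \<Rightarrow> nat \<Rightarrow> real" and y
      have "(\<Prod>l\<in>A. R ((w(k := (w k)(a := y))) k l)) = (\<Prod>l\<in>A. R (w k l))"
        using insert by (intro prod.cong) auto
      then show "\<Psi> (w(k := (w k)(a := y))) * (\<Prod>l\<in>A. R ((w(k := (w k)(a := y))) k l))
          = \<Psi> w * (\<Prod>l\<in>A. R (w k l))"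
        by (simp add: indep)
    qed
    finally show ?case using insert by simp
  qed simp
  have cardS: "card {A. A \<subseteq> {1..L} \<and> card A = s} = L choose s"
    using n_subsets[of "{1..L}" s] by simp
  have "E (\<lambda>w. \<Psi> w * esym_mean L R s (w k))
     = ennreal (1 / real (L choose s)) * (\<Sum>A | A \<subseteq> {1..L} \<and> card A = s. E \<Psi>)"
    unfolding E_mult_esym_sum[OF k \<Psi> \<Psi>0]
    by (intro arg_cong2[where f = "(*)"] sum.cong refl F) (auto intro: finite_subset)
  also have "\<dots> = ennreal (1 / real (L choose s)) * (ennreal (real (L choose s)) * E \<Psi>)"
    by (simp only: sum_constant cardS ennreal_of_nat_eq_real_of_nat)
  also have "\<dots> = ennreal ((1 / real (L choose s)) * real (L choose s)) * E \<Psi>"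
    by (subst ennreal_mult) (auto simp: mult.assoc)
  also have "\<dots> = E \<Psi>"
    using s by simp
  finally show ?thesis .
qed

end

section \<open>Path densities\<close>

text \<open>\<open>N\<close> is the number of phases and \<open>r\<close> is the sequence \<rho>
  extended by its boundary values. The bound on \<open>m + N\<close> says that the last anomaly size
  \<open>m + N - 1\<close> is at most \<open>L\<close>.\<close>

locale phase_chain = ratio_product +
  fixes m N :: nat and r :: "nat \<Rightarrow> real"
  assumes N1: "1 \<le> N" and m1: "1 \<le> m" and mN: "m + N \<le> Suc L"
    and r0: "r 0 = 1" and rN: "r N = 0" and r_bounds: "\<And>i. i \<in> {1..<N} \<Longrightarrow> 0 < r i \<and> r i < 1"
begin

definition "Lm i = esym_mean L R (m + i - 1)"

lemma Lm_meas [measurable]: "Lm i \<in> borel_measurable obs"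
  unfolding Lm_def by measurable

lemma Lm_nonneg: "0 \<le> Lm i x"
  unfolding Lm_def by (rule esym_nonneg)

lemma inc_Lm: "inc (\<lambda>w. Lm i (w k))"
  unfolding Lm_def by (rule inc_esym)

lemma r_range: "i \<le> N \<Longrightarrow> 0 \<le> r i \<and> r i \<le> 1"
  using r0 rN r_bounds[of i] by (cases "i = 0 \<or> i = N") auto

lemma r_pos: "i < N \<Longrightarrow> 0 < r i"
  using r0 r_bounds[of i] by (cases "i = 0") auto

text \<open>The probability that a chain in phase \<open>j\<close> moves to phase \<open>l\<close>
  in one step: it leaves each of \<open>j, ..., l - 1\<close> with probability \<open>r\<close>, and
  then stays. The value \<open>r 0 = 1\<close> forces it out of the idle state 0, and
  \<open>r N = 0\<close> keeps it in the last phase.\<close>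

definition coef :: "nat \<Rightarrow> nat \<Rightarrow> real" where
  "coef j l = (1 - r l) * (\<Prod>s\<in>{j..<l}. r s)"

lemma coef_nonneg: "l \<le> N \<Longrightarrow> 0 \<le> coef j l"
  unfolding coef_def using r_range by (intro mult_nonneg_nonneg prod_nonneg) auto

lemma coef_Suc: "j < l \<Longrightarrow> coef j l = r j * coef (Suc j) l"
  unfolding coef_def by (simp add: prod.atLeast_Suc_lessThan)

text \<open>The one-step transition operator of this chain, applied to a function \<open>c\<close>
  of the next phase.\<close>

definition TE :: "nat \<Rightarrow> (nat \<Rightarrow> ennreal) \<Rightarrow> ennreal" where
  "TE j c = (\<Sum>l\<in>{j..N}. ennreal (coef j l) * c l)"

lemma TE_N: "TE N c = c N"
  by (simp add: TE_def coef_def rN)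

lemma TE_step:
  assumes "j < N"
  shows "TE j c = ennreal (1 - r j) * c j + ennreal (r j) * TE (Suc j) c"
proof -
  have "TE j c = ennreal (coef j j) * c j + (\<Sum>l\<in>{Suc j..N}. ennreal (coef j l) * c l)"
    unfolding TE_def using assms by (intro sum.atLeast_Suc_atMost) simp
  also have "(\<Sum>l\<in>{Suc j..N}. ennreal (coef j l) * c l) = (\<Sum>l\<in>{Suc j..N}. ennreal (r j) * (ennreal (coef (Suc j) l) * c l))"
    using r_range[of j] assms
    by (intro sum.cong refl) (auto simp: coef_Suc ennreal_mult coef_nonneg mult.assoc)
  finally show ?thesis
    by (simp add: TE_def[of "Suc j"] sum_distrib_left coef_def[of j j])
qed

lemma ennreal_convex_self:
  assumes "0 \<le> a" "a \<le> 1"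
  shows "ennreal (1 - a) * X + ennreal a * X = X"
  using assms by (simp add: distrib_right[symmetric] ennreal_plus[symmetric] del: ennreal_plus)

lemma TE_const: "j \<le> N \<Longrightarrow> TE j (\<lambda>_. e) = e"
proof (induction rule: inc_induct)
  case base
  then show ?case by (simp add: TE_N)
next
  case (step j)
  then have "0 \<le> r j" "r j \<le> 1" using r_range[of j] by auto
  then show ?case
    using ennreal_convex_self[of "r j" e] step by (subst TE_step) auto
qed

lemma TE_0_1: "TE 0 c = TE 1 c"
  using N1 by (subst TE_step) (auto simp: r0)

lemma TE_ge:
  assumes c: "\<And>l. l \<in> {1..N} \<Longrightarrow> e \<le> c l" and "j \<le> N"
  shows "e \<le> TE j c"
proof -
  have *: "e \<le> TE j c" if "1 \<le> j" "j \<le> N" for j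
  proof -
    have "e = TE j (\<lambda>_. e)" using that by (simp add: TE_const)
    also have "\<dots> \<le> TE j c"
      unfolding TE_def using c that by (intro sum_mono mult_left_mono) auto
    finally show ?thesis .
  qed
  show ?thesis
    using *[of j] *[of 1] N1 assms(2) TE_0_1[of c] by (cases "j = 0") auto
qed

text \<open>\<open>TE j c\<close> is a convex combination of \<open>c j\<close> and
  \<open>TE (Suc j) c\<close>, and \<open>c j\<close> is the smaller of the two when
  \<open>c\<close> is nondecreasing on the phases. The state 0 is apart, because \<open>c 0\<close>
  is not compared with anything there: its weight is 0.\<close>

lemma TE_Suc_mono:
  assumes c: "\<And>l. l \<in> {1..<N} \<Longrightarrow> c l \<le> c (Suc l)" and "j < N"
  shows "TE j c \<le> TE (Suc j) c"
proof (cases "j = 0")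
  case True
  then show ?thesis using TE_0_1[of c] by simp
next
  case False
  have low: "1 \<le> i \<longrightarrow> c i \<le> TE i c" if "i \<le> N" for i
    using that
  proof (induction rule: inc_induct)
    case base
    then show ?case by (simp add: TE_N)
  next
    case (step i)
    show ?case
    proof
      assume i: "1 \<le> i"
      have ri: "0 \<le> r i" "r i \<le> 1" using r_range[of i] step by auto
      have "c i \<le> TE (Suc i) c"
        using c[of i] i step by (auto intro: order_trans)
      then have "ennreal (1 - r i) * c i + ennreal (r i) * c i \<le> TE i c"
        using step by (subst TE_step) (auto intro!: add_mono mult_left_mono)
      then show "c i \<le> TE i c"
        using ennreal_convex_self[OF ri] by simp
    qed
  qed
  have rj: "0 \<le> r j" "r j \<le> 1" using r_range[of j] assms by auto
  have "c j \<le> c (Suc j)" using c[of j] False assms by auto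
  also have "\<dots> \<le> TE (Suc j) c" using low[of "Suc j"] assms by auto
  finally have "TE j c \<le> ennreal (1 - r j) * TE (Suc j) c + ennreal (r j) * TE (Suc j) c"
    using assms by (subst TE_step) (auto intro!: add_mono mult_left_mono)
  then show ?thesis using ennreal_convex_self[OF rj] by simp
qed

text \<open>The likelihood ratio, on the times \<open>k + 1, ..., k + t\<close>, of observations
  driven by the hidden chain that is in state \<open>j\<close> at time \<open>k\<close>, against the
  null law. It averages over all phase paths, whereas the test keeps only the best one.\<close>

primrec dens :: "nat \<Rightarrow> nat \<Rightarrow> nat \<Rightarrow> (nat \<Rightarrow> nat \<Rightarrow> real) \<Rightarrow> real" where
  "dens 0 k j w = 1"
| "dens (Suc t) k j w = (\<Sum>l\<in>{j..N}. coef j l * (Lm l (w (Suc k)) * dens t (Suc k) l w))"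

lemma dens_nonneg: "0 \<le> dens t k j w"
proof (induction t arbitrary: k j)
  case (Suc t)
  then show ?case by (auto intro!: sum_nonneg mult_nonneg_nonneg coef_nonneg Lm_nonneg)
qed simp

lemma Lm_comp_meas [measurable]: "(\<lambda>w. Lm i (w (Suc k))) \<in> borel_measurable \<mu>"
  using measurable_compose[OF meas_component Lm_meas] by auto

lemma dens_meas [measurable]: "dens t k j \<in> borel_measurable \<mu>"
proof (induction t arbitrary: k j)
  case (Suc t)
  note [measurable] = Suc.IH
  have "(\<lambda>w. \<Sum>l\<in>{j..N}. coef j l * (Lm l (w (Suc k)) * dens t (Suc k) l w)) \<in> borel_measurable \<mu>"
    by measurable
  then show ?case by (subst dens.simps[abs_def]) simp
next
  case 0
  have "dens 0 k j = (\<lambda>_. 1)" by (simp add: fun_eq_iff)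
  then show ?case by simp
qed

lemma inc_dens: "inc (dens t k j)"
proof (induction t arbitrary: k j)
  case 0
  then show ?case by (simp add: inc_const)
next
  case (Suc t)
  have "inc (\<lambda>w. \<Sum>l\<in>{j..N}. coef j l * (Lm l (w (Suc k)) * dens t (Suc k) l w))"
    by (intro inc_sum inc_cmult inc_mult inc_Lm Suc.IH) (auto simp: Lm_nonneg dens_nonneg coef_nonneg)
  then show ?case by simp
qed

lemma dens_upd: "k' \<le> k \<Longrightarrow> dens t k j (w(k' := z)) = dens t k j w"
  by (induction t arbitrary: k j) auto

lemma E_mult_dens_Suc:
  assumes [measurable]: "\<phi> \<in> borel_measurable \<mu>" and "\<And>w. 0 \<le> \<phi> w"
  shows "E (\<lambda>w. \<phi> w * dens (Suc t) k j w) = TE j (\<lambda>l. E (\<lambda>w. (\<phi> w * Lm l (w (Suc k))) * dens t (Suc k) l w))"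
proof -
  have "E (\<lambda>w. \<phi> w * dens (Suc t) k j w)
    = E (\<lambda>w. \<Sum>l\<in>{j..N}. coef j l * ((\<phi> w * Lm l (w (Suc k))) * dens t (Suc k) l w))"
    by (simp add: sum_distrib_left mult_ac)
  also have "\<dots> = (\<Sum>l\<in>{j..N}. E (\<lambda>w. coef j l * ((\<phi> w * Lm l (w (Suc k))) * dens t (Suc k) l w)))"
    using assms by (intro E_sum) (auto intro!: mult_nonneg_nonneg coef_nonneg Lm_nonneg dens_nonneg)
  also have "\<dots> = (\<Sum>l\<in>{j..N}. ennreal (coef j l) * E (\<lambda>w. (\<phi> w * Lm l (w (Suc k))) * dens t (Suc k) l w))"
    using assms by (intro sum.cong refl E_cmult) (auto intro!: mult_nonneg_nonneg coef_nonneg Lm_nonneg dens_nonneg)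
  finally show ?thesis by (simp add: TE_def)
qed

text \<open>The first factor \<open>Lm l\<close> involves a time that the remaining density does not
  see, and it has mean 1; the transition probabilities sum to 1.\<close>

lemma E_dens: "j \<le> N \<Longrightarrow> E (dens t k j) = 1"
proof (induction t arbitrary: k j)
  case 0
  interpret prob_space \<mu> by (rule prob_\<mu>)
  show ?case by (simp add: E_def emeasure_space_1)
next
  case (Suc t)
  have "E (\<lambda>w. (1 * Lm l (w (Suc k))) * dens t (Suc k) l w) = 1" if "l \<in> {j..N}" "1 \<le> l" for l
  proof -
    have "E (\<lambda>w. (1 * Lm l (w (Suc k))) * dens t (Suc k) l w) = E (\<lambda>w. dens t (Suc k) l w * esym_mean L R (m + l - 1) (w (Suc k)))"
      by (simp add: Lm_def mult.commute)
    also have "\<dots> = E (dens t (Suc k) l)"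
      using that mN by (intro E_esym_indep) (auto simp: dens_nonneg dens_upd)
    finally show ?thesis using Suc.IH[of l] that by simp
  qed
  then have "TE i (\<lambda>l. E (\<lambda>w. (1 * Lm l (w (Suc k))) * dens t (Suc k) l w)) = TE i (\<lambda>_. 1)" if "1 \<le> i" "j \<le> i" for i
    unfolding TE_def using that by (intro sum.cong) auto
  then have "TE j (\<lambda>l. E (\<lambda>w. (1 * Lm l (w (Suc k))) * dens t (Suc k) l w)) = 1"
    using Suc.prems N1 TE_0_1[of "\<lambda>l. E (\<lambda>w. (1 * Lm l (w (Suc k))) * dens t (Suc k) l w)"]
    by (cases "j = 0") (auto simp: TE_const)
  then show ?case
    using E_mult_dens_Suc[of "\<lambda>_. 1" t k j] by simp
qed

text \<open>The path densities are stochastically ordered: a later phase, or an earlier start, makes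
  increasing functions larger on average.\<close>

lemma E_dens_phase_mono:
  assumes "\<phi> \<in> borel_measurable \<mu>" "\<And>w. 0 \<le> \<phi> w" "inc \<phi>" "j < N"
  shows "E (\<lambda>w. \<phi> w * dens t k j w) \<le> E (\<lambda>w. \<phi> w * dens t k (Suc j) w)"
  using assms
proof (induction t arbitrary: k j \<phi>)
  case 0
  then show ?case by simp
next
  case (Suc t)
  note [measurable] = Suc.prems(1)
  show ?case
    unfolding E_mult_dens_Suc[OF Suc.prems(1,2)]
  \<comment> \<open>What remains is monotonicity in the next phase \<open>l\<close>. The induction
    hypothesis is used with the weight \<open>\<phi> * Lm l\<close>, which is again increasing, and
    moves the later path from \<open>l\<close> to \<open>Suc l\<close>; then the mixture at time
    \<open>Suc k\<close> receives one more anomalous sensor.\<close>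
  proof (rule TE_Suc_mono)
    show "j < N" by fact
    fix l assume l: "l \<in> {1..<N}"
    have "E (\<lambda>w. (\<phi> w * Lm l (w (Suc k))) * dens t (Suc k) l w)
      \<le> E (\<lambda>w. (\<phi> w * Lm l (w (Suc k))) * dens t (Suc k) (Suc l) w)"
      using Suc.prems l by (intro Suc.IH) (auto intro!: mult_nonneg_nonneg Lm_nonneg inc_mult inc_Lm)
    also have "\<dots> = E (\<lambda>w. (\<phi> w * dens t (Suc k) (Suc l) w) * esym_mean L R (m + l - 1) (w (Suc k)))"
      by (simp add: Lm_def mult_ac)
    also have "\<dots> \<le> E (\<lambda>w. (\<phi> w * dens t (Suc k) (Suc l) w) * esym_mean L R (Suc (m + l - 1)) (w (Suc k)))"
      using Suc.prems l mN
      by (intro E_esym_mono_Suc) (auto intro!: mult_nonneg_nonneg dens_nonneg inc_mult inc_dens)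
    also have "Suc (m + l - 1) = m + Suc l - 1" using l by auto
    also have "E (\<lambda>w. (\<phi> w * dens t (Suc k) (Suc l) w) * esym_mean L R (m + Suc l - 1) (w (Suc k)))
       = E (\<lambda>w. (\<phi> w * Lm (Suc l) (w (Suc k))) * dens t (Suc k) (Suc l) w)"
      by (simp add: Lm_def mult_ac)
    finally show "E (\<lambda>w. (\<phi> w * Lm l (w (Suc k))) * dens t (Suc k) l w)
      \<le> E (\<lambda>w. (\<phi> w * Lm (Suc l) (w (Suc k))) * dens t (Suc k) (Suc l) w)" .
  qed
qed

text \<open>Starting one step earlier lets time \<open>Suc k\<close> be anomalous instead of null,
  and lets the later path begin in some phase \<open>l\<close> instead of the state 0. Both changes
  raise the mean of an increasing function, for every \<open>l\<close> and hence for the average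
  over \<open>l\<close>.\<close>

lemma E_dens_start_mono:
  assumes [measurable]: "\<phi> \<in> borel_measurable \<mu>" and \<phi>: "\<And>w. 0 \<le> \<phi> w" "inc \<phi>"
  shows "E (\<lambda>w. \<phi> w * dens t (Suc k) 0 w) \<le> E (\<lambda>w. \<phi> w * dens (Suc t) k 0 w)"
  unfolding E_mult_dens_Suc[OF assms(1) \<phi>(1)]
proof (rule TE_ge)
  fix l assume l: "l \<in> {1..N}"
  have "E (\<lambda>w. \<phi> w * dens t (Suc k) 0 w) \<le> E (\<lambda>w. \<phi> w * dens t (Suc k) i w)" if "i \<le> N" for i
    using that
  proof (induction i)
    case (Suc i)
    then show ?case
      using E_dens_phase_mono[OF assms, of i t "Suc k"] by (auto intro: order_trans)
  qed simp
  from this[of l] l have "E (\<lambda>w. \<phi> w * dens t (Suc k) 0 w) \<le> E (\<lambda>w. \<phi> w * dens t (Suc k) l w)"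
    by simp
  also have "E (\<lambda>w. \<phi> w * dens t (Suc k) l w) \<le> E (\<lambda>w. (\<phi> w * dens t (Suc k) l w) * esym_mean L R (m + l - 1) (w (Suc k)))"
    using \<phi> l mN by (intro E_esym_ge) (auto intro!: mult_nonneg_nonneg dens_nonneg inc_mult inc_dens)
  also have "\<dots> = E (\<lambda>w. (\<phi> w * Lm l (w (Suc k))) * dens t (Suc k) l w)"
    by (simp add: Lm_def mult_ac)
  finally show "E (\<lambda>w. \<phi> w * dens t (Suc k) 0 w) \<le> E (\<lambda>w. (\<phi> w * Lm l (w (Suc k))) * dens t (Suc k) l w)"
    .
qed simp

text \<open>For the horizon \<open>K\<close>: the densities of the paths that start just before time
  \<open>K - i + 1\<close> from the state 0 (\<open>i \<le> K\<close>), then of those that start at time 1 from the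
  phase \<open>i - K\<close>.\<close>

definition start_dens :: "nat \<Rightarrow> nat \<Rightarrow> (nat \<Rightarrow> nat \<Rightarrow> real) \<Rightarrow> real" where
  "start_dens K i = (if i \<le> K then dens i (K - i) 0 else dens K 0 (i - K))"

lemma start_dens_meas [measurable]: "start_dens K i \<in> borel_measurable \<mu>"
  by (simp add: start_dens_def)

lemma inc_start_dens: "inc (start_dens K i)"
  by (simp add: start_dens_def inc_dens)

lemma E_start_dens: "i \<le> K + N \<Longrightarrow> E (start_dens K i) = 1"
  by (auto simp: start_dens_def E_dens)

lemma E_start_dens_mono:
  assumes "\<phi> \<in> borel_measurable \<mu>" "\<And>w. 0 \<le> \<phi> w" "inc \<phi>" "i < K + N"
  shows "E (\<lambda>w. \<phi> w * start_dens K i w) \<le> E (\<lambda>w. \<phi> w * start_dens K (Suc i) w)"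
proof (cases "i < K")
  case True
  then have "K - i = Suc (K - Suc i)" by auto
  then show ?thesis
    using True E_dens_start_mono[OF assms(1-3), of i "K - Suc i"] by (simp add: start_dens_def)
next
  case False
  then have "Suc i - K = Suc (i - K)" "i - K < N" using assms by auto
  then show ?thesis
    using False E_dens_phase_mono[OF assms(1-3), of "i - K" K 0]
    by (cases "i = K") (auto simp: start_dens_def)
qed

text \<open>Both densities have total mass 1, so what the later one gains on the increasing
  complement it must lose on \<open>A\<close>.\<close>

lemma start_dens_antimono_on_lower:
  assumes A [measurable]: "A \<in> sets \<mu>" and low: "inc (indicator (- A))" and i: "i < K + N"
  shows "E (\<lambda>w. indicator A w * start_dens K (Suc i) w) \<le> E (\<lambda>w. indicator A w * start_dens K i w)"
proof -
  have [measurable]: "(\<lambda>w. indicator (- A) w :: real) \<in> borel_measurable \<mu>"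
  proof (subst measurable_cong)
    fix w assume "w \<in> space \<mu>"
    then show "(indicator (- A) w :: real) = 1 - indicator A w"
      by (auto simp: indicator_def)
  qed auto
  have split: "E (\<lambda>w. indicator A w * start_dens K j w) + E (\<lambda>w. indicator (- A) w * start_dens K j w) = 1"
    if "j \<le> K + N" for j
  proof -
    have "E (\<lambda>w. indicator A w * start_dens K j w) + E (\<lambda>w. indicator (- A) w * start_dens K j w)
       = E (start_dens K j)"
      unfolding E_def
      by (subst nn_integral_add[symmetric]) (auto intro!: nn_integral_cong simp: indicator_def)
    then show ?thesis using that by (simp add: E_start_dens)
  qed
  let ?a = "E (\<lambda>w. indicator A w * start_dens K (Suc i) w)" and ?b = "E (\<lambda>w. indicator (- A) w * start_dens K (Suc i) w)"
  let ?c = "E (\<lambda>w. indicator A w * start_dens K i w)" and ?d = "E (\<lambda>w. indicator (- A) w * start_dens K i w)"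
  have "?a + ?d \<le> ?a + ?b"
    using E_start_dens_mono[OF _ _ low i] by (intro add_left_mono) auto
  also have "\<dots> = ?c + ?d"
    using split[of i] split[of "Suc i"] i by simp
  finally have "?d + ?a \<le> ?d + ?c" by (simp add: add.commute)
  moreover have "?d \<noteq> \<top>"
  proof -
    have "?d \<le> ?c + ?d" by (rule add_increasing) auto
    also have "\<dots> = 1" using split[of i] i by simp
    finally show ?thesis by (auto simp: top_unique)
  qed
  ultimately show ?thesis
    by (simp add: ennreal_add_left_cancel_le)
qed

text \<open>The second summand is the mass not yet spent; at \<open>i = 0\<close> the density is 1
  and this mass is all of \<open>C\<close>. Where the next density is the first to reach \<gamma>,
  it pays for \<gamma> times the probability of that event out of the remaining mass. Passing to the
  next density does not increase that mass, because having seen no crossing so far is a decreasing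
  event.\<close>

lemma hazard_bound:
  fixes C :: "(nat \<Rightarrow> nat \<Rightarrow> real) set"
  assumes C [measurable]: "C \<in> sets \<mu>" and low: "inc (indicator (- C))" and "0 \<le> \<gamma>" and K: "i \<le> K + N"
  shows "ennreal \<gamma> * emeasure \<mu> {w \<in> C. \<exists>i'\<in>{1..i}. \<gamma> \<le> start_dens K i' w}
     + E (\<lambda>w. indicator {w \<in> C. \<forall>i'\<in>{1..i}. start_dens K i' w < \<gamma>} w * start_dens K i w) \<le> emeasure \<mu> C"
  using K
proof (induction i)
  case 0
  then show ?case
    by (simp add: start_dens_def E_def ennreal_indicator)
next
  case (Suc i)
  have CS: "C \<subseteq> space \<mu>" using sets.sets_into_space[OF C] .
  have eqC: "{w \<in> C. P w} = C \<inter> {w \<in> space \<mu>. P w}" for P :: "(nat \<Rightarrow> nat \<Rightarrow> real) \<Rightarrow> bool"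
    using CS by auto
  let ?G = "\<lambda>i. {w \<in> C. \<forall>i'\<in>{1..i}. start_dens K i' w < \<gamma>}"
  let ?H = "{w \<in> ?G i. \<gamma> \<le> start_dens K (Suc i) w}"
  have [measurable]: "?G i \<in> sets \<mu>" for i unfolding eqC by measurable
  have eqG: "{w \<in> ?G i. P w} = ?G i \<inter> {w \<in> space \<mu>. P w}" for P :: "(nat \<Rightarrow> nat \<Rightarrow> real) \<Rightarrow> bool"
    using CS by auto
  have [measurable]: "?H \<in> sets \<mu>" unfolding eqG by measurable
  have [measurable]: "{w \<in> C. \<exists>i'\<in>{1..i}. \<gamma> \<le> start_dens K i' w} \<in> sets \<mu>" for i
    unfolding eqC by measurable
  have lowG: "inc (indicator (- ?G i))" for i
    unfolding inc_def
  proof (intro allI impI)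
    fix w :: "nat \<Rightarrow> nat \<Rightarrow> real" and k l y assume a: "1 \<le> k" "l \<in> {1..L}" "R (w k l) \<le> R y"
    let ?w = "w(k := (w k)(l := y))"
    have "?w \<in> C \<Longrightarrow> w \<in> C"
      using low a unfolding inc_def by (force simp: indicator_def split: if_splits)
    moreover have "start_dens K i' w \<le> start_dens K i' ?w" for i'
      using inc_start_dens a unfolding inc_def by auto
    ultimately have "?w \<in> ?G i \<Longrightarrow> w \<in> ?G i"
      using le_less_trans by blast
    then show "(indicator (- ?G i) w :: real) \<le> indicator (- ?G i) ?w"
      by (auto simp: indicator_def)
  qed
  have e1: "emeasure \<mu> {w \<in> C. \<exists>i'\<in>{1..Suc i}. \<gamma> \<le> start_dens K i' w}
     = emeasure \<mu> {w \<in> C. \<exists>i'\<in>{1..i}. \<gamma> \<le> start_dens K i' w} + emeasure \<mu> ?H"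
    by (subst plus_emeasure) (auto intro!: arg_cong[where f = "emeasure \<mu>"] simp: atLeastAtMostSuc_conv not_le not_less)
  have "ennreal \<gamma> * emeasure \<mu> ?H + E (\<lambda>w. indicator (?G (Suc i)) w * start_dens K (Suc i) w)
     = (\<integral>\<^sup>+ w. ennreal \<gamma> * indicator ?H w \<partial>\<mu>) + (\<integral>\<^sup>+ w. ennreal (indicator (?G (Suc i)) w * start_dens K (Suc i) w) \<partial>\<mu>)"
    unfolding E_def by (simp add: nn_integral_cmult)
  also have "\<dots> = (\<integral>\<^sup>+ w. ennreal \<gamma> * indicator ?H w + ennreal (indicator (?G (Suc i)) w * start_dens K (Suc i) w) \<partial>\<mu>)"
    by (rule nn_integral_add[symmetric]) auto
  also have "\<dots> \<le> E (\<lambda>w. indicator (?G i) w * start_dens K (Suc i) w)"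
    unfolding E_def
    by (intro nn_integral_mono) (auto simp: indicator_def atLeastAtMostSuc_conv ennreal_leI split: if_splits)
  also have "\<dots> \<le> E (\<lambda>w. indicator (?G i) w * start_dens K i w)"
    using Suc.prems by (intro start_dens_antimono_on_lower lowG) auto
  finally have e2: "ennreal \<gamma> * emeasure \<mu> ?H + E (\<lambda>w. indicator (?G (Suc i)) w * start_dens K (Suc i) w)
    \<le> E (\<lambda>w. indicator (?G i) w * start_dens K i w)" .
  have "ennreal \<gamma> * emeasure \<mu> {w \<in> C. \<exists>i'\<in>{1..Suc i}. \<gamma> \<le> start_dens K i' w}
     + E (\<lambda>w. indicator (?G (Suc i)) w * start_dens K (Suc i) w)
    = ennreal \<gamma> * emeasure \<mu> {w \<in> C. \<exists>i'\<in>{1..i}. \<gamma> \<le> start_dens K i' w}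
     + (ennreal \<gamma> * emeasure \<mu> ?H + E (\<lambda>w. indicator (?G (Suc i)) w * start_dens K (Suc i) w))"
    unfolding e1 by (simp add: distrib_left add.assoc)
  also have "\<dots> \<le> emeasure \<mu> C"
    using Suc.IH Suc.prems e2 by (meson Suc_leD add_left_mono order_trans)
  finally show ?case .
qed

end

section \<open>Time to false alarm\<close>

context phase_chain
begin

lemma space_\<mu>_update:
  assumes "1 \<le> k" "l \<in> {1..L}"
  shows "w(k := (w k)(l := y)) \<in> space \<mu> \<longleftrightarrow> w \<in> space \<mu>"
proof -
  have G: "space G = UNIV" using sets_eq_imp_space_eq[OF sets_G] by simp
  have "(w k)(l := y) \<in> space obs \<longleftrightarrow> w k \<in> space obs"
    using assms(2) unfolding obs_def space_PiM by (auto simp: G PiE_iff extensional_def)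
  then show ?thesis
    using assms(1) unfolding \<mu>_def space_PiM by (auto simp: PiE_iff extensional_def)
qed

text \<open>The exponential of the recursion of the test, with the ratios taken from
  \<open>R\<close>. All phases start from the value 1, and state 0 keeps it, as in the definition of
  Omega.\<close>

primrec Q :: "nat \<Rightarrow> nat \<Rightarrow> (nat \<Rightarrow> nat \<Rightarrow> real) \<Rightarrow> real" where
  "Q 0 i w = 1"
| "Q (Suc k) i w = (if i = 0 then 1 else
     Max ((\<lambda>j. Q k j w * (\<Prod>s\<in>{j..<i}. r s)) ` {0..i}) * Lm i (w (Suc k)) * (1 - r i))"

lemma Q_nonneg: "i \<le> N \<Longrightarrow> 0 \<le> Q k i w"
proof (induction k arbitrary: i)
  case (Suc k)
  have "0 \<le> Max ((\<lambda>j. Q k j w * (\<Prod>s\<in>{j..<i}. r s)) ` {0..i})"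
    using Suc r_range by (intro Max_ge_iff[THEN iffD2] bexI[of _ "Q k i w"]) (auto intro!: rev_image_eqI[of i])
  then show ?case
    using r_range[of i] Suc.prems by (auto intro!: mult_nonneg_nonneg Lm_nonneg)
qed simp

lemma Q_meas [measurable]: "Q k i \<in> borel_measurable \<mu>"
proof (induction k arbitrary: i)
  case 0
  have "Q 0 i = (\<lambda>_. 1)" by (simp add: fun_eq_iff)
  then show ?case by simp
next
  case (Suc k)
  note [measurable] = Suc.IH
  have "(\<lambda>w. if i = 0 then 1 else
     Max ((\<lambda>j. Q k j w * (\<Prod>s\<in>{j..<i}. r s)) ` {0..i}) * Lm i (w (Suc k)) * (1 - r i)) \<in> borel_measurable \<mu>"
    by measurable
  moreover have "Q (Suc k) i = (\<lambda>w. if i = 0 then 1 else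
     Max ((\<lambda>j. Q k j w * (\<Prod>s\<in>{j..<i}. r s)) ` {0..i}) * Lm i (w (Suc k)) * (1 - r i))"
    by (simp add: fun_eq_iff)
  ultimately show ?case by simp
qed

lemma inc_Q: "i \<le> N \<Longrightarrow> inc (Q k i)"
proof (induction k arbitrary: i)
  case 0
  show ?case by (simp add: inc_def)
next
  case (Suc k)
  show ?case
    unfolding inc_def
  proof (intro allI impI)
    fix w :: "nat \<Rightarrow> nat \<Rightarrow> real" and k' l y
    assume a: "1 \<le> k'" "l \<in> {1..L}" "R (w k' l) \<le> R y"
    let ?w = "w(k' := (w k')(l := y))"
    let ?M = "\<lambda>w. Max ((\<lambda>j. Q k j w * (\<Prod>s\<in>{j..<i}. r s)) ` {0..i})"
    have M: "?M w \<le> ?M ?w"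
    proof (rule Max.boundedI)
      fix a' assume "a' \<in> (\<lambda>j. Q k j w * (\<Prod>s\<in>{j..<i}. r s)) ` {0..i}"
      then obtain j where j: "j \<le> i" "a' = Q k j w * (\<Prod>s\<in>{j..<i}. r s)" by auto
      have "Q k j w \<le> Q k j ?w"
        using Suc.IH[of j] j Suc.prems a unfolding inc_def by auto
      then have "a' \<le> Q k j ?w * (\<Prod>s\<in>{j..<i}. r s)"
        unfolding j using Suc.prems r_range by (intro mult_right_mono prod_nonneg) auto
      also have "\<dots> \<le> ?M ?w" using j by (intro Max_ge) auto
      finally show "a' \<le> ?M ?w" .
    qed auto
    have M0: "0 \<le> ?M w"
      using Suc.prems r_range Q_nonneg[of i k w] by (intro Max_ge_iff[THEN iffD2] bexI[of _ "Q k i w"]) (auto intro!: rev_image_eqI[of i])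
    have "Lm i (w (Suc k)) \<le> Lm i (?w (Suc k))"
      using inc_Lm[of i "Suc k"] a unfolding inc_def by blast
    then have "?M w * Lm i (w (Suc k)) * (1 - r i) \<le> ?M ?w * Lm i (?w (Suc k)) * (1 - r i)"
      using M M0 r_range[of i] Suc.prems
      by (intro mult_right_mono mult_mono) (auto intro: Lm_nonneg order_trans)
    then show "Q (Suc k) i w \<le> Q (Suc k) i ?w" by simp
  qed
qed

text \<open>The optimal path behind \<open>Q\<close> is traced backwards. A single transition is
  dominated by the sum over all transitions in \<open>dens\<close>, so each step back turns one
  maximisation into an average. The trace ends either in state 0, at a fresh start, or at time 0 in
  some phase. The side condition excludes the empty path at the horizon, which would have index
  0.\<close>

lemma Q_le_start_dens:
  assumes "1 \<le> K"
  shows "k \<le> K \<Longrightarrow> j \<le> N \<Longrightarrow> k < K \<or> 1 \<le> j \<Longrightarrow>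
    \<exists>i\<in>{1..K + N}. Q k j w * dens (K - k) k j w \<le> start_dens K i w"
proof (induction k arbitrary: j)
  case 0
  then show ?case
    using assms by (intro bexI[of _ "K + j"]) (auto simp: start_dens_def)
next
  case (Suc k)
  show ?case
  proof (cases "j = 0")
    case True
    then show ?thesis
      using Suc.prems by (intro bexI[of _ "K - Suc k"]) (auto simp: start_dens_def)
  next
    case False
    let ?h = "\<lambda>j'. Q k j' w * (\<Prod>s\<in>{j'..<j}. r s)"
    have "Max (?h ` {0..j}) \<in> ?h ` {0..j}"
      by (rule Max_in) auto
    then obtain j' where "j' \<in> {0..j}" "Max (?h ` {0..j}) = ?h j'" by (elim imageE)
    then have j': "j' \<le> j" "Max (?h ` {0..j}) = ?h j'" by simp_all
    have "Q (Suc k) j w * dens (K - Suc k) (Suc k) j w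
       = Q k j' w * (coef j' j * (Lm j (w (Suc k)) * dens (K - Suc k) (Suc k) j w))"
      using False j' by (simp add: coef_def mult_ac)
    also have "\<dots> \<le> Q k j' w * dens (Suc (K - Suc k)) k j' w"
    proof (rule mult_left_mono)
      show "0 \<le> Q k j' w" using j' Suc.prems by (intro Q_nonneg) auto
      have "coef j' j * (Lm j (w (Suc k)) * dens (K - Suc k) (Suc k) j w)
        \<le> (\<Sum>l\<in>{j'..N}. coef j' l * (Lm l (w (Suc k)) * dens (K - Suc k) (Suc k) l w))"
        using j' Suc.prems
        by (intro member_le_sum) (auto intro!: mult_nonneg_nonneg coef_nonneg Lm_nonneg dens_nonneg)
      then show "coef j' j * (Lm j (w (Suc k)) * dens (K - Suc k) (Suc k) j w) \<le> dens (Suc (K - Suc k)) k j' w"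
        by simp
    qed
    also have "Suc (K - Suc k) = K - k" using Suc.prems by auto
    finally have "Q (Suc k) j w * dens (K - Suc k) (Suc k) j w \<le> Q k j' w * dens (K - k) k j' w" .
    moreover obtain i where "i \<in> {1..K + N}" "Q k j' w * dens (K - k) k j' w \<le> start_dens K i w"
      using Suc.IH[of j'] Suc.prems j' by auto
    ultimately show ?thesis
      by (meson order_trans)
  qed
qed

definition quiet :: "real \<Rightarrow> nat \<Rightarrow> (nat \<Rightarrow> nat \<Rightarrow> real) set" where
  "quiet \<gamma> K = {w \<in> space \<mu>. \<forall>k\<in>{1..K}. \<forall>i\<in>{1..N}. Q k i w < \<gamma>}"

lemma quiet_sets [measurable]: "quiet \<gamma> K \<in> sets \<mu>"
  unfolding quiet_def by measurable

lemma inc_not_quiet: "inc (indicator (- quiet \<gamma> K))"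
  unfolding inc_def
proof (intro allI impI)
  fix w :: "nat \<Rightarrow> nat \<Rightarrow> real" and k l y
  assume a: "1 \<le> k" "l \<in> {1..L}" "R (w k l) \<le> R y"
  let ?w = "w(k := (w k)(l := y))"
  have "Q k' i w \<le> Q k' i ?w" if "i \<in> {1..N}" for k' i
    using inc_Q[of i k'] that a unfolding inc_def by auto
  then have "?w \<in> quiet \<gamma> K \<Longrightarrow> w \<in> quiet \<gamma> K"
    unfolding quiet_def using space_\<mu>_update[OF a(1,2)] le_less_trans by blast
  then show "(indicator (- quiet \<gamma> K) w :: real) \<le> indicator (- quiet \<gamma> K) ?w"
    by (auto simp: indicator_def)
qed

lemma measure_quiet_ge:
  assumes "1 \<le> \<gamma>"
  shows "(1 - 1 / \<gamma>) ^ K \<le> measure \<mu> (quiet \<gamma> K)"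
proof (induction K)
  case 0
  interpret prob_space \<mu> by (rule prob_\<mu>)
  show ?case by (simp add: quiet_def prob_space)
next
  case (Suc K)
  interpret prob_space \<mu> by (rule prob_\<mu>)
  let ?H = "{w \<in> quiet \<gamma> K. \<exists>i'\<in>{1..Suc K + N}. \<gamma> \<le> start_dens (Suc K) i' w}"
  have eq: "?H = quiet \<gamma> K \<inter> {w \<in> space \<mu>. \<exists>i'\<in>{1..Suc K + N}. \<gamma> \<le> start_dens (Suc K) i' w}"
    by (auto simp: quiet_def)
  have [measurable]: "?H \<in> sets \<mu>" unfolding eq by measurable
  have "ennreal \<gamma> * emeasure \<mu> ?H \<le> emeasure \<mu> (quiet \<gamma> K)"
  proof -
    have "ennreal \<gamma> * emeasure \<mu> ?H \<le> ennreal \<gamma> * emeasure \<mu> ?H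
      + E (\<lambda>w. indicator {w \<in> quiet \<gamma> K. \<forall>i'\<in>{1..Suc K + N}. start_dens (Suc K) i' w < \<gamma>} w * start_dens (Suc K) (Suc K + N) w)"
      by (intro add_increasing2) auto
    also have "\<dots> \<le> emeasure \<mu> (quiet \<gamma> K)"
      using assms by (intro hazard_bound inc_not_quiet) auto
    finally show ?thesis .
  qed
  then have "\<gamma> * measure \<mu> ?H \<le> measure \<mu> (quiet \<gamma> K)"
    using assms by (simp add: emeasure_eq_measure ennreal_mult[symmetric])
  then have H: "measure \<mu> ?H \<le> measure \<mu> (quiet \<gamma> K) / \<gamma>"
    using assms by (simp add: field_simps)
  \<comment> \<open>An alarm at the new time would bring some start density with horizon
    \<open>Suc K\<close> up to \<gamma>: the path bound is used at the horizon itself, where no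
    continuation is left to average.\<close>
  have "quiet \<gamma> K - ?H \<subseteq> quiet \<gamma> (Suc K)"
  proof
    fix w assume w: "w \<in> quiet \<gamma> K - ?H"
    have "Q (Suc K) i w < \<gamma>" if i: "i \<in> {1..N}" for i
    proof -
      obtain i' where "i' \<in> {1..Suc K + N}" "Q (Suc K) i w * dens (Suc K - Suc K) (Suc K) i w \<le> start_dens (Suc K) i' w"
        using Q_le_start_dens[of "Suc K" "Suc K" i w] i by auto
      then have "Q (Suc K) i w \<le> start_dens (Suc K) i' w" "start_dens (Suc K) i' w < \<gamma>"
        using w by (auto simp: not_le)
      then show ?thesis by simp
    qed
    then show "w \<in> quiet \<gamma> (Suc K)"
      using w by (auto simp: quiet_def atLeastAtMostSuc_conv)
  qed
  then have "measure \<mu> (quiet \<gamma> K - ?H) \<le> measure \<mu> (quiet \<gamma> (Suc K))"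
    by (intro finite_measure_mono) auto
  moreover have "measure \<mu> (quiet \<gamma> K - ?H) = measure \<mu> (quiet \<gamma> K) - measure \<mu> ?H"
    by (intro finite_measure_Diff) auto
  ultimately have "measure \<mu> (quiet \<gamma> (Suc K)) \<ge> (1 - 1 / \<gamma>) * measure \<mu> (quiet \<gamma> K)"
    using H by (simp add: algebra_simps)
  moreover have "(1 - 1 / \<gamma>) * (1 - 1 / \<gamma>) ^ K \<le> (1 - 1 / \<gamma>) * measure \<mu> (quiet \<gamma> K)"
    using Suc.IH assms by (intro mult_left_mono) auto
  ultimately show ?case by simp
qed

text \<open>\<open>T\<close> is at least the number of \<open>K\<close> with
  \<open>w \<in> quiet \<gamma> K\<close>, so its mean is at least the sum of their probabilities,
  bounded below by a geometric series with sum \<gamma>.\<close>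

lemma nn_integral_ge_if_quiet:
  assumes \<gamma>: "1 \<le> \<gamma>"
    and T: "AE w in \<mu>. \<forall>K. w \<in> quiet \<gamma> K \<longrightarrow> of_nat (Suc K) \<le> T w"
  shows "ennreal \<gamma> \<le> (\<integral>\<^sup>+ w. T w \<partial>\<mu>)"
proof -
  interpret prob_space \<mu> by (rule prob_\<mu>)
  have le: "ennreal (\<Sum>K<n. (1 - 1 / \<gamma>) ^ K) \<le> (\<integral>\<^sup>+ w. T w \<partial>\<mu>)" for n
  proof -
    have "ennreal (\<Sum>K<n. (1 - 1 / \<gamma>) ^ K) = (\<Sum>K<n. ennreal ((1 - 1 / \<gamma>) ^ K))"
      using \<gamma> by (intro sum_ennreal[symmetric]) auto
    also have "\<dots> \<le> (\<Sum>K<n. emeasure \<mu> (quiet \<gamma> K))"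
      using measure_quiet_ge[OF \<gamma>] by (intro sum_mono) (auto simp: emeasure_eq_measure)
    also have "\<dots> = (\<integral>\<^sup>+ w. (\<Sum>K<n. indicator (quiet \<gamma> K) w) \<partial>\<mu>)"
      by (subst nn_integral_sum) auto
    also have "\<dots> \<le> (\<integral>\<^sup>+ w. T w \<partial>\<mu>)"
    proof (rule nn_integral_mono_AE)
      show "AE w in \<mu>. (\<Sum>K<n. indicator (quiet \<gamma> K) w) \<le> T w"
        using T
      proof (rule eventually_mono)
        fix w assume w: "\<forall>K. w \<in> quiet \<gamma> K \<longrightarrow> of_nat (Suc K) \<le> T w"
        let ?S = "{K \<in> {..<n}. w \<in> quiet \<gamma> K}"
        have "(\<Sum>K<n. indicator (quiet \<gamma> K) w :: ennreal) = of_nat (card ?S)"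
          by (simp add: indicator_def sum.If_cases Int_def)
        also have "\<dots> \<le> T w"
        proof (cases "?S = {}")
          case False
          then have M: "Max ?S \<in> ?S" by (intro Max_in) auto
          have "card ?S \<le> card {..Max ?S}" by (intro card_mono) auto
          then have "(of_nat (card ?S) :: ennreal) \<le> of_nat (Suc (Max ?S))"
            by (subst of_nat_le_iff) simp
          also have "\<dots> \<le> T w" using w M by blast
          finally show ?thesis .
        qed (simp only: card.empty of_nat_0 zero_le)
        finally show "(\<Sum>K<n. indicator (quiet \<gamma> K) w) \<le> T w" .
      qed
    qed
    finally show ?thesis .
  qed
  have "(\<lambda>K. (1 - 1 / \<gamma>) ^ K) sums (1 / (1 - (1 - 1 / \<gamma>)))"
    using \<gamma> by (intro geometric_sums) auto
  then have "(\<lambda>n. ennreal (\<Sum>K<n. (1 - 1 / \<gamma>) ^ K)) \<longlonglongrightarrow> ennreal \<gamma>"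
    unfolding sums_def by (intro tendsto_ennrealI) simp
  then show ?thesis
    by (rule LIMSEQ_le_const2) (use le in auto)
qed

end

section \<open>From the abstract chain to the mixture-WD-CuSum test\<close>

text \<open>The logarithm with value \<open>-\<infinity>\<close> at 0, so that products of
  nonnegative reals become sums without exception.\<close>

definition eln :: "real \<Rightarrow> ereal" where
  "eln q = log_ratio q 1"

lemma eln_mono: "0 \<le> a \<Longrightarrow> a \<le> b \<Longrightarrow> eln a \<le> eln b"
  by (auto simp: eln_def log_ratio_def)

lemma eln_mult: "0 \<le> a \<Longrightarrow> 0 \<le> b \<Longrightarrow> eln (a * b) = eln a + eln b"
  by (auto simp: eln_def log_ratio_def ln_mult)

lemma eln_pos: "0 < a \<Longrightarrow> eln a = ereal (ln a)"
  by (simp add: eln_def log_ratio_def)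

lemma le_eln_iff: "0 \<le> a \<Longrightarrow> 0 < c \<Longrightarrow> ereal (ln c) \<le> eln a \<longleftrightarrow> c \<le> a"
  by (auto simp: eln_def log_ratio_def)

text \<open>The null factors cancel sensor by sensor. This makes the mixture ratio a symmetric
  function of the sensorwise ratios, to which the monotonicity results apply.\<close>

lemma mixture_density_ratio:
  assumes g: "\<And>l. l \<in> {1..L} \<Longrightarrow> 0 < g (x l)"
  shows "mixture_density g f L m i x / null_density g L x = esym_mean L (\<lambda>y. f y / g y) (m + i - 1) x"
proof -
  have "anomaly_density g f L A x / null_density g L x = (\<Prod>l\<in>A. f (x l) / g (x l))" if A: "A \<subseteq> {1..L}" for A
  proof -
    have "null_density g L x = (\<Prod>l\<in>A. g (x l)) * (\<Prod>l\<in>{1..L} - A. g (x l))"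
      unfolding null_density_def using A by (subst prod.subset_diff[of A]) (auto simp: mult.commute)
    moreover have "(\<Prod>l\<in>{1..L} - A. g (x l)) \<noteq> 0" "(\<Prod>l\<in>A. g (x l)) \<noteq> 0"
      using g A finite_subset[OF A] by (force simp: prod_zero_iff)+
    ultimately show ?thesis
      unfolding anomaly_density_def by (simp add: prod_dividef)
  qed
  then have "(\<Sum>A | A \<subseteq> {1..L} \<and> card A = m + i - 1. anomaly_density g f L A x) / null_density g L x
     = (\<Sum>A | A \<subseteq> {1..L} \<and> card A = m + i - 1. \<Prod>l\<in>A. f (x l) / g (x l))"
    unfolding sum_divide_distrib by (intro sum.cong) auto
  moreover have "mixture_density g f L m i x / null_density g L x
     = (\<Sum>A | A \<subseteq> {1..L} \<and> card A = m + i - 1. anomaly_density g f L A x) / null_density g L x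
       / real (L choose (m + i - 1))"
    unfolding mixture_density_def by simp
  ultimately show ?thesis
    unfolding esym_mean_def by simp
qed

lemma null_density_pos: "(\<And>l. l \<in> {1..L} \<Longrightarrow> 0 < g (x l)) \<Longrightarrow> 0 < null_density g L x"
  unfolding null_density_def by (intro prod_pos) auto

lemma esym_mean_mono:
  assumes "\<And>l. l \<in> {1..L} \<Longrightarrow> 0 \<le> R (x l)" "\<And>l. l \<in> {1..L} \<Longrightarrow> R (x l) \<le> R' (x l)"
  shows "esym_mean L R s x \<le> esym_mean L R' s x"
  unfolding esym_mean_def using assms by (intro divide_right_mono sum_mono prod_mono) auto

lemma mixture_llr_le_eln:
  assumes g: "\<And>l. l \<in> {1..L} \<Longrightarrow> 0 < g (x l)" and f: "\<And>y. 0 \<le> f y"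
    and R: "\<And>l. l \<in> {1..L} \<Longrightarrow> f (x l) / g (x l) \<le> R (x l)"
  shows "mixture_llr g f L m i x \<le> eln (esym_mean L R (m + i - 1) x)"
proof -
  have n: "0 < null_density g L x" using g by (rule null_density_pos)
  have "mixture_llr g f L m i x = eln (mixture_density g f L m i x / null_density g L x)"
    using n by (auto simp: mixture_llr_def eln_def log_ratio_def)
  also have "\<dots> = eln (esym_mean L (\<lambda>y. f y / g y) (m + i - 1) x)"
    using mixture_density_ratio[of L g x f m i] g by simp
  also have "\<dots> \<le> eln (esym_mean L R (m + i - 1) x)"
  proof (rule eln_mono)
    have fg: "0 \<le> f (x l) / g (x l)" if "l \<in> {1..L}" for l
      using f g[OF that] by (intro divide_nonneg_pos) auto
    show "0 \<le> esym_mean L (\<lambda>y. f y / g y) (m + i - 1) x"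
      unfolding esym_mean_def
    proof (rule divide_nonneg_nonneg, rule sum_nonneg, rule prod_nonneg)
      fix A l assume "A \<in> {A. A \<subseteq> {1..L} \<and> card A = m + i - 1}" "l \<in> A"
      then have "l \<in> {1..L}" by auto
      then show "0 \<le> f (x l) / g (x l)" by (rule fg)
    qed simp
    show "esym_mean L (\<lambda>y. f y / g y) (m + i - 1) x \<le> esym_mean L R (m + i - 1) x"
      using fg R by (intro esym_mean_mono) auto
  qed
  finally show ?thesis .
qed

theorem null_expectation_WD_CuSum_ge:
  assumes g: "is_pdf g" and f: "is_pdf f" and mn: "1 \<le> m" "m \<le> n" "n \<le> L"
    and \<rho>: "\<forall>i\<in>{1..n - m}. 0 < \<rho> i \<and> \<rho> i < 1" and \<gamma>: "0 < \<gamma>"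
  shows "ennreal \<gamma> \<le> null_expectation g L (WD_CuSum g f L m n \<rho> (ln \<gamma>))"
proof -
  define G where "G = density lborel (\<lambda>y. ennreal (g y))"
  define q where "q y = f y / g y" for y
  \<comment> \<open>\<open>\<beta>\<close> is the mass that \<open>f\<close> puts where
    \<open>g\<close> is positive, which is less than 1 if \<open>f\<close> is not absolutely
    continuous. Adding \<open>1 - \<beta>\<close> to the ratio restores mean 1 and only makes the
    statistics larger, so a lower bound for the time to alarm with \<open>R\<close> carries over to
    the test.\<close>
  define \<beta> where "\<beta> = enn2real (\<integral>\<^sup>+ y. ennreal (q y) \<partial>G)"
  define R where "R y = q y + (1 - \<beta>)" for y
  define r where "r = ext_rho m n \<rho>"
  define N where "N = n - m + 1"
  have [measurable]: "g \<in> borel_measurable borel" "f \<in> borel_measurable borel"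
    and g0: "\<And>y. 0 \<le> g y" and f0: "\<And>y. 0 \<le> f y"
    using g f by (auto simp: is_pdf_def)
  have [measurable]: "q \<in> borel_measurable borel" unfolding q_def[abs_def] by measurable
  have q0: "0 \<le> q y" for y using f0 g0 by (simp add: q_def)
  interpret GP: prob_space G unfolding G_def by (rule prob_space_density_pdf[OF g])
  have "(\<integral>\<^sup>+ y. ennreal (q y) \<partial>G) = (\<integral>\<^sup>+ y. ennreal (g y) * ennreal (q y) \<partial>lborel)"
    unfolding G_def by (rule nn_integral_density) auto
  also have "\<dots> \<le> (\<integral>\<^sup>+ y. ennreal (f y) \<partial>lborel)"
    using g0 f0 by (intro nn_integral_mono) (auto simp: q_def ennreal_mult[symmetric] intro!: ennreal_leI)
  also have "\<dots> = 1" using f by (simp add: is_pdf_def)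
  finally have q1: "(\<integral>\<^sup>+ y. ennreal (q y) \<partial>G) \<le> 1" .
  then have \<beta>: "(\<integral>\<^sup>+ y. ennreal (q y) \<partial>G) = ennreal \<beta>" "0 \<le> \<beta>" "\<beta> \<le> 1"
    unfolding \<beta>_def using enn2real_leI[of 1 "(\<integral>\<^sup>+ y. ennreal (q y) \<partial>G)"]
    by (auto simp: ennreal_enn2real_if top_unique)
  have R0: "0 \<le> R y" for y using q0[of y] \<beta> by (simp add: R_def)
  have "(\<integral>\<^sup>+ y. ennreal (R y) \<partial>G) = (\<integral>\<^sup>+ y. ennreal (q y) + ennreal (1 - \<beta>) \<partial>G)"
    unfolding R_def using q0 \<beta> by (intro nn_integral_cong) (simp add: ennreal_plus)
  also have "\<dots> = (\<integral>\<^sup>+ y. ennreal (q y) \<partial>G) + (\<integral>\<^sup>+ y. ennreal (1 - \<beta>) \<partial>G)"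
    by (rule nn_integral_add) (auto simp: G_def)
  also have "\<dots> = 1"
    using \<beta> by (simp add: GP.emeasure_space_1 ennreal_plus[symmetric] del: ennreal_plus)
  finally have R1: "(\<integral>\<^sup>+ y. ennreal (R y) \<partial>G) = 1" .
  interpret phase_chain G R L m N r
  proof
    show "R \<in> borel_measurable borel" unfolding R_def[abs_def] by measurable
    show "m + N \<le> Suc L" using mn by (simp add: N_def)
    show "0 < r i \<and> r i < 1" if "i \<in> {1..<N}" for i
      using \<rho> that by (auto simp: r_def ext_rho_def N_def)
  qed (use R0 R1 mn in \<open>auto simp: G_def N_def r_def ext_rho_def\<close>)
  have \<mu>: "null_prob g L = \<mu>"
    unfolding null_prob_def \<mu>_def obs_def obs_law_null[OF g] G_def[symmetric] ..
  \<comment> \<open>Null observations almost surely avoid the zeros of \<open>g\<close>, where the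
    quotient \<open>f y / g y\<close> is not the likelihood ratio.\<close>
  have AEg: "AE w in \<mu>. \<forall>k\<in>{1..}. \<forall>l\<in>{1..L}. 0 < g (w k l)"
  proof -
    have "AE y in G. 0 < g y"
      unfolding G_def by (subst AE_density) (auto simp: ennreal_eq_0_iff)
    then have "AE x in obs. 0 < g (x l)" if "l \<in> {1..L}" for l
      unfolding obs_def using that by (intro AE_PiM_component prob_G)
    then have "AE x in obs. \<forall>l\<in>{1..L}. 0 < g (x l)"
      by (intro AE_ball_countable[THEN iffD2]) auto
    then have "AE w in \<mu>. \<forall>l\<in>{1..L}. 0 < g (w k l)" if "k \<in> {1..}" for k
      unfolding \<mu>_def using that by (intro AE_PiM_component prob_obs)
    then show ?thesis
      by (intro AE_ball_countable[THEN iffD2]) auto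
  qed
  have WD_le: "WD_stat g f L m n \<rho> w k i \<le> eln (Q k i w)"
    if w: "\<forall>k\<in>{1..}. \<forall>l\<in>{1..L}. 0 < g (w k l)" and "i \<le> N" for w k i
    using that(2)
  proof (induction k arbitrary: i)
    case 0
    then show ?case by (simp add: eln_def log_ratio_def)
  next
    case (Suc k)
    show ?case
    proof (cases "i = 0")
      case True
      then show ?thesis by (simp add: eln_def log_ratio_def)
    next
      case False
      let ?M = "Max ((\<lambda>j. Q k j w * (\<Prod>s\<in>{j..<i}. r s)) ` {0..i})"
      have M0: "0 \<le> ?M"
        using Suc.prems r_range Q_nonneg[of i k w]
        by (intro Max_ge_iff[THEN iffD2] bexI[of _ "Q k i w"]) (auto intro!: rev_image_eqI[of i])
      have "Max ((\<lambda>j. WD_stat g f L m n \<rho> w k j + ereal (\<Sum>s\<in>{j..<i}. ln (ext_rho m n \<rho> s))) ` {0..i}) \<le> eln ?M"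
      proof (rule Max.boundedI)
        fix a assume "a \<in> (\<lambda>j. WD_stat g f L m n \<rho> w k j + ereal (\<Sum>s\<in>{j..<i}. ln (ext_rho m n \<rho> s))) ` {0..i}"
        then obtain j where j: "j \<le> i" "a = WD_stat g f L m n \<rho> w k j + ereal (\<Sum>s\<in>{j..<i}. ln (r s))"
          by (auto simp: r_def)
        have rp: "0 < r s" if "s \<in> {j..<i}" for s using that Suc.prems by (intro r_pos) auto
        have pp: "0 < (\<Prod>s\<in>{j..<i}. r s)" using rp by (intro prod_pos) auto
        have "ereal (\<Sum>s\<in>{j..<i}. ln (r s)) = eln (\<Prod>s\<in>{j..<i}. r s)"
          using pp ln_prod[of "{j..<i}" r] rp by (force simp: eln_pos)
        then have "a \<le> eln (Q k j w) + eln (\<Prod>s\<in>{j..<i}. r s)"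
          unfolding j(2) using Suc.IH[of j] j Suc.prems by (intro add_mono) auto
        also have "\<dots> = eln (Q k j w * (\<Prod>s\<in>{j..<i}. r s))"
          using Q_nonneg[of j k w] j Suc.prems pp by (intro eln_mult[symmetric]) auto
        also have "\<dots> \<le> eln ?M"
          using j Q_nonneg[of j k w] Suc.prems pp
          by (intro eln_mono Max_ge) auto
        finally show "a \<le> eln ?M" .
      qed auto
      moreover have "mixture_llr g f L m i (w (Suc k)) \<le> eln (Lm i (w (Suc k)))"
        unfolding Lm_def using w f0 \<beta> by (intro mixture_llr_le_eln) (auto simp: R_def q_def)
      moreover have "r i < 1"
        using r_bounds[of i] False Suc.prems rN by (cases "i = N") auto
      then have "ereal (ln (1 - ext_rho m n \<rho> i)) = eln (1 - r i)"
        by (subst eln_pos) (auto simp: r_def)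
      ultimately have "WD_stat g f L m n \<rho> w (Suc k) i \<le> eln ?M + eln (Lm i (w (Suc k))) + eln (1 - r i)"
        using False by (auto intro!: add_mono)
      also have "\<dots> = eln (Q (Suc k) i w)"
        using False M0 Lm_nonneg[of i "w (Suc k)"] r_range[of i] Suc.prems by (simp add: eln_mult)
      finally show ?thesis .
    qed
  qed
  define \<tau> where "\<tau> = WD_CuSum g f L m n \<rho> (ln \<gamma>)"
  have \<tau>1: "1 \<le> \<tau> w" for w
    unfolding \<tau>_def WD_CuSum_def by (intro Inf_greatest) (auto simp: one_enat_def)
  have "ennreal \<gamma> \<le> (\<integral>\<^sup>+ w. ennreal_of_enat (\<tau> w) \<partial>\<mu>)"
  \<comment> \<open>For \<open>\<gamma> \<le> 1\<close> it suffices that an alarm takes at least one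
    step. For larger \<gamma> the threshold is positive, so the 0 inside the maximum cannot cause an
    alarm.\<close>
  proof (cases "\<gamma> \<le> 1")
    case True
    interpret prob_space \<mu> by (rule prob_\<mu>)
    have "ennreal \<gamma> \<le> 1" using True by (simp add: ennreal_le_1)
    also have "\<dots> = (\<integral>\<^sup>+ w. 1 \<partial>\<mu>)" by (simp add: emeasure_space_1)
    also have "\<dots> \<le> (\<integral>\<^sup>+ w. ennreal_of_enat (\<tau> w) \<partial>\<mu>)"
    proof (rule nn_integral_mono)
      fix w
      have "ennreal_of_enat 1 \<le> ennreal_of_enat (\<tau> w)"
        using \<tau>1 by (simp only: ennreal_of_enat_le_iff)
      then show "1 \<le> ennreal_of_enat (\<tau> w)" by (simp add: one_enat_def)
    qed
    finally show ?thesis .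
  next
    case False
    then have \<gamma>1: "1 < \<gamma>" by simp
    show ?thesis
    proof (rule nn_integral_ge_if_quiet[of \<gamma>])
      show "AE w in \<mu>. \<forall>K. w \<in> quiet \<gamma> K \<longrightarrow> of_nat (Suc K) \<le> ennreal_of_enat (\<tau> w)"
        using AEg
      proof (rule eventually_mono, intro allI impI)
        fix w K assume w: "\<forall>k\<in>{1..}. \<forall>l\<in>{1..L}. 0 < g (w k l)" and K: "w \<in> quiet \<gamma> K"
        have "enat (Suc K) \<le> \<tau> w"
          unfolding \<tau>_def WD_CuSum_def
        proof (rule Inf_greatest, clarify)
          fix k assume k: "1 \<le> k" "ereal (ln \<gamma>) \<le> WD_max g f L m n \<rho> w k"
          have "WD_max g f L m n \<rho> w k \<in> insert 0 ((\<lambda>i. WD_stat g f L m n \<rho> w k i) ` {1..N})"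
            unfolding WD_max_def N_def by (rule Max_in) auto
          moreover have "WD_max g f L m n \<rho> w k \<noteq> 0"
            using k(2) \<gamma>1 by (auto simp: zero_ereal_def)
          ultimately obtain i where i: "i \<in> {1..N}" "WD_max g f L m n \<rho> w k = WD_stat g f L m n \<rho> w k i"
            by auto
          then have "ereal (ln \<gamma>) \<le> eln (Q k i w)"
            using k(2) WD_le[OF w, of i k] by auto
          then have "\<gamma> \<le> Q k i w"
            using Q_nonneg[of i k w] i \<gamma> by (subst (asm) le_eln_iff) auto
          then have "\<not> k \<le> K"
            using K i k(1) unfolding quiet_def by force
          then show "enat (Suc K) \<le> enat k" by simp
        qed
        then have "ennreal_of_enat (enat (Suc K)) \<le> ennreal_of_enat (\<tau> w)"
          by (simp only: ennreal_of_enat_le_iff)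
        then show "of_nat (Suc K) \<le> ennreal_of_enat (\<tau> w)"
          by (simp only: ennreal_of_enat_enat)
      qed
    qed (use \<gamma>1 in auto)
  qed
  then show ?thesis
    by (simp add: null_expectation_def \<mu> \<tau>_def)
qed

section \<open>A weak law of large numbers for finitely many laws\<close>

definition trunc :: "real \<Rightarrow> real \<Rightarrow> real" where
  "trunc B x = (if \<bar>x\<bar> \<le> B then x else 0)"

lemma trunc_meas [measurable]: "trunc B \<in> borel_measurable borel"
  unfolding trunc_def[abs_def] by measurable

lemma trunc_bound: "0 \<le> B \<Longrightarrow> \<bar>trunc B x\<bar> \<le> B"
  by (auto simp: trunc_def)

text \<open>Dominated convergence for each law; finiteness of the family yields a common
  level.\<close>

lemma ex_trunc_level:
  assumes "finite \<L>" and \<L>: "\<And>\<nu>. \<nu> \<in> \<L> \<Longrightarrow> sets \<nu> = sets borel \<and> integrable \<nu> (\<lambda>x::real. x)" and \<eta>: "0 < \<eta>"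
  shows "\<exists>B\<ge>1. \<forall>\<nu>\<in>\<L>. (\<integral>x. \<bar>x - trunc B x\<bar> \<partial>\<nu>) \<le> \<eta>"
proof -
  have ev: "\<forall>\<^sub>F k in sequentially. (\<integral>x. \<bar>x - trunc (real k) x\<bar> \<partial>\<nu>) \<le> \<eta>" if "\<nu> \<in> \<L>" for \<nu>
  proof -
    have [measurable_cong]: "sets \<nu> = sets borel" and int: "integrable \<nu> (\<lambda>x. x)" using \<L>[OF that] by auto
    have "(\<lambda>k. \<integral>x. \<bar>x - trunc (real k) x\<bar> \<partial>\<nu>) \<longlonglongrightarrow> (\<integral>x. 0 \<partial>\<nu>)"
    proof (rule integral_dominated_convergence[where w = "\<lambda>x. \<bar>x\<bar>"])
      show "integrable \<nu> (\<lambda>x. \<bar>x\<bar>)" using int by simp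
      show "AE x in \<nu>. (\<lambda>k. \<bar>x - trunc (real k) x\<bar>) \<longlonglongrightarrow> 0"
      proof (rule AE_I2)
        fix x :: real
        obtain k0 where "\<bar>x\<bar> \<le> real k0" using real_arch_simple by blast
        then have "\<forall>\<^sub>F k in sequentially. \<bar>x - trunc (real k) x\<bar> = 0"
          by (intro eventually_sequentiallyI[of k0]) (auto simp: trunc_def)
        then show "(\<lambda>k. \<bar>x - trunc (real k) x\<bar>) \<longlonglongrightarrow> 0"
          by (rule tendsto_eventually)
      qed
    qed (auto simp: trunc_def)
    then have "\<forall>\<^sub>F k in sequentially. (\<integral>x. \<bar>x - trunc (real k) x\<bar> \<partial>\<nu>) < \<eta>"
      using \<eta> by (auto dest: order_tendstoD)
    then show ?thesis by (rule eventually_mono) auto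
  qed
  have "\<forall>\<^sub>F k in sequentially. \<forall>\<nu>\<in>\<L>. (\<integral>x. \<bar>x - trunc (real k) x\<bar> \<partial>\<nu>) \<le> \<eta>"
    using assms(1) ev by (rule eventually_ball_finite[rule_format])
  then have "\<forall>\<^sub>F k in sequentially. 1 \<le> k \<and> (\<forall>\<nu>\<in>\<L>. (\<integral>x. \<bar>x - trunc (real k) x\<bar> \<partial>\<nu>) \<le> \<eta>)"
    using eventually_ge_at_top[of 1] by eventually_elim auto
  then obtain k where "1 \<le> k" "\<forall>\<nu>\<in>\<L>. (\<integral>x. \<bar>x - trunc (real k) x\<bar> \<partial>\<nu>) \<le> \<eta>"
    by (auto simp: eventually_sequentially)
  then show ?thesis by (intro exI[of _ "real k"]) auto
qed

text \<open>By independence and centring, only the diagonal terms of the squared sum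
  survive.\<close>

lemma (in prob_space) second_moment_sum_le:
  fixes Y :: "nat \<Rightarrow> 'a \<Rightarrow> real"
  assumes indep: "indep_vars (\<lambda>_. borel) Y {..<n}"
    and bound: "\<And>u x. \<bar>Y u x\<bar> \<le> C" and mean0: "\<And>u. u < n \<Longrightarrow> expectation (Y u) = 0"
  shows "expectation (\<lambda>x. (\<Sum>u<n. Y u x)\<^sup>2) \<le> real n * C\<^sup>2"
    and "integrable M (\<lambda>x. (\<Sum>u<n. Y u x)\<^sup>2)"
proof -
  have meas: "Y u \<in> borel_measurable M" if "u < n" for u
    using indep that by (auto simp: indep_vars_def)
  have int: "integrable M (Y u)" if "u < n" for u
    using meas[OF that] bound by (intro integrable_const_bound[of _ C]) auto
  have C0: "0 \<le> C" using bound[of 0 undefined] by linarith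
  have bnd: "\<bar>Y u x * Y v x\<bar> \<le> C * C" for u v x
    unfolding abs_mult using bound C0 by (intro mult_mono) auto
  have intm: "integrable M (\<lambda>x. Y u x * Y v x)" if "u < n" "v < n" for u v
    using meas[OF that(1)] meas[OF that(2)] bnd by (intro integrable_const_bound[of _ "C * C"]) auto
  have eq: "(\<Sum>u<n. Y u x)\<^sup>2 = (\<Sum>u<n. \<Sum>v<n. Y u x * Y v x)" for x
    by (simp add: power2_eq_square sum_product)
  show "integrable M (\<lambda>x. (\<Sum>u<n. Y u x)\<^sup>2)"
    unfolding eq by (intro Bochner_Integration.integrable_sum intm) auto
  have cross: "expectation (\<lambda>x. Y u x * Y v x) \<le> (if u = v then C * C else 0)" if "u < n" "v < n" for u v
  proof (cases "u = v")
    case True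
    have "expectation (\<lambda>x. Y u x * Y v x) \<le> expectation (\<lambda>_. C * C)"
      using intm[OF that] bnd by (intro integral_mono) (auto simp: abs_le_iff)
    then show ?thesis using True by (simp add: prob_space)
  next
    case False
    have "indep_vars (\<lambda>_. borel) Y {u, v}"
      using indep that by (intro indep_vars_subset[OF indep]) auto
    then have "expectation (\<lambda>x. \<Prod>i\<in>{u, v}. Y i x) = (\<Prod>i\<in>{u, v}. expectation (Y i))"
      using int that by (intro indep_vars_lebesgue_integral) auto
    then show ?thesis using False mean0 that by simp
  qed
  have "expectation (\<lambda>x. (\<Sum>u<n. Y u x)\<^sup>2) = (\<Sum>u<n. \<Sum>v<n. expectation (\<lambda>x. Y u x * Y v x))"
    unfolding eq
    by (subst Bochner_Integration.integral_sum) (auto intro!: sum.cong Bochner_Integration.integral_sum Bochner_Integration.integrable_sum intm)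
  also have "\<dots> \<le> (\<Sum>u<n. \<Sum>v<n. (if u = v then C * C else 0))"
    by (intro sum_mono cross) auto
  also have "\<dots> = real n * C\<^sup>2"
    by (simp add: power2_eq_square)
  finally show "expectation (\<lambda>x. (\<Sum>u<n. Y u x)\<^sup>2) \<le> real n * C\<^sup>2" .
qed

text \<open>The truncation level serves the finitely many laws at once; the truncated sums are
  controlled by their second moments, the remainders by their first.\<close>

theorem uniform_weak_law:
  fixes \<delta> \<epsilon> :: real
  assumes fin: "finite \<L>"
    and \<L>: "\<And>\<nu>. \<nu> \<in> \<L> \<Longrightarrow> sets \<nu> = sets borel \<and> integrable \<nu> (\<lambda>x::real. x)"
    and \<delta>: "0 < \<delta>" and \<epsilon>: "0 < \<epsilon>"
  shows "\<exists>n0::nat. \<forall>n\<ge>n0. \<forall>(M :: 'a measure) X. prob_space M \<longrightarrow>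
    prob_space.indep_vars M (\<lambda>_. borel) X {..<n} \<longrightarrow> (\<forall>u<n. distr M borel (X u) \<in> \<L>) \<longrightarrow>
    measure M {x \<in> space M. \<delta> * real n < \<bar>\<Sum>u<n. X u x - (\<integral>y. y \<partial>distr M borel (X u))\<bar>} \<le> \<epsilon>"
proof -
  \<comment> \<open>Centring doubles the first moment of a remainder to at most
    \<open>2 * \<eta>\<close>, so Markov's inequality for the sum of \<open>n\<close> remainders at
    level \<open>\<delta> * n / 2\<close> gives
    \<open>4 * \<eta> / \<delta> = \<epsilon> / 2\<close>.\<close>
  define \<eta> where "\<eta> = \<epsilon> * \<delta> / 8"
  have \<eta>: "0 < \<eta>" using \<delta> \<epsilon> by (simp add: \<eta>_def)
  obtain B where B: "1 \<le> B" "\<And>\<nu>. \<nu> \<in> \<L> \<Longrightarrow> (\<integral>x. \<bar>x - trunc B x\<bar> \<partial>\<nu>) \<le> \<eta>"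
    using ex_trunc_level[OF fin \<L> \<eta>] by blast
  \<comment> \<open>The centred truncated variables are bounded by \<open>2 * B\<close>; Chebyshev's
    inequality at level \<open>\<delta> * n / 2\<close> gives 16 B^2 / (\<delta>^2 n), which is at
    most \<open>\<epsilon> / 2\<close> from \<open>n0\<close> on. Nothing here depends on the
    particular sequence of variables.\<close>
  define n0 where "n0 = nat \<lceil>16 * B\<^sup>2 / \<delta>\<^sup>2 / (\<epsilon> / 2)\<rceil> + 1"
  show ?thesis
  proof (rule exI[of _ n0], intro allI impI)
    fix n M and X :: "nat \<Rightarrow> 'a \<Rightarrow> real"
    assume n: "n0 \<le> n" and "prob_space M" and indep: "prob_space.indep_vars M (\<lambda>_. borel) X {..<n}"
      and laws: "\<forall>u<n. distr M borel (X u) \<in> \<L>"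
    interpret prob_space M by fact
    have n1: "1 \<le> n" using n by (simp add: n0_def)
    have nr: "16 * B\<^sup>2 / \<delta>\<^sup>2 / (\<epsilon> / 2) \<le> real n"
      using n unfolding n0_def by linarith
    have meas [measurable]: "X u \<in> borel_measurable M" if "u < n" for u
      using indep that by (auto simp: indep_vars_def)
    have intX: "integrable M (X u)" if u: "u < n" for u
    proof -
      have "integrable (distr M borel (X u)) (\<lambda>x. x)" using \<L> laws u by blast
      then show ?thesis
        using integrable_distr_eq[OF meas[OF u], of "\<lambda>x. x"] by simp
    qed
    define mean where "mean u = (\<integral>y. y \<partial>distr M borel (X u))" for u
    have mean: "mean u = expectation (X u)" if "u < n" for u
      unfolding mean_def using meas[OF that] by (subst integral_distr) auto
    define X1 where "X1 u x = trunc B (X u x)" for u x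
    define X2 where "X2 u x = X u x - trunc B (X u x)" for u x
    have B0: "0 \<le> B" using B by simp
    have m1 [measurable]: "X1 u \<in> borel_measurable M" and m2 [measurable]: "X2 u \<in> borel_measurable M" if "u < n" for u
      unfolding X1_def[abs_def] X2_def[abs_def] using meas[OF that] by measurable
    have i1: "integrable M (X1 u)" if "u < n" for u
      using m1[OF that] trunc_bound[OF B0] by (intro integrable_const_bound[of _ B]) (auto simp: X1_def)
    have i2: "integrable M (X2 u)" if "u < n" for u
    proof -
      have "integrable M (\<lambda>x. X u x - X1 u x)" using intX i1 that by (intro Bochner_Integration.integrable_diff)
      then show ?thesis by (simp add: X1_def X2_def[abs_def])
    qed
    \<comment> \<open>The value 0 beyond \<open>n\<close> makes the bound by \<open>2 * B\<close>
      hold at every index, in the form required by the second moment estimate.\<close>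
    define Y where "Y u x = (if u < n then X1 u x - expectation (X1 u) else 0)" for u x
    define V where "V u x = X2 u x - expectation (X2 u)" for u x
    have XYV: "X u x - mean u = Y u x + V u x" if "u < n" for u x
    proof -
      have "expectation (X u) = expectation (\<lambda>x. X1 u x + X2 u x)"
        by (simp add: X1_def X2_def)
      also have "\<dots> = expectation (X1 u) + expectation (X2 u)"
        using i1 i2 that by (intro Bochner_Integration.integral_add)
      finally show ?thesis
        using mean[OF that] that by (simp add: Y_def V_def) (simp add: X1_def X2_def)
    qed
    have absX1: "\<bar>expectation (X1 u)\<bar> \<le> B" if "u < n" for u
    proof -
      have "\<bar>expectation (X1 u)\<bar> \<le> expectation (\<lambda>x. \<bar>X1 u x\<bar>)" by (rule integral_abs_bound)
      also have "\<dots> \<le> expectation (\<lambda>_. B)"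
      proof (rule integral_mono)
        show "integrable M (\<lambda>x. \<bar>X1 u x\<bar>)" using i1[OF that] by simp
        show "\<bar>X1 u x\<bar> \<le> B" for x using trunc_bound[OF B0] by (simp add: X1_def)
      qed simp
      finally show ?thesis by (simp add: prob_space)
    qed
    have Yb: "\<bar>Y u x\<bar> \<le> 2 * B" for u x
      using absX1[of u] trunc_bound[OF B0, of "X u x"] B0 by (auto simp: Y_def X1_def)
    have Y_eq: "Y u = (\<lambda>x. X1 u x - expectation (X1 u))" if "u < n" for u
      using that by (simp add: Y_def fun_eq_iff)
    have Ymean: "expectation (Y u) = 0" if "u < n" for u
      unfolding Y_eq[OF that] using i1[OF that] by (simp add: prob_space)
    have Yindep: "indep_vars (\<lambda>_. borel) Y {..<n}"
    proof -
      have "indep_vars (\<lambda>_. borel) (\<lambda>u x. (\<lambda>y. trunc B y - expectation (X1 u)) (X u x)) {..<n}"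
        by (rule indep_vars_compose2[OF indep]) measurable
      moreover have "indep_vars (\<lambda>_. borel) Y {..<n} =
          indep_vars (\<lambda>_. borel) (\<lambda>u x. (\<lambda>y. trunc B y - expectation (X1 u)) (X u x)) {..<n}"
        by (rule indep_vars_cong) (auto simp: Y_eq X1_def fun_eq_iff)
      ultimately show ?thesis by simp
    qed
    have Ym [measurable]: "Y u \<in> borel_measurable M" for u
      unfolding Y_def[abs_def] using m1[of u] by (cases "u < n") auto
    have Vm [measurable]: "V u \<in> borel_measurable M" if "u < n" for u
      unfolding V_def[abs_def] using m2[OF that] by measurable
    have iV: "integrable M (\<lambda>x. \<bar>V u x\<bar>)" if "u < n" for u
      unfolding V_def using i2[OF that] by auto
    have EV: "expectation (\<lambda>x. \<bar>V u x\<bar>) \<le> 2 * \<eta>" if u: "u < n" for u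
    proof -
      have e: "expectation (\<lambda>x. \<bar>X2 u x\<bar>) \<le> \<eta>"
      proof -
        have "expectation (\<lambda>x. \<bar>X2 u x\<bar>) = (\<integral>y. \<bar>y - trunc B y\<bar> \<partial>distr M borel (X u))"
          using meas[OF u] by (subst integral_distr) (auto simp: X2_def)
        then show ?thesis using B(2) laws u by simp
      qed
      have "expectation (\<lambda>x. \<bar>V u x\<bar>) \<le> expectation (\<lambda>x. \<bar>X2 u x\<bar> + \<bar>expectation (X2 u)\<bar>)"
        using iV[OF u] i2[OF u] unfolding V_def by (intro integral_mono) auto
      also have "\<dots> = expectation (\<lambda>x. \<bar>X2 u x\<bar>) + \<bar>expectation (X2 u)\<bar>"
        using i2[OF u] by (simp add: prob_space)
      also have "\<dots> \<le> 2 * \<eta>"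
        using e order_trans[OF integral_abs_bound e] by linarith
      finally show ?thesis .
    qed
    define c where "c = \<delta> * real n"
    have c: "0 < c" using \<delta> n1 by (simp add: c_def)
    let ?bad = "{x \<in> space M. c < \<bar>\<Sum>u<n. X u x - mean u\<bar>}"
    let ?A = "{x \<in> space M. c / 2 \<le> (\<Sum>u<n. \<bar>V u x\<bar>)}"
    let ?D = "{x \<in> space M. (c / 2)\<^sup>2 \<le> (\<Sum>u<n. Y u x)\<^sup>2}"
    have Am [measurable]: "?A \<in> events"
    proof -
      have "(\<lambda>x. \<Sum>u<n. \<bar>V u x\<bar>) \<in> borel_measurable M"
        by (intro borel_measurable_sum borel_measurable_abs) auto
      then show ?thesis by measurable
    qed
    have "?bad \<subseteq> ?A \<union> ?D"
    proof (rule ccontr)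
      assume "\<not> ?bad \<subseteq> ?A \<union> ?D"
      then obtain x where x: "c < \<bar>\<Sum>u<n. X u x - mean u\<bar>"
        "(\<Sum>u<n. \<bar>V u x\<bar>) < c / 2" "(\<Sum>u<n. Y u x)\<^sup>2 < (c / 2)\<^sup>2"
        by (force simp: not_le)
      have "\<bar>\<Sum>u<n. Y u x\<bar> < c / 2"
        using power2_less_imp_less[of "\<bar>\<Sum>u<n. Y u x\<bar>" "c / 2"] x(3) c by simp
      moreover have "\<bar>\<Sum>u<n. V u x\<bar> < c / 2"
        using sum_abs[of "\<lambda>u. V u x" "{..<n}"] x(2) by linarith
      moreover have "(\<Sum>u<n. X u x - mean u) = (\<Sum>u<n. Y u x) + (\<Sum>u<n. V u x)"
        unfolding sum.distrib[symmetric] by (intro sum.cong XYV) auto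
      ultimately show False using x(1) by linarith
    qed
    then have "prob ?bad \<le> prob (?A \<union> ?D)"
      by (intro finite_measure_mono) auto
    also have "\<dots> \<le> prob ?A + prob ?D"
      by (intro measure_Un_le) auto
    also have "prob ?D \<le> expectation (\<lambda>x. (\<Sum>u<n. Y u x)\<^sup>2) / (c / 2)\<^sup>2"
      using second_moment_sum_le(2)[OF Yindep Yb Ymean] c
      by (intro integral_Markov_inequality_measure[where A = "{}"]) auto
    also have "\<dots> \<le> (real n * (2 * B)\<^sup>2) / (c / 2)\<^sup>2"
      by (intro divide_right_mono second_moment_sum_le(1)[OF Yindep Yb Ymean]) auto
    also have "\<dots> = 16 * B\<^sup>2 / \<delta>\<^sup>2 / real n"
      using n1 \<delta> by (simp add: c_def power2_eq_square field_simps)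
    also have "\<dots> \<le> \<epsilon> / 2"
    proof -
      have *: "z / real n \<le> \<epsilon> / 2" if "z / (\<epsilon> / 2) \<le> real n" for z
        using that \<epsilon> n1 by (simp add: field_simps)
      show ?thesis by (rule *) (use nr in simp)
    qed
    also have "prob ?A \<le> expectation (\<lambda>x. \<Sum>u<n. \<bar>V u x\<bar>) / (c / 2)"
      using c iV by (intro integral_Markov_inequality_measure[where A = "{}"]) (auto intro!: sum_nonneg)
    also have "expectation (\<lambda>x. \<Sum>u<n. \<bar>V u x\<bar>) = (\<Sum>u<n. expectation (\<lambda>x. \<bar>V u x\<bar>))"
      using iV by (intro Bochner_Integration.integral_sum) auto
    also have "(\<Sum>u<n. expectation (\<lambda>x. \<bar>V u x\<bar>)) / (c / 2) \<le> (\<Sum>u<n. 2 * \<eta>) / (c / 2)"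
      using EV c by (intro divide_right_mono sum_mono) auto
    also have "\<dots> = \<epsilon> / 2"
      using n1 \<delta> by (simp add: c_def \<eta>_def)
    finally show "prob {x \<in> space M. \<delta> * real n < \<bar>\<Sum>u<n. X u x - (\<integral>y. y \<partial>distr M borel (X u))\<bar>} \<le> \<epsilon>"
      by (simp add: c_def mean_def)
  qed
qed

section \<open>Log-likelihood ratios of the anomaly model\<close>

locale anomaly_model =
  fixes g f :: "real \<Rightarrow> real" and L m n :: nat
  assumes g: "is_pdf g" and f: "is_pdf f" and m1: "1 \<le> m" and mn: "m \<le> n" and nL: "n \<le> L"
    and KL: "\<And>i. i \<in> {1..n - m + 1} \<Longrightarrow> 0 < KL_number g f L m i \<and> KL_number g f L m i < \<infinity>"
begin

definition "N = n - m + 1"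
definition "P0 = obs_law L (null_density g L)"
definition "PA A = obs_law L (anomaly_density g f L A)"
definition "PM i = obs_law L (mixture_density g f L m i)"
text \<open>The real-valued version has the value 0 where the log-likelihood ratio is infinite.
  Under the phase-\<open>i\<close> mixture, and under each of its components, this happens with
  probability 0.\<close>

definition "Z i x = real_of_ereal (mixture_llr g f L m i x)"
definition "I i = real_of_ereal (KL_number g f L m i)"
definition "subsets i = {A. A \<subseteq> {1..L} \<and> card A = m + i - 1}"
definition "law i = distr (PM i) borel (Z i)"

abbreviation "null \<equiv> null_density g L"
abbreviation "anom \<equiv> anomaly_density g f L"
abbreviation "mix \<equiv> mixture_density g f L m"

lemma gf_meas [measurable]: "g \<in> borel_measurable borel" "f \<in> borel_measurable borel"
  and gf_nonneg: "0 \<le> g y" "0 \<le> f y"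
  using g f by (auto simp: is_pdf_def)

lemma finite_subsets: "finite (subsets i)"
  by (simp add: subsets_def)

lemma card_subsets: "card (subsets i) = L choose (m + i - 1)"
  unfolding subsets_def using n_subsets[of "{1..L}" "m + i - 1"] by simp

lemma card_subsets_pos: "i \<in> {1..N} \<Longrightarrow> 0 < card (subsets i)"
proof -
  assume "i \<in> {1..N}"
  then have "m + i - 1 \<le> L" using m1 mn nL unfolding N_def by simp arith
  then show ?thesis unfolding card_subsets by (rule zero_less_binomial)
qed

lemma subsets_nonempty: "i \<in> {1..N} \<Longrightarrow> subsets i \<noteq> {}"
  using card_subsets_pos[of i] by auto

lemma N1: "1 \<le> N" by (simp add: N_def)

lemma null_nonneg: "0 \<le> null x" and anom_nonneg: "0 \<le> anom A x" and mix_nonneg: "0 \<le> mix i x"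
  unfolding null_density_def anomaly_density_def mixture_density_def
  by (auto intro!: divide_nonneg_nonneg sum_nonneg mult_nonneg_nonneg prod_nonneg simp: gf_nonneg)

lemma sensor_meas: "l \<in> {1..L} \<Longrightarrow> h \<in> borel_measurable borel \<Longrightarrow> (\<lambda>x. h (x l)) \<in> borel_measurable (obs_space L)"
  unfolding obs_space_def
  by (rule measurable_compose[OF measurable_component_singleton[of l "{1..L}" "\<lambda>_. lborel"]]) auto

lemma null_meas [measurable]: "null \<in> borel_measurable (obs_space L)"
  unfolding null_density_def[abs_def] by (intro borel_measurable_prod sensor_meas) auto

lemma anom_meas [measurable]: "A \<subseteq> {1..L} \<Longrightarrow> anom A \<in> borel_measurable (obs_space L)"
  unfolding anomaly_density_def[abs_def] by (intro borel_measurable_times borel_measurable_prod sensor_meas) auto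

lemma mix_eq: "mix i x = (\<Sum>A\<in>subsets i. anom A x) / real (card (subsets i))"
  unfolding mixture_density_def subsets_def[symmetric] card_subsets ..

lemma mix_meas [measurable]: "mix i \<in> borel_measurable (obs_space L)"
  unfolding mix_eq[abs_def] by (intro borel_measurable_divide borel_measurable_sum anom_meas) (auto simp: subsets_def)

lemma llr_meas [measurable]: "mixture_llr g f L m i \<in> borel_measurable (obs_space L)"
proof -
  have "(\<lambda>x. if mix i x = 0 then -\<infinity> else if null x = 0 then \<infinity> else ereal (ln (mix i x / null x)))
      \<in> borel_measurable (obs_space L)"
    by measurable
  then show ?thesis by (simp add: mixture_llr_def[abs_def] log_ratio_def)
qed

lemma Z_meas [measurable]: "Z i \<in> borel_measurable (obs_space L)"
  unfolding Z_def[abs_def] by measurable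

lemma sets_laws [measurable_cong, simp]: "sets P0 = sets (obs_space L)" "sets (PA A) = sets (obs_space L)" "sets (PM i) = sets (obs_space L)"
  by (simp_all add: P0_def PA_def PM_def obs_law_def)

lemma space_laws [simp]: "space P0 = space (obs_space L)" "space (PA A) = space (obs_space L)" "space (PM i) = space (obs_space L)"
  by (simp_all add: P0_def PA_def PM_def obs_law_def)

lemma prob_P0: "prob_space P0"
  unfolding P0_def by (rule prob_space_obs_null[OF g])

lemma prob_PA: "A \<subseteq> {1..L} \<Longrightarrow> prob_space (PA A)"
  unfolding PA_def by (rule prob_space_obs_anomaly[OF g f])

lemma emeasure_PM:
  assumes "X \<in> sets (obs_space L)"
  shows "emeasure (PM i) X = ennreal (1 / real (card (subsets i))) * (\<Sum>A\<in>subsets i. emeasure (PA A) X)"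
proof -
  have "emeasure (PM i) X = (\<integral>\<^sup>+ x. ennreal (mix i x) * indicator X x \<partial>obs_space L)"
    unfolding PM_def obs_law_def using assms by (intro emeasure_density) auto
  also have "\<dots> = (\<integral>\<^sup>+ x. ennreal (1 / real (card (subsets i))) * (\<Sum>A\<in>subsets i. ennreal (anom A x) * indicator X x) \<partial>obs_space L)"
  proof (rule nn_integral_cong)
    fix x
    have "ennreal (mix i x) = ennreal (1 / real (card (subsets i))) * (\<Sum>A\<in>subsets i. ennreal (anom A x))"
      unfolding mix_eq using anom_nonneg
      by (simp add: sum_ennreal ennreal_mult[symmetric] sum_nonneg)
    then show "ennreal (mix i x) * indicator X x
        = ennreal (1 / real (card (subsets i))) * (\<Sum>A\<in>subsets i. ennreal (anom A x) * indicator X x)"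
      by (simp add: sum_distrib_right mult.assoc)
  qed
  also have "\<dots> = ennreal (1 / real (card (subsets i))) * (\<Sum>A\<in>subsets i. \<integral>\<^sup>+ x. ennreal (anom A x) * indicator X x \<partial>obs_space L)"
  proof -
    have [measurable]: "(\<lambda>x. ennreal (anom A x) * indicator X x) \<in> borel_measurable (obs_space L)" if "A \<in> subsets i" for A
      using that assms by (intro borel_measurable_times_ennreal) (auto simp: subsets_def)
    show ?thesis by (simp add: nn_integral_cmult nn_integral_sum)
  qed
  also have "(\<Sum>A\<in>subsets i. \<integral>\<^sup>+ x. ennreal (anom A x) * indicator X x \<partial>obs_space L) = (\<Sum>A\<in>subsets i. emeasure (PA A) X)"
    unfolding PA_def obs_law_def using assms
    by (intro sum.cong refl emeasure_density[symmetric]) (auto simp: subsets_def)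
  finally show ?thesis .
qed

lemma prob_PM: "i \<in> {1..N} \<Longrightarrow> prob_space (PM i)"
proof (intro prob_spaceI)
  assume i: "i \<in> {1..N}"
  have "(\<Sum>A\<in>subsets i. emeasure (PA A) (space (obs_space L))) = of_nat (card (subsets i))"
    using prob_space.emeasure_space_1[OF prob_PA] by (simp add: subsets_def)
  then have "emeasure (PM i) (space (obs_space L)) = ennreal (1 / real (card (subsets i))) * ennreal (real (card (subsets i)))"
    by (simp add: emeasure_PM ennreal_of_nat_eq_real_of_nat)
  also have "\<dots> = 1"
    using card_subsets_pos[OF i] by (subst ennreal_mult[symmetric]) auto
  finally show "emeasure (PM i) (space (PM i)) = 1" by simp
qed

text \<open>The mixture is a uniform average of the component laws, so its null sets are null for
  each of them.\<close>

lemma AE_PA_of_AE_PM: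
  assumes "AE x in PM i. P x" "A \<in> subsets i"
  shows "AE x in PA A. P x"
proof -
  obtain X where X: "{x \<in> space (PM i). \<not> P x} \<subseteq> X" "emeasure (PM i) X = 0" "X \<in> sets (PM i)"
    using assms(1) by (rule AE_E)
  have "card (subsets i) \<noteq> 0" using assms(2) finite_subsets by auto
  then have "(\<Sum>A\<in>subsets i. emeasure (PA A) X) = 0"
    using X by (auto simp: emeasure_PM ennreal_eq_0_iff)
  then have "emeasure (PA A) X = 0"
    using assms(2) finite_subsets by (simp add: sum_eq_0_iff)
  then show ?thesis
    using X by (intro AE_I[of _ _ X]) auto
qed

lemma AE_mix_pos: "AE x in PM i. 0 < mix i x"
  unfolding PM_def obs_law_def by (subst AE_density) (auto simp: ennreal_eq_0_iff)

text \<open>From ln y <= y - 1, the negative part of the log-ratio weighted by the mixture density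
  is pointwise at most the null density. A finite divergence therefore forces the positive part to
  be integrable too.\<close>

lemma nn_integral_neg_llr_le: "(\<integral>\<^sup>+ x. e2ennreal (- mixture_llr g f L m i x) \<partial>PM i) \<le> 1"
proof -
  have "(\<integral>\<^sup>+ x. e2ennreal (- mixture_llr g f L m i x) \<partial>PM i)
      = (\<integral>\<^sup>+ x. ennreal (mix i x) * e2ennreal (- mixture_llr g f L m i x) \<partial>obs_space L)"
    unfolding PM_def obs_law_def by (rule nn_integral_density) auto
  also have "\<dots> \<le> (\<integral>\<^sup>+ x. ennreal (null x) \<partial>obs_space L)"
  proof (rule nn_integral_mono)
    fix x
    consider "mix i x = 0" | "mix i x \<noteq> 0" "null x = 0" | "0 < mix i x" "0 < null x"
      using mix_nonneg[of i x] null_nonneg[of x] by fastforce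
    then show "ennreal (mix i x) * e2ennreal (- mixture_llr g f L m i x) \<le> ennreal (null x)"
    proof cases
      case 3
      have "- ln (mix i x / null x) = ln (null x / mix i x)"
        using 3 by (simp add: ln_div)
      also have "\<dots> \<le> null x / mix i x - 1"
        using 3 by (intro ln_le_minus_one) auto
      finally have "mix i x * max 0 (- ln (mix i x / null x)) \<le> null x"
        using 3 mult_left_mono[of "- ln (mix i x / null x)" "null x / mix i x - 1" "mix i x"]
        by (auto simp: max_def algebra_simps)
      then have "ennreal (mix i x * max 0 (- ln (mix i x / null x))) \<le> ennreal (null x)"
        by (rule ennreal_leI)
      moreover have "e2ennreal (- mixture_llr g f L m i x) = ennreal (max 0 (- ln (mix i x / null x)))"
        using 3 by (simp add: mixture_llr_def log_ratio_def e2ennreal_ereal max_def ennreal_neg)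
      ultimately show ?thesis
        using 3 by (simp add: ennreal_mult)
    qed (auto simp: mixture_llr_def log_ratio_def e2ennreal_neg)
  qed
  also have "\<dots> = emeasure P0 (space P0)"
    unfolding P0_def obs_law_def by (subst emeasure_density) (auto intro!: nn_integral_cong simp: indicator_def)
  also have "\<dots> = 1" using prob_space.emeasure_space_1[OF prob_P0] .
  finally show ?thesis .
qed

lemma nn_integral_llr_finite:
  assumes "i \<in> {1..N}"
  shows "(\<integral>\<^sup>+ x. e2ennreal (mixture_llr g f L m i x) \<partial>PM i) \<noteq> \<infinity>"
proof
  assume inf: "(\<integral>\<^sup>+ x. e2ennreal (mixture_llr g f L m i x) \<partial>PM i) = \<infinity>"
  have "(\<integral>\<^sup>+ x. e2ennreal (- mixture_llr g f L m i x) \<partial>PM i) < \<top>"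
    using nn_integral_neg_llr_le[of i] by (rule le_less_trans) simp
  then have "KL_number g f L m i = \<infinity>"
    using inf unfolding KL_number_def Let_def PM_def[symmetric]
    by (cases "\<integral>\<^sup>+ x. e2ennreal (- mixture_llr g f L m i x) \<partial>PM i") auto
  then show False using KL[of i] assms by (simp add: N_def)
qed

text \<open>Where the null density vanishes but the mixture does not, the log-ratio is infinite;
  finite divergence thus makes the mixture absolutely continuous with respect to the null
  law.\<close>

lemma AE_PM_pos:
  assumes "i \<in> {1..N}"
  shows "AE x in PM i. 0 < mix i x \<and> 0 < null x"
proof -
  have "AE x in PM i. e2ennreal (mixture_llr g f L m i x) \<noteq> \<infinity>"
    using nn_integral_llr_finite[OF assms] by (intro nn_integral_PInf_AE) auto
  with AE_mix_pos show ?thesis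
  proof eventually_elim
    case (elim x)
    then show ?case
      using null_nonneg[of x] by (cases "null x = 0") (auto simp: mixture_llr_def log_ratio_def)
  qed
qed

lemma llr_pos: "0 < mix i x \<Longrightarrow> 0 < null x \<Longrightarrow> mixture_llr g f L m i x = ereal (Z i x)"
  and Z_pos: "0 < mix i x \<Longrightarrow> 0 < null x \<Longrightarrow> Z i x = ln (mix i x / null x)"
  by (simp_all add: Z_def mixture_llr_def log_ratio_def)

lemma Z_integrable: "i \<in> {1..N} \<Longrightarrow> integrable (PM i) (Z i)"
  and Z_mean: "i \<in> {1..N} \<Longrightarrow> (\<integral>x. Z i x \<partial>PM i) = I i"
proof -
  assume i: "i \<in> {1..N}"
  let ?a = "\<integral>\<^sup>+ x. e2ennreal (mixture_llr g f L m i x) \<partial>PM i"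
  let ?b = "\<integral>\<^sup>+ x. e2ennreal (- mixture_llr g f L m i x) \<partial>PM i"
  have a: "(\<integral>\<^sup>+ x. ennreal (Z i x) \<partial>PM i) = ?a"
    by (rule nn_integral_cong_AE, rule eventually_mono[OF AE_PM_pos[OF i]]) (auto simp: llr_pos e2ennreal_ereal)
  have b: "(\<integral>\<^sup>+ x. ennreal (- Z i x) \<partial>PM i) = ?b"
    by (rule nn_integral_cong_AE, rule eventually_mono[OF AE_PM_pos[OF i]]) (auto simp: llr_pos e2ennreal_ereal)
  have af: "?a < \<top>" using nn_integral_llr_finite[OF i] by (simp add: less_top)
  have bf: "?b < \<top>" using nn_integral_neg_llr_le[of i] by (rule le_less_trans) simp
  show int: "integrable (PM i) (Z i)"
    unfolding real_integrable_def a b using af bf by (auto simp: less_top)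
  have "(\<integral>x. Z i x \<partial>PM i) = enn2real ?a - enn2real ?b"
    unfolding real_lebesgue_integral_def[OF int] a b ..
  also have "\<dots> = I i"
    unfolding I_def KL_number_def Let_def PM_def[symmetric] using af bf
    by (cases ?a; cases ?b) auto
  finally show "(\<integral>x. Z i x \<partial>PM i) = I i" .
qed

lemma I_pos: "i \<in> {1..N} \<Longrightarrow> 0 < I i" and KL_eq: "i \<in> {1..N} \<Longrightarrow> KL_number g f L m i = ereal (I i)"
proof -
  assume "i \<in> {1..N}"
  then have "0 < KL_number g f L m i" "KL_number g f L m i < \<infinity>" using KL by (auto simp: N_def)
  then show "0 < I i" "KL_number g f L m i = ereal (I i)"
    unfolding I_def by (cases "KL_number g f L m i"; simp)+
qed

lemma density_ratio:
  assumes p [measurable]: "p \<in> borel_measurable (obs_space L)" and p0: "\<And>x. 0 \<le> p x"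
    and ac: "AE x in obs_law L p. 0 < null x"
  shows "obs_law L p = density P0 (\<lambda>x. ennreal (p x / null x))"
proof -
  have "density P0 (\<lambda>x. ennreal (p x / null x)) = density (obs_space L) (\<lambda>x. ennreal (null x) * ennreal (p x / null x))"
    unfolding P0_def obs_law_def by (rule density_density_eq) auto
  also have "\<dots> = density (obs_space L) (\<lambda>x. ennreal (p x))"
  proof (rule density_cong)
    have "AE x in obs_space L. 0 < ennreal (p x) \<longrightarrow> 0 < null x"
      using ac unfolding obs_law_def by (subst (asm) AE_density) auto
    then show "AE x in obs_space L. ennreal (null x) * ennreal (p x / null x) = ennreal (p x)"
    proof eventually_elim
      case (elim x)
      then show ?case
        using p0[of x] null_nonneg[of x] by (cases "p x = 0") (auto simp: ennreal_mult[symmetric])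
    qed
  qed auto
  finally show ?thesis by (simp add: obs_law_def)
qed

lemma PM_density:
  assumes "i \<in> {1..N}"
  shows "PM i = density P0 (\<lambda>x. ennreal (mix i x / null x))"
  unfolding PM_def
proof (rule density_ratio[OF mix_meas mix_nonneg])
  show "AE x in obs_law L (mix i). 0 < null x"
    using AE_PM_pos[OF assms] unfolding PM_def[symmetric] by (rule eventually_mono) simp
qed

lemma PA_density:
  assumes "i \<in> {1..N}" "A \<in> subsets i"
  shows "PA A = density P0 (\<lambda>x. ennreal (anom A x / null x))"
  unfolding PA_def
proof (rule density_ratio[OF anom_meas anom_nonneg])
  show "A \<subseteq> {1..L}" using assms by (simp add: subsets_def)
  show "AE x in obs_law L (anom A). 0 < null x"
    using AE_PA_of_AE_PM[OF AE_PM_pos[OF assms(1)] assms(2)] unfolding PA_def[symmetric]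
    by (rule eventually_mono) simp
qed

lemma ex_permutation:
  assumes "A \<subseteq> X" "B \<subseteq> X" "finite X" "card A = card B"
  obtains \<sigma> where "bij_betw \<sigma> X X" "\<And>l. l \<in> X \<Longrightarrow> \<sigma> l \<in> A \<longleftrightarrow> l \<in> B"
proof -
  have fin: "finite A" "finite B" using assms finite_subset by auto
  obtain s1 where s1: "bij_betw s1 B A" using finite_same_card_bij[of B A] assms fin by auto
  have "card (X - B) = card (X - A)" using assms fin by (simp add: card_Diff_subset)
  then obtain s2 where s2: "bij_betw s2 (X - B) (X - A)" using finite_same_card_bij[of "X - B" "X - A"] assms by auto
  define \<sigma> where "\<sigma> l = (if l \<in> B then s1 l else s2 l)" for l
  have b1: "bij_betw \<sigma> B A" using s1 by (rule bij_betw_cong[THEN iffD1, rotated]) (simp add: \<sigma>_def)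
  have b2: "bij_betw \<sigma> (X - B) (X - A)" using s2 by (rule bij_betw_cong[THEN iffD1, rotated]) (simp add: \<sigma>_def)
  have "bij_betw \<sigma> (B \<union> (X - B)) (A \<union> (X - A))"
    by (rule bij_betw_combine[OF b1 b2]) auto
  moreover have "B \<union> (X - B) = X" "A \<union> (X - A) = X" using assms by auto
  ultimately have "bij_betw \<sigma> X X" by simp
  moreover have "\<sigma> l \<in> A \<longleftrightarrow> l \<in> B" if "l \<in> X" for l
    using b1 b2 that by (cases "l \<in> B") (auto dest: bij_betwE)
  ultimately show thesis by (rule that)
qed

lemma Z_permute:
  assumes \<sigma>: "bij_betw \<sigma> {1..L} {1..L}"
  shows "Z i (\<lambda>l\<in>{1..L}. x (\<sigma> l)) = Z i x"
proof -
  let ?y = "\<lambda>l\<in>{1..L}. x (\<sigma> l)"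
  have inj: "inj_on \<sigma> {1..L}" and img: "\<sigma> ` {1..L} = {1..L}"
    using \<sigma> by (auto simp: bij_betw_def)
  have pr: "(\<Prod>l\<in>B. h (?y l)) = (\<Prod>l\<in>\<sigma> ` B. h (x l))" if "B \<subseteq> {1..L}" for B and h :: "real \<Rightarrow> real"
    using that inj by (subst prod.reindex) (auto intro!: prod.cong inj_on_subset[OF inj])
  have null: "null ?y = null x"
    unfolding null_density_def using pr[of "{1..L}" g] unfolding img by simp
  have anom: "anom A ?y = anom (\<sigma> ` A) x" if "A \<subseteq> {1..L}" for A
  proof -
    have "\<sigma> ` ({1..L} - A) = {1..L} - \<sigma> ` A"
      using that img inj_on_image_set_diff[OF inj, of "{1..L}" A] by auto
    then show ?thesis
      unfolding anomaly_density_def using that pr[of A f] pr[of "{1..L} - A" g] by auto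
  qed
  have "bij_betw ((`) \<sigma>) (subsets i) (subsets i)"
  proof (rule bij_betw_imageI)
    show inj2: "inj_on ((`) \<sigma>) (subsets i)"
      using inj by (intro inj_onI) (auto simp: subsets_def inj_on_image_eq_iff)
    have "(`) \<sigma> ` subsets i \<subseteq> subsets i"
      using img inj by (auto simp: subsets_def card_image inj_on_subset)
    then show "(`) \<sigma> ` subsets i = subsets i"
      using inj2 finite_subsets by (intro card_subset_eq) (auto simp: card_image)
  qed
  then have "(\<Sum>A\<in>subsets i. anom (\<sigma> ` A) x) = (\<Sum>A\<in>subsets i. anom A x)"
    by (rule sum.reindex_bij_betw)
  moreover have "(\<Sum>A\<in>subsets i. anom A ?y) = (\<Sum>A\<in>subsets i. anom (\<sigma> ` A) x)"
    by (intro sum.cong refl anom) (auto simp: subsets_def)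
  ultimately have "mix i ?y = mix i x"
    by (simp add: mix_eq)
  then show ?thesis
    unfolding Z_def mixture_llr_def null by simp
qed

text \<open>A permutation of the sensors that matches \<open>A\<close> and \<open>B\<close>
  transports one law into the other, and it leaves \<open>Z i\<close> unchanged because the mixture
  and the null density are symmetric.\<close>

lemma distr_PA_Z_eq:
  assumes A: "A \<in> subsets i" and B: "B \<in> subsets i"
  shows "distr (PA A) borel (Z i) = distr (PA B) borel (Z i)"
proof -
  have AL: "A \<subseteq> {1..L}" "B \<subseteq> {1..L}" "card A = card B" using A B by (auto simp: subsets_def)
  obtain \<sigma> where \<sigma>: "bij_betw \<sigma> {1..L} {1..L}" "\<And>l. l \<in> {1..L} \<Longrightarrow> \<sigma> l \<in> A \<longleftrightarrow> l \<in> B"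
    using ex_permutation[OF AL(1,2) _ AL(3)] by auto
  let ?M = "\<lambda>A l. density lborel (\<lambda>y. ennreal ((if l \<in> A then f else g) y))"
  let ?t = "\<lambda>x. \<lambda>l\<in>{1..L}. x (\<sigma> l)"
  have "distr (Pi\<^sub>M {1..L} (?M A)) (\<Pi>\<^sub>M l\<in>{1..L}. ?M A (\<sigma> l)) ?t = (\<Pi>\<^sub>M l\<in>{1..L}. ?M A (\<sigma> l))"
    using \<sigma>(1) g f by (intro distr_PiM_reindex prob_space_density_pdf) (auto simp: bij_betw_def)
  moreover have "(\<Pi>\<^sub>M l\<in>{1..L}. ?M A (\<sigma> l)) = Pi\<^sub>M {1..L} (?M B)"
    using \<sigma>(2) by (intro PiM_cong) auto
  ultimately have eq: "distr (PA A) (PA B) ?t = PA B"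
    unfolding PA_def obs_law_anomaly[OF g f AL(1)] obs_law_anomaly[OF g f AL(2)] by simp
  have t [measurable]: "?t \<in> measurable (PA A) (PA B)"
  proof -
    have "?t \<in> measurable (obs_space L) (obs_space L)"
      unfolding obs_space_def using \<sigma>(1)
      by (intro measurable_restrict measurable_component_singleton) (auto simp: bij_betw_def)
    then show ?thesis by (simp cong: measurable_cong_sets)
  qed
  have "distr (PA B) borel (Z i) = distr (distr (PA A) (PA B) ?t) borel (Z i)"
    by (simp only: eq)
  also have "\<dots> = distr (PA A) borel (Z i \<circ> ?t)"
    by (intro distr_distr t) measurable
  also have "Z i \<circ> ?t = Z i"
    using Z_permute[OF \<sigma>(1)] by (simp add: fun_eq_iff)
  finally show ?thesis ..
qed

text \<open>All components give the same law of \<open>Z i\<close>, so their average, the mixture,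
  gives it as well.\<close>

lemma distr_PA_Z:
  assumes i: "i \<in> {1..N}" and A: "A \<in> subsets i"
  shows "distr (PA A) borel (Z i) = law i"
proof (rule measure_eqI)
  show "sets (distr (PA A) borel (Z i)) = sets (law i)" by (simp add: law_def)
  fix X assume "X \<in> sets (distr (PA A) borel (Z i))"
  then have X [measurable]: "X \<in> sets borel" by simp
  have vm: "Z i -` X \<inter> space (obs_space L) \<in> sets (obs_space L)"
    by (rule measurable_sets[OF Z_meas X])
  have PAeq: "emeasure (PA B) (Z i -` X \<inter> space (obs_space L)) = emeasure (distr (PA A) borel (Z i)) X" if "B \<in> subsets i" for B
    unfolding distr_PA_Z_eq[OF A that] by (subst emeasure_distr) auto
  have "emeasure (law i) X = emeasure (PM i) (Z i -` X \<inter> space (obs_space L))"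
    unfolding law_def by (subst emeasure_distr) auto
  also have "\<dots> = ennreal (1 / real (card (subsets i))) * (ennreal (real (card (subsets i))) * emeasure (distr (PA A) borel (Z i)) X)"
    unfolding emeasure_PM[OF vm] by (simp add: PAeq ennreal_of_nat_eq_real_of_nat)
  also have "\<dots> = ennreal (1 / real (card (subsets i)) * real (card (subsets i))) * emeasure (distr (PA A) borel (Z i)) X"
    by (subst ennreal_mult) (auto simp: mult.assoc)
  also have "\<dots> = emeasure (distr (PA A) borel (Z i)) X"
    using card_subsets_pos[OF i] by simp
  finally show "emeasure (distr (PA A) borel (Z i)) X = emeasure (law i) X" ..
qed

lemma law_props:
  assumes "i \<in> {1..N}"
  shows "sets (law i) = sets borel" "integrable (law i) (\<lambda>x. x)" "(\<integral>x. x \<partial>law i) = I i"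
  using Z_integrable[OF assms] Z_mean[OF assms]
  by (simp_all add: law_def integrable_distr_eq integral_distr)

end

section \<open>Events of blocks of times and the worst-case delay\<close>

lemma space_obs_filtration: "space (obs_filtration L t) = space (seq_space L)"
  unfolding obs_filtration_def by (rule space_measure_of) auto

text \<open>Events determined by the observations at the times in \<open>K\<close>, written as
  preimages under restriction to \<open>K\<close>: in this form, independence of disjoint blocks is
  independence of the restrictions.\<close>

definition block_event :: "nat \<Rightarrow> nat set \<Rightarrow> (nat \<Rightarrow> nat \<Rightarrow> real) set \<Rightarrow> bool" where
  "block_event L K A \<longleftrightarrow> (\<exists>A'\<in>sets (Pi\<^sub>M K (\<lambda>_. obs_space L)). A = {w \<in> space (seq_space L). restrict w K \<in> A'})"

text \<open>The preimages under restriction to \<open>{1..k}\<close> form a sigma-algebra that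
  contains the generators of the filtration.\<close>

lemma obs_filtration_block_event:
  assumes "A \<in> sets (obs_filtration L (enat k))"
  shows "block_event L {1..k} A"
proof -
  let ?r = "\<lambda>w. restrict w {1..k}"
  let ?V = "vimage_algebra (space (seq_space L)) ?r (Pi\<^sub>M {1..k} (\<lambda>_. obs_space L))"
  have rm: "?r \<in> space (seq_space L) \<rightarrow> space (Pi\<^sub>M {1..k} (\<lambda>_. obs_space L))"
    unfolding seq_space_def by (auto simp: space_PiM)
  have "(\<Union>j\<in>{j. 1 \<le> j \<and> enat j \<le> enat k}. {(\<lambda>w. w j) -` B \<inter> space (seq_space L) |B. B \<in> sets (obs_space L)}) \<subseteq> sets ?V"
  proof safe
    fix j B assume j: "1 \<le> j" "enat j \<le> enat k" and B: "B \<in> sets (obs_space L)"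
    then have jk: "j \<in> {1..k}" by simp
    have "(\<lambda>w. w j) -` B \<inter> space (seq_space L)
       = ?r -` ((\<lambda>x. x j) -` B \<inter> space (Pi\<^sub>M {1..k} (\<lambda>_. obs_space L))) \<inter> space (seq_space L)"
      using jk rm by auto
    moreover have "(\<lambda>x. x j) -` B \<inter> space (Pi\<^sub>M {1..k} (\<lambda>_. obs_space L)) \<in> sets (Pi\<^sub>M {1..k} (\<lambda>_. obs_space L))"
      using jk B by (intro measurable_sets[OF measurable_component_singleton]) auto
    ultimately show "(\<lambda>w. w j) -` B \<inter> space (seq_space L) \<in> sets ?V"
      by (simp only: in_vimage_algebra)
  qed
  then have "sigma_sets (space ?V) (\<Union>j\<in>{j. 1 \<le> j \<and> enat j \<le> enat k}. {(\<lambda>w. w j) -` B \<inter> space (seq_space L) |B. B \<in> sets (obs_space L)}) \<subseteq> sets ?V"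
    by (rule sets.sigma_sets_subset)
  then have "sets (obs_filtration L (enat k)) \<subseteq> sets ?V"
    unfolding obs_filtration_def by (subst sets_measure_of) auto
  then have "A \<in> sets ?V" using assms by auto
  then obtain A' where "A' \<in> sets (Pi\<^sub>M {1..k} (\<lambda>_. obs_space L))" "A = ?r -` A' \<inter> space (seq_space L)"
    unfolding sets_vimage_algebra2[OF rm] by auto
  then show ?thesis
    unfolding block_event_def by (intro bexI[of _ A']) auto
qed

lemma block_event_sets: "K \<subseteq> {1..} \<Longrightarrow> block_event L K A \<Longrightarrow> A \<in> sets (seq_space L)"
  unfolding block_event_def
proof safe
  fix A' assume K: "K \<subseteq> {1..}" and A': "A' \<in> sets (Pi\<^sub>M K (\<lambda>_. obs_space L))"
  have "(\<lambda>w. restrict w K) \<in> measurable (seq_space L) (Pi\<^sub>M K (\<lambda>_. obs_space L))"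
    unfolding seq_space_def using K by (rule measurable_restrict_subset)
  then have "(\<lambda>w. restrict w K) -` A' \<inter> space (seq_space L) \<in> sets (seq_space L)"
    using A' by (rule measurable_sets)
  moreover have "(\<lambda>w. restrict w K) -` A' \<inter> space (seq_space L) = {w \<in> space (seq_space L). restrict w K \<in> A'}"
    by auto
  ultimately show "{w \<in> space (seq_space L). restrict w K \<in> A'} \<in> sets (seq_space L)" by simp
qed

lemma obs_filtration_sets: "A \<in> sets (obs_filtration L (enat k)) \<Longrightarrow> A \<in> sets (seq_space L)"
  by (intro block_event_sets[OF _ obs_filtration_block_event]) auto

lemma borel_measurable_enat:
  fixes h :: "enat \<Rightarrow> 'b::topological_space"
  shows "h \<in> borel_measurable borel"
proof (rule measurableI)
  fix A :: "'b set"
  have "h -` A \<in> sets borel" by (rule sets.countable) auto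
  then show "h -` A \<inter> space borel \<in> sets borel" by simp
qed simp

lemma changepoint_1: "changepoint \<nu> d 1 = \<nu>"
  by (simp add: changepoint_def)

lemma phase_at_range:
  assumes "\<nu> \<le> k"
  shows "phase_at m n \<nu> d k \<in> {1..n - m + 1}"
  using phase_at_eq_iff[OF assms, of m n d "phase_at m n \<nu> d k"] by auto

lemma phase_at_mono:
  assumes "\<nu> \<le> k" "k \<le> k'"
  shows "phase_at m n \<nu> d k \<le> phase_at m n \<nu> d k'"
  unfolding phase_at_def
proof (rule Max_mono)
  show "{i \<in> {1..n - m + 1}. changepoint \<nu> d i \<le> k} \<noteq> {}"
    using assms changepoint_1[of \<nu> d] by (auto intro!: exI[of _ 1])
qed (use assms in auto)

locale indep_coordinates =
  fixes Qk :: "nat \<Rightarrow> (nat \<Rightarrow> real) measure" and L :: nat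
  assumes prob_Q: "\<And>k. 1 \<le> k \<Longrightarrow> prob_space (Qk k)" and sets_Q: "\<And>k. 1 \<le> k \<Longrightarrow> sets (Qk k) = sets (obs_space L)"
begin

definition "P = Pi\<^sub>M {1::nat..} Qk"

lemma prob_P: "prob_space P"
  unfolding P_def by (intro prob_space_PiM prob_Q) auto

lemma sets_P [measurable_cong]: "sets P = sets (seq_space L)"
  unfolding P_def seq_space_def using sets_Q by (intro sets_PiM_cong) auto

lemma space_P: "space P = space (seq_space L)"
  by (rule sets_eq_imp_space_eq[OF sets_P])

lemma coordinate_meas: "1 \<le> k \<Longrightarrow> (\<lambda>w. w k) \<in> measurable P (obs_space L)"
proof -
  assume k: "1 \<le> k"
  have "(\<lambda>w. w k) \<in> measurable P (Qk k)"
    unfolding P_def using k by (intro measurable_component_singleton) auto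
  then show ?thesis by (simp cong: measurable_cong_sets add: sets_Q[OF k])
qed

lemma distr_coordinate: "1 \<le> k \<Longrightarrow> distr P (obs_space L) (\<lambda>w. w k) = Qk k"
proof -
  assume k: "1 \<le> k"
  have "distr P (obs_space L) (\<lambda>w. w k) = distr P (Qk k) (\<lambda>w. w k)"
    using sets_Q[OF k] by (intro distr_cong) auto
  also have "\<dots> = Qk k"
    unfolding P_def using k prob_Q by (intro distr_PiM_component) auto
  finally show ?thesis .
qed

lemma indep_coordinates: "prob_space.indep_vars P (\<lambda>_. obs_space L) (\<lambda>k w. w k) {1..}"
proof -
  interpret prob_space P by (rule prob_P)
  have "distr P (\<Pi>\<^sub>M i\<in>{1..}. obs_space L) (\<lambda>x. \<lambda>i\<in>{1..}. x i) = (\<Pi>\<^sub>M i\<in>{1..}. distr P (obs_space L) (\<lambda>w. w i))"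
  proof -
    have "distr P (\<Pi>\<^sub>M i\<in>{1..}. obs_space L) (\<lambda>x. \<lambda>i\<in>{1..}. x i) = distr P P (\<lambda>x. x)"
    proof (rule distr_cong)
      show "sets (\<Pi>\<^sub>M i\<in>{1..}. obs_space L) = sets P" by (simp add: sets_P seq_space_def)
      fix x assume "x \<in> space P"
      then show "(\<lambda>i\<in>{1..}. x i) = x"
        unfolding P_def space_PiM by (intro extensional_restrict) (auto simp: PiE_def)
    qed simp
    also have "\<dots> = P" by (rule distr_id)
    also have "\<dots> = (\<Pi>\<^sub>M i\<in>{1..}. distr P (obs_space L) (\<lambda>w. w i))"
      unfolding P_def using distr_coordinate by (intro PiM_cong) (auto simp: P_def)
    finally show ?thesis .
  qed
  then show ?thesis
    using coordinate_meas by (subst indep_vars_iff_distr_eq_PiM') auto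
qed

lemma block_prob:
  assumes K: "\<And>j. j \<in> J \<Longrightarrow> K j \<subseteq> {1..}" and dis: "disjoint_family_on K J"
    and A: "\<And>j. j \<in> J \<Longrightarrow> block_event L (K j) (A j)" and J: "finite J" "J \<noteq> {}"
  shows "measure P (\<Inter>j\<in>J. A j) = (\<Prod>j\<in>J. measure P (A j))"
proof -
  interpret prob_space P by (rule prob_P)
  have "\<forall>j\<in>J. \<exists>A'. A' \<in> sets (Pi\<^sub>M (K j) (\<lambda>_. obs_space L)) \<and> A j = {w \<in> space (seq_space L). restrict w (K j) \<in> A'}"
    using A unfolding block_event_def by auto
  from bchoice[OF this] obtain A' where A': "\<And>j. j \<in> J \<Longrightarrow> A' j \<in> sets (Pi\<^sub>M (K j) (\<lambda>_. obs_space L))"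
    "\<And>j. j \<in> J \<Longrightarrow> A j = {w \<in> space (seq_space L). restrict w (K j) \<in> A' j}"
    by blast
  have iv: "indep_vars (\<lambda>j. Pi\<^sub>M (K j) (\<lambda>_. obs_space L)) (\<lambda>j w. restrict (\<lambda>i. w i) (K j)) J"
    using indep_coordinates K dis by (intro indep_vars_restrict) auto
  have eq: "A j = (\<lambda>w. restrict (\<lambda>i. w i) (K j)) -` A' j \<inter> space P" if "j \<in> J" for j
    using A'(2)[OF that] by (auto simp: space_P)
  have "(\<Inter>j\<in>J. A j) = (\<Inter>j\<in>J. (\<lambda>w. restrict (\<lambda>i. w i) (K j)) -` A' j \<inter> space P)"
    using eq by auto
  then have "measure P (\<Inter>j\<in>J. A j) = (\<Prod>j\<in>J. prob ((\<lambda>w. restrict (\<lambda>i. w i) (K j)) -` A' j \<inter> space P))"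
    using indep_varsD[OF iv J(2,1) subset_refl, of A'] A'(1) by simp
  also have "\<dots> = (\<Prod>j\<in>J. measure P (A j))"
    using eq by (intro prod.cong) auto
  finally show ?thesis .
qed

end

section \<open>The essential supremum of the conditional delay, bounded by ordinary
  integrals\<close>

text \<open>If the conditional expectation exceeded \<open>c\<close> with positive probability, the
  event where it does, intersected with \<open>\<tau> \<ge> \<nu>\<close>, would be a history event
  violating \<open>bound\<close>; the intersection is one because \<open>\<tau> \<ge> \<nu>\<close>
  is itself known at time \<open>\<nu> - 1\<close>. The assumption \<open>1 \<le> c\<close> covers
  the default value 1 of the delay.\<close>

lemma worst_history_delay_le:
  fixes P :: "(nat \<Rightarrow> nat \<Rightarrow> real) measure"
  assumes P: "prob_space P" and sets_P: "sets P = sets (seq_space L)"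
    and \<tau> [measurable]: "\<tau> \<in> borel_measurable P"
    and E: "{w \<in> space P. enat \<nu> \<le> \<tau> w} \<in> sets (obs_filtration L (enat (\<nu> - 1)))"
    and c: "1 \<le> c"
    and bound: "\<And>B. B \<in> sets (obs_filtration L (enat (\<nu> - 1))) \<Longrightarrow> B \<subseteq> {w \<in> space P. enat \<nu> \<le> \<tau> w} \<Longrightarrow>
      (\<integral>\<^sup>+ w. ennreal_of_enat (\<tau> w + 1 - enat \<nu>) * indicator B w \<partial>P) \<le> ennreal c * emeasure P B"
  shows "worst_history_delay P L \<tau> \<nu> \<le> ennreal c"
proof -
  interpret prob_space P by fact
  let ?E = "{w \<in> space P. enat \<nu> \<le> \<tau> w}" and ?F = "obs_filtration L (enat (\<nu> - 1))"
  have sp: "space P = space (seq_space L)" using sets_P by (rule sets_eq_imp_space_eq)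
  show ?thesis
  proof (cases "emeasure P ?E = 0")
    case True
    then show ?thesis using c by (simp add: worst_history_delay_def ennreal_le_iff2 ennreal_1[symmetric] del: ennreal_1)
  next
    case False
    let ?U = "uniform_measure P ?E"
    have E': "?E \<in> sets P" using obs_filtration_sets[OF E] sets_P by simp
    have fin: "emeasure P ?E \<noteq> \<infinity>" by simp
    interpret U: prob_space ?U
      using False fin by (rule prob_space_uniform_measure)
    have sub: "subalgebra ?U ?F"
      unfolding subalgebra_def using obs_filtration_sets sets_P by (auto simp: space_obs_filtration sp)
    interpret fs: finite_measure_subalgebra ?U ?F
      by unfold_locales (rule sub)
    define D where "D w = ennreal_of_enat (\<tau> w + 1 - enat \<nu>)" for w
    have Dm: "D \<in> borel_measurable ?U"
    proof -
      have "(\<lambda>t::enat. ennreal_of_enat (t + 1 - enat \<nu>)) \<in> borel_measurable borel"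
        by (rule borel_measurable_enat)
      then have "(\<lambda>w. ennreal_of_enat (\<tau> w + 1 - enat \<nu>)) \<in> borel_measurable P"
        using \<tau> by (rule measurable_compose[rotated])
      then show ?thesis unfolding D_def[abs_def] by simp
    qed
    have boundD: "(\<integral>\<^sup>+ w. D w * indicator B w \<partial>P) \<le> ennreal c * emeasure P B"
      if "B \<in> sets ?F" "B \<subseteq> ?E" for B
      using bound[OF that] by (simp only: D_def)
    let ?h = "nn_cond_exp ?U ?F D"
    let ?A = "{w \<in> space P. ennreal c < ?h w}"
    have hm: "?h \<in> borel_measurable ?F" by simp
    have AF: "?A \<in> sets ?F"
    proof -
      have "{w \<in> space ?F. ennreal c < ?h w} \<in> sets ?F" using hm by measurable
      then show ?thesis by (simp add: space_obs_filtration sp)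
    qed
    have AU: "?A \<in> sets ?U" using AF sub by (auto simp: subalgebra_def)
    have "(\<integral>\<^sup>+ w. ?h w * indicator ?A w \<partial>?U) = (\<integral>\<^sup>+ w. indicator ?A w * ?h w \<partial>?U)"
      by (simp add: mult.commute)
    also have "\<dots> = (\<integral>\<^sup>+ w. indicator ?A w * D w \<partial>?U)"
      using AF Dm by (intro fs.nn_cond_exp_intg) auto
    also have "\<dots> = (\<integral>\<^sup>+ w. (indicator ?A w * D w) * indicator ?E w \<partial>P) / emeasure P ?E"
      using Dm AU E' by (intro nn_integral_uniform_measure) auto
    also have "(\<integral>\<^sup>+ w. (indicator ?A w * D w) * indicator ?E w \<partial>P) = (\<integral>\<^sup>+ w. D w * indicator (?A \<inter> ?E) w \<partial>P)"
      by (intro nn_integral_cong) (auto simp: indicator_def)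
    also have "\<dots> / emeasure P ?E \<le> (ennreal c * emeasure P (?A \<inter> ?E)) / emeasure P ?E"
      using AF E by (intro divide_right_mono_ennreal boundD) auto
    also have "\<dots> = ennreal c * emeasure ?U ?A"
      using AU E' by (simp add: emeasure_uniform_measure Int_commute ennreal_times_divide)
    finally have le: "(\<integral>\<^sup>+ w. ?h w * indicator ?A w \<partial>?U) \<le> ennreal c * emeasure ?U ?A" .
    have "emeasure ?U ?A = 0"
    proof (rule ccontr)
      assume pos: "emeasure ?U ?A \<noteq> 0"
      have "(\<integral>\<^sup>+ w. ennreal c * indicator ?A w \<partial>?U) < (\<integral>\<^sup>+ w. ?h w * indicator ?A w \<partial>?U)"
      proof (rule nn_integral_less)
        show "(\<integral>\<^sup>+ w. ennreal c * indicator ?A w \<partial>?U) \<noteq> \<infinity>"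
          using U.emeasure_finite[of ?A]
          by (subst nn_integral_cmult_indicator[OF AU]) (simp only: ennreal_mult_eq_top_iff infinity_ennreal_def ennreal_neq_top, simp)
        show "AE w in ?U. ennreal c * indicator ?A w \<le> ?h w * indicator ?A w"
          by (rule AE_I2) (auto simp: indicator_def)
        show "\<not> (AE w in ?U. ?h w * indicator ?A w \<le> ennreal c * indicator ?A w)"
        proof
          assume "AE w in ?U. ?h w * indicator ?A w \<le> ennreal c * indicator ?A w"
          then have "AE w in ?U. w \<notin> ?A"
            by (rule eventually_mono) (auto simp: indicator_def not_le)
          then have "emeasure ?U ?A = 0"
            using AU by (subst (asm) AE_iff_measurable[of "?A" _ ]) (auto simp: space_uniform_measure sp)
          then show False using pos by simp
        qed
        show "(\<lambda>w. ennreal c * indicator ?A w) \<in> borel_measurable ?U" using AU by (intro borel_measurable_times_ennreal) auto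
        show "(\<lambda>w. ?h w * indicator ?A w) \<in> borel_measurable ?U" using AU by (intro borel_measurable_times_ennreal) auto
      qed
      then show False
        using le AU by (simp add: nn_integral_cmult_indicator)
    qed
    then have "AE w in ?U. \<not> ennreal c < ?h w"
      using AU by (intro AE_I[of _ _ ?A]) auto
    then have "AE w in ?U. ?h w \<le> ennreal c" by (simp add: not_less)
    then have "esssup ?U ?h \<le> ennreal c"
      by (intro esssup_I) auto
    then show ?thesis
      using False by (simp add: worst_history_delay_def D_def[abs_def] Let_def)
  qed
qed

text \<open>An essential supremum dominates the mean, and the mean of the conditional expectation is
  the mean delay given \<open>\<tau> \<ge> \<nu>\<close>. Markov's inequality bounds it below:
  stopping at \<open>\<nu> + t\<close> or later means a delay of at least
  \<open>t + 1\<close>.\<close>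

lemma worst_history_delay_ge:
  fixes P :: "(nat \<Rightarrow> nat \<Rightarrow> real) measure"
  assumes P: "prob_space P" and sets_P: "sets P = sets (seq_space L)"
    and \<tau> [measurable]: "\<tau> \<in> borel_measurable P"
    and E: "{w \<in> space P. enat \<nu> \<le> \<tau> w} \<in> sets P"
    and pos: "0 < measure P {w \<in> space P. enat \<nu> \<le> \<tau> w}" and q: "0 \<le> q"
    and late: "q * measure P {w \<in> space P. enat \<nu> \<le> \<tau> w} \<le> measure P {w \<in> space P. enat (\<nu> + t) \<le> \<tau> w}"
  shows "ennreal (q * real (t + 1)) \<le> worst_history_delay P L \<tau> \<nu>"
proof -
  interpret prob_space P by fact
  let ?E = "{w \<in> space P. enat \<nu> \<le> \<tau> w}" and ?F = "obs_filtration L (enat (\<nu> - 1))"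
  have sp: "space P = space (seq_space L)" using sets_P by (rule sets_eq_imp_space_eq)
  have nz: "emeasure P ?E \<noteq> 0" using pos by (simp add: emeasure_eq_measure)
  have fin: "emeasure P ?E \<noteq> \<infinity>" by simp
  let ?U = "uniform_measure P ?E"
  interpret U: prob_space ?U
    using nz fin by (rule prob_space_uniform_measure)
  have sub: "subalgebra ?U ?F"
    unfolding subalgebra_def using obs_filtration_sets sets_P by (auto simp: space_obs_filtration sp)
  interpret fs: finite_measure_subalgebra ?U ?F
    by unfold_locales (rule sub)
  define D where "D w = ennreal_of_enat (\<tau> w + 1 - enat \<nu>)" for w
  have DmP: "D \<in> borel_measurable P"
  proof -
    have "(\<lambda>t::enat. ennreal_of_enat (t + 1 - enat \<nu>)) \<in> borel_measurable borel"
      by (rule borel_measurable_enat)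
    then show ?thesis
      unfolding D_def[abs_def] using \<tau> by (rule measurable_compose[rotated])
  qed
  have Dm: "D \<in> borel_measurable ?U" using DmP by simp
  let ?h = "nn_cond_exp ?U ?F D"
  let ?T = "{w \<in> space P. enat (\<nu> + t) \<le> \<tau> w}"
  have Tm [measurable]: "?T \<in> sets P" by measurable
  have TE: "?T \<subseteq> ?E" by (auto intro: order_trans[rotated])
  have "ennreal (q * real (t + 1)) \<le> ennreal (real (t + 1)) * (emeasure P ?T / emeasure P ?E)"
  proof -
    have "q \<le> measure P ?T / measure P ?E" using late pos by (simp add: field_simps)
    then have "q * real (t + 1) \<le> real (t + 1) * (measure P ?T / measure P ?E)"
      by (subst mult.commute) (intro mult_left_mono, auto)
    then have "ennreal (q * real (t + 1)) \<le> ennreal (real (t + 1) * (measure P ?T / measure P ?E))"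
      by (rule ennreal_leI)
    also have "\<dots> = ennreal (real (t + 1)) * (emeasure P ?T / emeasure P ?E)"
      using pos by (simp add: ennreal_mult divide_ennreal[symmetric] emeasure_eq_measure ennreal_times_divide)
    finally show ?thesis .
  qed
  also have "\<dots> = (\<integral>\<^sup>+ w. ennreal (real (t + 1)) * indicator ?T w \<partial>P) / emeasure P ?E"
    by (simp add: nn_integral_cmult_indicator ennreal_times_divide)
  also have "\<dots> \<le> (\<integral>\<^sup>+ w. D w * indicator ?E w \<partial>P) / emeasure P ?E"
  proof (intro divide_right_mono_ennreal nn_integral_mono)
    fix w assume w: "w \<in> space P"
    show "ennreal (real (t + 1)) * indicator ?T w \<le> D w * indicator ?E w"
    proof (cases "w \<in> ?T")
      case True
      then have "w \<in> ?E" using TE by auto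
      have "enat (t + 1) \<le> \<tau> w + 1 - enat \<nu>"
        using True by (cases "\<tau> w") (auto simp: one_enat_def)
      then have "ennreal_of_enat (enat (t + 1)) \<le> D w"
        unfolding D_def by (simp only: ennreal_of_enat_le_iff)
      then show ?thesis
        using True \<open>w \<in> ?E\<close> by (simp add: ennreal_of_nat_eq_real_of_nat del: of_nat_Suc)
    qed simp
  qed
  also have "\<dots> = (\<integral>\<^sup>+ w. D w \<partial>?U)"
    using DmP E by (intro nn_integral_uniform_measure[symmetric]) auto
  also have "\<dots> = (\<integral>\<^sup>+ w. 1 * D w \<partial>?U)" by simp
  also have "\<dots> = (\<integral>\<^sup>+ w. 1 * ?h w \<partial>?U)"
    using Dm by (intro fs.nn_cond_exp_intg[symmetric]) auto
  also have "\<dots> \<le> (\<integral>\<^sup>+ w. esssup ?U ?h \<partial>?U)"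
    using esssup_AE[of ?h ?U] by (intro nn_integral_mono_AE) auto
  also have "\<dots> = esssup ?U ?h"
    using U.emeasure_space_1 by simp
  finally show ?thesis
    using nz by (simp add: worst_history_delay_def D_def[abs_def] Let_def)
qed

context indep_coordinates
begin

lemma distr_shift:
  "distr P (Pi\<^sub>M {..<t} (\<lambda>_. obs_space L)) (\<lambda>w. \<lambda>u\<in>{..<t}. w (s + u + 1)) = Pi\<^sub>M {..<t} (\<lambda>u. Qk (s + u + 1))"
proof -
  have "distr P (Pi\<^sub>M {..<t} (\<lambda>_. obs_space L)) (\<lambda>w. \<lambda>u\<in>{..<t}. w (s + u + 1))
      = distr P (Pi\<^sub>M {..<t} (\<lambda>u. Qk (s + u + 1))) (\<lambda>w. \<lambda>u\<in>{..<t}. w (s + u + 1))"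
    using sets_Q by (intro distr_cong sets_PiM_cong) auto
  also have "\<dots> = Pi\<^sub>M {..<t} (\<lambda>u. Qk (s + u + 1))"
    unfolding P_def using prob_Q by (intro distr_PiM_reindex) (auto simp: inj_on_def)
  finally show ?thesis .
qed

lemma indep_shifted_coordinates:
  "prob_space.indep_vars P (\<lambda>_. obs_space L) (\<lambda>u w. w (s + u + 1)) {..<t}"
proof (cases "t = 0")
  case True
  interpret prob_space P by (rule prob_P)
  show ?thesis using True by (simp add: indep_vars_def indep_sets_def)
next
  case False
  interpret prob_space P by (rule prob_P)
  have "distr P (Pi\<^sub>M {..<t} (\<lambda>_. obs_space L)) (\<lambda>w. \<lambda>u\<in>{..<t}. w (s + u + 1))
      = (\<Pi>\<^sub>M u\<in>{..<t}. distr P (obs_space L) (\<lambda>w. w (s + u + 1)))"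
    unfolding distr_shift using distr_coordinate by (intro PiM_cong) auto
  then show ?thesis
    using coordinate_meas False by (subst indep_vars_iff_distr_eq_PiM') auto
qed

lemma AE_coordinate:
  assumes "1 \<le> k" "AE x in Qk k. T x"
  shows "AE w in P. T (w k)"
proof -
  have "AE x in distr P (obs_space L) (\<lambda>w. w k). T x"
    unfolding distr_coordinate[OF assms(1)] by (rule assms(2))
  then show ?thesis by (rule AE_distrD[OF coordinate_meas[OF assms(1)]])
qed

end

context anomaly_model
begin

text \<open>The weak law as a property of the block length \<open>t\<close> alone. The quantifiers
  range over all independent sequences, positions \<open>s\<close> and phase assignments
  \<open>p\<close>, because all of these change with \<gamma>. Both the anomaly laws and the mixture
  laws of the lower bound meet the condition on \<open>Z\<close>.\<close>

definition deviation_bound :: "real \<Rightarrow> real \<Rightarrow> nat \<Rightarrow> bool" where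
  "deviation_bound \<delta> \<epsilon> t \<longleftrightarrow> (\<forall>Qk s p. indep_coordinates Qk L \<longrightarrow>
    (\<forall>u<t. p u \<in> {1..N} \<and> distr (Qk (s + u + 1)) borel (Z (p u)) = law (p u)) \<longrightarrow>
    measure (Pi\<^sub>M {1..} Qk) {w \<in> space (seq_space L). \<delta> * real t < \<bar>\<Sum>u<t. Z (p u) (w (s + u + 1)) - I (p u)\<bar>} \<le> \<epsilon>)"

lemma deviation_boundD:
  "deviation_bound \<delta> \<epsilon> t \<Longrightarrow> indep_coordinates Qk L \<Longrightarrow>
    (\<And>u. u < t \<Longrightarrow> p u \<in> {1..N} \<and> distr (Qk (s + u + 1)) borel (Z (p u)) = law (p u)) \<Longrightarrow>
    measure (Pi\<^sub>M {1..} Qk) {w \<in> space (seq_space L). \<delta> * real t < \<bar>\<Sum>u<t. Z (p u) (w (s + u + 1)) - I (p u)\<bar>} \<le> \<epsilon>"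
  unfolding deviation_bound_def by blast

lemma ex_deviation_bound:
  fixes \<delta> \<epsilon> :: real
  assumes "0 < \<delta>" "0 < \<epsilon>"
  obtains n0 :: nat where "\<And>t. n0 \<le> t \<Longrightarrow> deviation_bound \<delta> \<epsilon> t"
proof -
  have "sets \<nu> = sets borel \<and> integrable \<nu> (\<lambda>x::real. x)" if "\<nu> \<in> law ` {1..N}" for \<nu>
    using that law_props by auto
  from uniform_weak_law[OF finite_imageI[OF finite_atLeastAtMost] this assms]
  obtain n0 where n0: "\<forall>n\<ge>n0. \<forall>(M :: (nat \<Rightarrow> nat \<Rightarrow> real) measure) X. prob_space M \<longrightarrow>
    prob_space.indep_vars M (\<lambda>_. borel) X {..<n} \<longrightarrow> (\<forall>u<n. distr M borel (X u) \<in> law ` {1..N}) \<longrightarrow>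
    measure M {x \<in> space M. \<delta> * real n < \<bar>\<Sum>u<n. X u x - (\<integral>y. y \<partial>distr M borel (X u))\<bar>} \<le> \<epsilon>"
    by blast
  have "deviation_bound \<delta> \<epsilon> t" if t: "n0 \<le> t" for t
    unfolding deviation_bound_def
  proof (intro allI impI)
    fix Qk s p
    assume "indep_coordinates Qk L"
      and p: "\<forall>u<t. p u \<in> {1..N} \<and> distr (Qk (s + u + 1)) borel (Z (p u)) = law (p u)"
    then interpret A: indep_coordinates Qk L by simp
    interpret prob_space A.P by (rule A.prob_P)
    let ?X = "\<lambda>u w. Z (p u) (w (s + u + 1))"
    have indep: "indep_vars (\<lambda>_. borel) ?X {..<t}"
      using A.indep_shifted_coordinates by (rule indep_vars_compose2) measurable
    have law: "distr A.P borel (?X u) = law (p u)" if "u < t" for u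
    proof -
      have "distr A.P borel (?X u) = distr (distr A.P (obs_space L) (\<lambda>w. w (s + u + 1))) borel (Z (p u))"
        using A.coordinate_meas by (subst distr_distr) (auto simp: comp_def)
      also have "\<dots> = law (p u)"
        using A.distr_coordinate p that by simp
      finally show ?thesis .
    qed
    have "(\<Sum>u<t. ?X u w - (\<integral>y. y \<partial>distr A.P borel (?X u))) = (\<Sum>u<t. ?X u w - I (p u))" for w
      using law p law_props(3) by (intro sum.cong) auto
    moreover have "distr A.P borel (?X u) \<in> law ` {1..N}" if "u < t" for u
      using law[OF that] p that by auto
    then have "prob {w \<in> space A.P. \<delta> * real t < \<bar>\<Sum>u<t. ?X u w - (\<integral>y. y \<partial>distr A.P borel (?X u))\<bar>} \<le> \<epsilon>"
      by (rule n0[rule_format, OF t prob_space_axioms indep])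
    ultimately show "measure (Pi\<^sub>M {1..} Qk) {w \<in> space (seq_space L). \<delta> * real t < \<bar>\<Sum>u<t. Z (p u) (w (s + u + 1)) - I (p u)\<bar>} \<le> \<epsilon>"
      by (simp only: A.P_def[symmetric] A.space_P)
  qed
  then show thesis by (rule that)
qed

definition "coordinate_law \<nu> d S k =
  obs_law L (if k < \<nu> then null else anom (S (phase_at m n \<nu> d k) k))"

lemma anomaly_prob_eq: "anomaly_prob g f L m n \<nu> d S = Pi\<^sub>M {1..} (coordinate_law \<nu> d S)"
  unfolding anomaly_prob_def coordinate_law_def ..

lemma coordinate_law_before: "k < \<nu> \<Longrightarrow> coordinate_law \<nu> d S k = P0"
  by (simp add: coordinate_law_def P0_def)

lemma coordinate_law_after: "\<nu> \<le> k \<Longrightarrow> coordinate_law \<nu> d S k = PA (S (phase_at m n \<nu> d k) k)"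
  by (simp add: coordinate_law_def PA_def)

lemma trajectory_subsets:
  assumes "S \<in> trajectories L m n" "1 \<le> k" "\<nu> \<le> k"
  shows "S (phase_at m n \<nu> d k) k \<in> subsets (phase_at m n \<nu> d k)"
  using assms phase_at_range[OF assms(3), of m n d] by (auto simp: trajectories_def subsets_def)

lemma indep_coordinates_anomaly:
  assumes "S \<in> trajectories L m n"
  shows "indep_coordinates (coordinate_law \<nu> d S) L"
proof -
  have *: "prob_space (coordinate_law \<nu> d S k) \<and> sets (coordinate_law \<nu> d S k) = sets (obs_space L)" if k: "1 \<le> k" for k
  proof (cases "k < \<nu>")
    case True
    then show ?thesis using prob_P0 by (simp add: coordinate_law_before)
  next
    case False
    then have "S (phase_at m n \<nu> d k) k \<in> subsets (phase_at m n \<nu> d k)"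
      using k by (intro trajectory_subsets[OF assms]) auto
    then show ?thesis using False prob_PA by (simp add: coordinate_law_after subsets_def)
  qed
  then show ?thesis by (intro indep_coordinates.intro) auto
qed

lemma indep_coordinates_null: "indep_coordinates (\<lambda>_. P0) L"
  by (rule indep_coordinates.intro) (auto intro: prob_P0)

lemma distr_coordinate_law:
  assumes "S \<in> trajectories L m n" "1 \<le> k" "\<nu> \<le> k"
  shows "distr (coordinate_law \<nu> d S k) borel (Z (phase_at m n \<nu> d k)) = law (phase_at m n \<nu> d k)"
  using distr_PA_Z[OF _ trajectory_subsets[OF assms]] phase_at_range[OF assms(3)] coordinate_law_after[OF assms(3)]
  by (simp add: N_def)

text \<open>The phase \<open>u\<close> steps after the changepoint, with \<open>u = 0\<close> at the
  changepoint itself; by translation invariance the position of the changepoint is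
  immaterial.\<close>

definition "phase d u = phase_at m n 0 d u"

lemma phase_at_shift: "phase_at m n \<nu> d (\<nu> + u) = phase d u"
  unfolding phase_def phase_at_def changepoint_def by simp

lemma phase_range: "phase d u \<in> {1..N}"
  unfolding phase_def N_def by (rule phase_at_range) simp

lemma phase_mono: "u \<le> v \<Longrightarrow> phase d u \<le> phase d v"
  unfolding phase_def by (rule phase_at_mono) auto

lemma AE_llr_finite:
  assumes S: "S \<in> trajectories L m n" and \<nu>: "1 \<le> \<nu>"
  shows "AE w in anomaly_prob g f L m n \<nu> d S. \<forall>u. mixture_llr g f L m (phase d u) (w (\<nu> + u)) = ereal (Z (phase d u) (w (\<nu> + u)))"
proof -
  interpret A: indep_coordinates "coordinate_law \<nu> d S" L by (rule indep_coordinates_anomaly[OF S])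
  have "AE w in A.P. mixture_llr g f L m (phase d u) (w (\<nu> + u)) = ereal (Z (phase d u) (w (\<nu> + u)))" for u
  proof (rule A.AE_coordinate)
    show "1 \<le> \<nu> + u" using \<nu> by simp
    have "AE x in PA (S (phase d u) (\<nu> + u)). 0 < mix (phase d u) x \<and> 0 < null x"
      using trajectory_subsets[OF S, of "\<nu> + u" \<nu> d] \<nu>
      by (intro AE_PA_of_AE_PM[OF AE_PM_pos[OF phase_range]]) (simp add: phase_at_shift)
    then show "AE x in coordinate_law \<nu> d S (\<nu> + u). mixture_llr g f L m (phase d u) x = ereal (Z (phase d u) x)"
      by (simp only: coordinate_law_after[OF le_add1] phase_at_shift) (rule eventually_mono, auto simp: llr_pos)
  qed
  then show ?thesis unfolding anomaly_prob_eq A.P_def[symmetric] AE_all_countable by blast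
qed

end

section \<open>Pathwise lower bounds for the test statistic\<close>

lemma WD_stat_0: "WD_stat g f L m n \<rho> w k 0 = 0"
  by (cases k) auto

lemma WD_stat_Suc_ge:
  assumes "1 \<le> i" "j \<le> i" "ereal a \<le> WD_stat g f L m n \<rho> w k j" "mixture_llr g f L m i (w (Suc k)) = ereal z"
  shows "ereal (a + (\<Sum>r\<in>{j..<i}. ln (ext_rho m n \<rho> r)) + z + ln (1 - ext_rho m n \<rho> i)) \<le> WD_stat g f L m n \<rho> w (Suc k) i"
proof -
  have "ereal (a + (\<Sum>r\<in>{j..<i}. ln (ext_rho m n \<rho> r)))
      \<le> WD_stat g f L m n \<rho> w k j + ereal (\<Sum>r\<in>{j..<i}. ln (ext_rho m n \<rho> r))"
    using add_right_mono[OF assms(3)] by (simp only: plus_ereal.simps(1)[symmetric])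
  also have "\<dots> \<le> Max ((\<lambda>j. WD_stat g f L m n \<rho> w k j
                      + ereal (\<Sum>r\<in>{j..<i}. ln (ext_rho m n \<rho> r))) ` {0..i})"
    using assms(2) by (intro Max_ge) auto
  finally have le: "ereal (a + (\<Sum>r\<in>{j..<i}. ln (ext_rho m n \<rho> r))) \<le> \<dots>" .
  show ?thesis
    using assms(1,4) add_right_mono[OF add_right_mono[OF le, of "ereal z"], of "ereal (ln (1 - ext_rho m n \<rho> i))"]
    by simp
qed

text \<open>The value of the recursion along the path that starts afresh at time \<open>s\<close> and then follows
  the phases \<open>p\<close>.\<close>

lemma WD_stat_path_ge:
  assumes p: "\<And>u. u \<le> t \<Longrightarrow> 1 \<le> p u" "\<And>u v. u \<le> v \<Longrightarrow> v \<le> t \<Longrightarrow> p u \<le> p v"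
    and llr: "\<And>u. u \<le> t \<Longrightarrow> mixture_llr g f L m (p u) (w (s + u + 1)) = ereal (z u)"
  shows "ereal ((\<Sum>u\<le>t. z u + ln (1 - ext_rho m n \<rho> (p u))) + (\<Sum>x<p t. ln (ext_rho m n \<rho> x)))
    \<le> WD_stat g f L m n \<rho> w (s + t + 1) (p t)"
  using assms
proof (induction t)
  case 0
  have "ereal (0 + (\<Sum>r\<in>{0..<p 0}. ln (ext_rho m n \<rho> r)) + z 0 + ln (1 - ext_rho m n \<rho> (p 0))) \<le> WD_stat g f L m n \<rho> w (Suc s) (p 0)"
    using 0 by (intro WD_stat_Suc_ge) (auto simp: WD_stat_0 zero_ereal_def[symmetric])
  then show ?case by (simp add: atLeast0LessThan algebra_simps)
next
  case (Suc t)
  let ?a = "(\<Sum>u\<le>t. z u + ln (1 - ext_rho m n \<rho> (p u))) + (\<Sum>x<p t. ln (ext_rho m n \<rho> x))"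
  have "ereal ?a \<le> WD_stat g f L m n \<rho> w (s + t + 1) (p t)"
    using Suc.prems by (intro Suc.IH) auto
  then have "ereal (?a + (\<Sum>r\<in>{p t..<p (Suc t)}. ln (ext_rho m n \<rho> r)) + z (Suc t) + ln (1 - ext_rho m n \<rho> (p (Suc t))))
      \<le> WD_stat g f L m n \<rho> w (Suc (s + t + 1)) (p (Suc t))"
    using Suc.prems by (intro WD_stat_Suc_ge) (auto, metis add_Suc_right order_refl)
  moreover have "(\<Sum>x<p (Suc t). ln (ext_rho m n \<rho> x)) = (\<Sum>x<p t. ln (ext_rho m n \<rho> x)) + (\<Sum>r\<in>{p t..<p (Suc t)}. ln (ext_rho m n \<rho> r))"
    using Suc.prems(2)[of t "Suc t"] by (simp add: lessThan_atLeast0 sum.atLeastLessThan_concat)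
  ultimately show ?case by (simp add: algebra_simps del: WD_stat.simps)
qed

text \<open>Phases never decrease along a path, so each transition factor is paid at most once; the
  total is a valid bound for every path, whatever its length.\<close>

definition rho_penalty :: "nat \<Rightarrow> (nat \<Rightarrow> real) \<Rightarrow> real" where
  "rho_penalty M \<rho> = (\<Sum>i\<in>{1..M}. - ln (\<rho> i))"

text \<open>A bound for the cost of a single step in any phase, hence to be multiplied by the length
  of the path.\<close>

definition stay_penalty :: "nat \<Rightarrow> (nat \<Rightarrow> real) \<Rightarrow> real" where
  "stay_penalty M \<rho> = (\<Sum>i\<in>{1..M}. - ln (1 - \<rho> i))"

lemma sum_ln_ext_rho_ge:
  assumes \<rho>: "\<And>i. i \<in> {1..n - m} \<Longrightarrow> 0 < \<rho> i \<and> \<rho> i < 1" and i: "i \<le> n - m + 1"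
  shows "- rho_penalty (n - m) \<rho> \<le> (\<Sum>x<i. ln (ext_rho m n \<rho> x))"
proof -
  have "- (\<Sum>x<i. ln (ext_rho m n \<rho> x)) = (\<Sum>x<i. - ln (ext_rho m n \<rho> x))" by (simp add: sum_negf)
  also have "\<dots> \<le> (\<Sum>x<n - m + 1. - ln (ext_rho m n \<rho> x))"
  proof (rule sum_mono2)
    fix x assume "x \<in> {..<n - m + 1} - {..<i}"
    then show "0 \<le> - ln (ext_rho m n \<rho> x)"
      using \<rho>[of x] by (cases "x = 0") (auto simp: ext_rho_def)
  qed (use i in auto)
  also have "\<dots> = (\<Sum>x\<in>{0..n - m}. - ln (ext_rho m n \<rho> x))"
    by (intro sum.cong) auto
  also have "\<dots> = rho_penalty (n - m) \<rho>"
    unfolding rho_penalty_def by (rule sum.mono_neutral_cong_right) (auto simp: ext_rho_def)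
  finally show ?thesis by simp
qed

lemma ln_stay_ge:
  assumes \<rho>: "\<And>i. i \<in> {1..n - m} \<Longrightarrow> 0 < \<rho> i \<and> \<rho> i < 1" and i: "i \<in> {1..n - m + 1}"
  shows "- stay_penalty (n - m) \<rho> \<le> ln (1 - ext_rho m n \<rho> i)"
proof -
  have nonneg: "0 \<le> - ln (1 - \<rho> j)" if "j \<in> {1..n - m}" for j
    using \<rho>[OF that] by simp
  show ?thesis
  proof (cases "i = n - m + 1")
    case True
    have "0 \<le> stay_penalty (n - m) \<rho>"
      unfolding stay_penalty_def by (intro sum_nonneg nonneg)
    then show ?thesis using True by (simp add: ext_rho_def)
  next
    case False
    then have i': "i \<in> {1..n - m}" using i by auto
    have "- ln (1 - \<rho> i) \<le> stay_penalty (n - m) \<rho>"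
      unfolding stay_penalty_def using i' nonneg by (intro member_le_sum) auto
    then show ?thesis using False i' by (simp add: ext_rho_def)
  qed
qed

text \<open>Since Omega^(0) is always 0, the path that starts afresh after time \<open>s\<close>
  competes in the maximum regardless of what was observed before. The criterion for stopping by time
  \<open>s + t\<close> therefore involves only the block after \<open>s\<close>, which is what makes
  the attempts on disjoint blocks independent.\<close>

lemma WD_CuSum_le_block:
  assumes \<rho>: "\<And>i. i \<in> {1..n - m} \<Longrightarrow> 0 < \<rho> i \<and> \<rho> i < 1"
    and t: "1 \<le> t" and p: "\<And>u. u < t \<Longrightarrow> p u \<in> {1..n - m + 1}" "\<And>u v. u \<le> v \<Longrightarrow> v < t \<Longrightarrow> p u \<le> p v"
    and llr: "\<And>u. u < t \<Longrightarrow> mixture_llr g f L m (p u) (w (s + u + 1)) = ereal (z u)"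
    and b: "b + rho_penalty (n - m) \<rho> + real t * stay_penalty (n - m) \<rho> \<le> (\<Sum>u<t. z u)"
  shows "WD_CuSum g f L m n \<rho> b w \<le> enat (s + t)"
proof -
  obtain t' where t': "t = Suc t'" using t by (cases t) auto
  have "b \<le> (\<Sum>u\<le>t'. z u + ln (1 - ext_rho m n \<rho> (p u))) + (\<Sum>x<p t'. ln (ext_rho m n \<rho> x))"
  proof -
    have "(\<Sum>u\<le>t'. z u - stay_penalty (n - m) \<rho>) \<le> (\<Sum>u\<le>t'. z u + ln (1 - ext_rho m n \<rho> (p u)))"
      using ln_stay_ge[OF \<rho> p(1)] t' by (intro sum_mono) (simp add: less_Suc_eq_le)
    moreover have "(\<Sum>u\<le>t'. z u - stay_penalty (n - m) \<rho>) = (\<Sum>u<t. z u) - real t * stay_penalty (n - m) \<rho>"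
      by (simp add: sum_subtractf t' lessThan_Suc_atMost)
    moreover have "- rho_penalty (n - m) \<rho> \<le> (\<Sum>x<p t'. ln (ext_rho m n \<rho> x))"
      using p(1)[of t'] t' by (intro sum_ln_ext_rho_ge[OF \<rho>]) auto
    ultimately show ?thesis using b by linarith
  qed
  then have "ereal b \<le> ereal ((\<Sum>u\<le>t'. z u + ln (1 - ext_rho m n \<rho> (p u))) + (\<Sum>x<p t'. ln (ext_rho m n \<rho> x)))"
    by simp
  also have "\<dots> \<le> WD_stat g f L m n \<rho> w (s + t' + 1) (p t')"
    using p llr t' by (intro WD_stat_path_ge) auto
  also have "\<dots> \<le> WD_max g f L m n \<rho> w (s + t' + 1)"
    unfolding WD_max_def using p(1)[of t'] t' by (intro Max_ge) auto
  finally show ?thesis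
    unfolding WD_CuSum_def t' by (intro Inf_lower) auto
qed

section \<open>Stopping times and their measurability\<close>

lemma measurable_obs_filtration_component:
  assumes "1 \<le> k" "enat k \<le> t"
  shows "(\<lambda>w. w k) \<in> measurable (obs_filtration L t) (obs_space L)"
proof (rule measurableI)
  fix w assume "w \<in> space (obs_filtration L t)"
  then show "w k \<in> space (obs_space L)"
    using assms by (auto simp: space_obs_filtration seq_space_def space_PiM)
next
  fix B assume "B \<in> sets (obs_space L)"
  then show "(\<lambda>w. w k) -` B \<inter> space (obs_filtration L t) \<in> sets (obs_filtration L t)"
    using assms unfolding space_obs_filtration unfolding obs_filtration_def
    by (subst sets_measure_of) (auto intro!: sigma_sets.Basic)
qed

lemma (in anomaly_model) WD_stat_meas:
  "enat k \<le> t \<Longrightarrow> (\<lambda>w. WD_stat g f L m n \<rho> w k i) \<in> borel_measurable (obs_filtration L t)"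
proof (induction k arbitrary: i)
  case (Suc k)
  have "enat k \<le> t" using Suc.prems by (meson enat_ord_simps(1) le_SucI order_refl order_trans)
  note IH = Suc.IH[OF this]
  have "(\<lambda>w. mixture_llr g f L m i (w (Suc k))) \<in> borel_measurable (obs_filtration L t)"
    using Suc.prems by (intro measurable_compose[OF measurable_obs_filtration_component llr_meas]) auto
  then show ?case
    using IH by (simp del: Max_insert) measurable
qed simp

lemma (in anomaly_model) stopping_time_WD_CuSum: "stopping_time (obs_filtration L) (WD_CuSum g f L m n \<rho> b)"
proof (rule stopping_timeI)
  fix t
  show "Measurable.pred (obs_filtration L t) (\<lambda>w. WD_CuSum g f L m n \<rho> b w \<le> t)"
  proof (cases t)
    case (enat K)
    have "WD_CuSum g f L m n \<rho> b w \<le> t \<longleftrightarrow> (\<exists>k\<in>{1..K}. ereal b \<le> WD_max g f L m n \<rho> w k)" for w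
    proof
      assume le: "WD_CuSum g f L m n \<rho> b w \<le> t"
      have ne: "enat ` {k. 1 \<le> k \<and> ereal b \<le> WD_max g f L m n \<rho> w k} \<noteq> {}"
      proof
        assume "enat ` {k. 1 \<le> k \<and> ereal b \<le> WD_max g f L m n \<rho> w k} = {}"
        then have "WD_CuSum g f L m n \<rho> b w = \<infinity>"
          unfolding WD_CuSum_def by (simp only: Inf_empty top_enat_def)
        then show False using le enat by simp
      qed
      have "Inf (enat ` {k. 1 \<le> k \<and> ereal b \<le> WD_max g f L m n \<rho> w k}) \<in> enat ` {k. 1 \<le> k \<and> ereal b \<le> WD_max g f L m n \<rho> w k}"
        using wellorder_InfI ne by (metis ex_in_conv)
      then show "\<exists>k\<in>{1..K}. ereal b \<le> WD_max g f L m n \<rho> w k"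
        using le unfolding WD_CuSum_def[symmetric] enat by auto
    next
      assume "\<exists>k\<in>{1..K}. ereal b \<le> WD_max g f L m n \<rho> w k"
      then show "WD_CuSum g f L m n \<rho> b w \<le> t"
        unfolding WD_CuSum_def enat by (auto intro!: Inf_lower2)
    qed
    moreover have "(\<lambda>w. WD_max g f L m n \<rho> w k) \<in> borel_measurable (obs_filtration L t)" if "k \<in> {1..K}" for k
    proof -
      have "(\<lambda>w. WD_stat g f L m n \<rho> w k i) \<in> borel_measurable (obs_filtration L t)" for i
        using that enat by (intro WD_stat_meas) auto
      then have "(\<lambda>w. max 0 (Max ((\<lambda>i. WD_stat g f L m n \<rho> w k i) ` {1..n - m + 1}))) \<in> borel_measurable (obs_filtration L t)"
        by measurable
      then show ?thesis by (simp add: WD_max_def)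
    qed
    then have "Measurable.pred (obs_filtration L t) (\<lambda>w. \<exists>k\<in>{1..K}. ereal b \<le> WD_max g f L m n \<rho> w k)"
      by (intro pred_intros_finite) auto
    ultimately show ?thesis by simp
  qed simp
qed

lemma stopping_time_meas:
  assumes "stopping_time (obs_filtration L) \<tau>" "sets P = sets (seq_space L)"
  shows "\<tau> \<in> borel_measurable P"
proof (rule measurable_stopping_time[OF assms(1)])
  fix t
  show "space (obs_filtration L t) = space P"
    using sets_eq_imp_space_eq[OF assms(2)] by (simp add: space_obs_filtration)
  show "sets (obs_filtration L t) \<subseteq> sets P"
    unfolding assms(2) obs_filtration_def
  proof (subst sets_measure_of, force, rule sets.sigma_sets_subset, safe)
    fix k :: nat and B assume "1 \<le> k" "B \<in> sets (obs_space L)"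
    then show "(\<lambda>w. w k) -` B \<inter> space (seq_space L) \<in> sets (seq_space L)"
      unfolding seq_space_def by (intro measurable_sets[OF measurable_component_singleton]) auto
  qed
qed

lemma stopping_time_ge_sets:
  assumes "stopping_time (obs_filtration L) \<tau>" "1 \<le> \<nu>"
  shows "{w \<in> space (seq_space L). enat \<nu> \<le> \<tau> w} \<in> sets (obs_filtration L (enat (\<nu> - 1)))"
proof -
  have "Measurable.pred (obs_filtration L (enat (\<nu> - 1))) (\<lambda>w. enat (\<nu> - 1) < \<tau> w)"
    using assms(1) by (rule stopping_timeD2)
  moreover have "enat (\<nu> - 1) < t \<longleftrightarrow> enat \<nu> \<le> t" for t
    using assms(2) by (cases t) auto
  ultimately show ?thesis
    by (simp add: Measurable.pred_def space_obs_filtration)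
qed

section \<open>Upper bound for the delay\<close>

context anomaly_model
begin

lemma block_event_deviation:
  "block_event L {s + 1..s + t} {w \<in> space (seq_space L). c < \<bar>\<Sum>u<t. Z (p u) (w (s + u + 1)) - I (p u)\<bar>}"
proof -
  let ?K = "{s + 1..s + t}"
  let ?M = "Pi\<^sub>M ?K (\<lambda>_. obs_space L)"
  let ?A = "{x \<in> space ?M. c < \<bar>\<Sum>u<t. Z (p u) (x (s + u + 1)) - I (p u)\<bar>}"
  have [measurable]: "(\<lambda>x. Z (p u) (x (s + u + 1))) \<in> borel_measurable ?M" if "u < t" for u
    using that by (intro measurable_compose[OF _ Z_meas] measurable_component_singleton) auto
  have "?A \<in> sets ?M" by measurable
  moreover have "{w \<in> space (seq_space L). c < \<bar>\<Sum>u<t. Z (p u) (w (s + u + 1)) - I (p u)\<bar>}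
    = {w \<in> space (seq_space L). restrict w ?K \<in> ?A}"
    by (rule Collect_cong) (auto simp: seq_space_def space_PiM)
  ultimately show ?thesis unfolding block_event_def by blast
qed

text \<open>After the changepoint the time axis is cut into a first block of length \<open>t0\<close> and further
  blocks of length \<open>l\<close>. The test has stopped by the end of the first block on which the
  log-likelihood ratios do not deviate much from their means, and the blocks are independent.\<close>

lemma worst_history_delay_WD_CuSum_le:
  fixes t0 l :: nat and \<epsilon> \<delta> b :: real
  assumes S: "S \<in> trajectories L m n" and \<nu>: "1 \<le> \<nu>"
    and \<rho>: "\<And>i. i \<in> {1..n - m} \<Longrightarrow> 0 < \<rho> i \<and> \<rho> i < 1"
    and t0: "1 \<le> t0" and l: "1 \<le> l" and \<epsilon>: "0 \<le> \<epsilon>" "\<epsilon> \<le> 1 / 2"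
    and dev: "deviation_bound \<delta> \<epsilon> t0" "deviation_bound \<delta> \<epsilon> l"
    and first: "b + rho_penalty (n - m) \<rho> + real t0 * stay_penalty (n - m) \<rho> \<le> (\<Sum>u<t0. I (phase d u)) - \<delta> * real t0"
    and later: "\<And>s. b + rho_penalty (n - m) \<rho> + real l * stay_penalty (n - m) \<rho> \<le> (\<Sum>u<l. I (phase d (s + u))) - \<delta> * real l"
  shows "worst_history_delay (anomaly_prob g f L m n \<nu> d S) L (WD_CuSum g f L m n \<rho> b) \<nu> \<le> ennreal (real t0 + 2 * \<epsilon> * real l)"
proof -
  interpret A: indep_coordinates "coordinate_law \<nu> d S" L by (rule indep_coordinates_anomaly[OF S])
  interpret prob_space A.P by (rule A.prob_P)
  have P: "anomaly_prob g f L m n \<nu> d S = A.P" by (simp add: anomaly_prob_eq A.P_def)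
  let ?\<tau> = "WD_CuSum g f L m n \<rho> b"
  \<comment> \<open>\<open>st j\<close> is the offset of block \<open>j\<close> from the
    changepoint, and \<open>s j\<close> is the last time before the block. Hence observation
    \<open>u\<close> of block \<open>j\<close> is made at time
    \<open>s j + u + 1 = \<nu> + (st j + u)\<close>.\<close>
  define len st s where "len j = (if j = 0 then t0 else l)" and "st j = (if j = 0 then 0 else t0 + (j - 1) * l)"
    and "s j = \<nu> - 1 + st j" for j :: nat
  define F where "F j = {w \<in> space (seq_space L). \<delta> * real (len j) <
      \<bar>\<Sum>u<len j. Z (phase d (st j + u)) (w (s j + u + 1)) - I (phase d (st j + u))\<bar>}" for j
  have st_Suc: "st (Suc j) = st j + len j" for j
    by (cases j) (auto simp: st_def len_def)
  have s_eq: "s j + u + 1 = \<nu> + (st j + u)" for j u using \<nu> by (simp add: s_def)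
  have end_eq: "st j + len j = t0 + j * l" for j by (cases j) (auto simp: st_def len_def)
  have len_dev: "deviation_bound \<delta> \<epsilon> (len j)" and len1: "1 \<le> len j" for j using t0 l dev by (auto simp: len_def)
  have F_block: "block_event L {s j + 1..s j + len j} (F j)" for j
    unfolding F_def by (rule block_event_deviation)
  have F_sets [measurable]: "F j \<in> sets A.P" for j
    using block_event_sets[OF _ F_block] by (auto simp: A.sets_P)
  have F_prob: "prob (F j) \<le> \<epsilon>" for j
    unfolding F_def A.P_def
  proof (rule deviation_boundD[OF len_dev])
    show "indep_coordinates (coordinate_law \<nu> d S) L" by (rule indep_coordinates_anomaly[OF S])
    fix u
    have "distr (coordinate_law \<nu> d S (\<nu> + (st j + u))) borel (Z (phase_at m n \<nu> d (\<nu> + (st j + u))))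
        = law (phase_at m n \<nu> d (\<nu> + (st j + u)))"
      using \<nu> by (intro distr_coordinate_law[OF S]) auto
    then show "phase d (st j + u) \<in> {1..N} \<and> distr (coordinate_law \<nu> d S (s j + u + 1)) borel (Z (phase d (st j + u))) = law (phase d (st j + u))"
      unfolding s_eq phase_at_shift using phase_range by simp
  qed
  have stop: "AE w in A.P. \<forall>j. w \<notin> F j \<longrightarrow> ?\<tau> w \<le> enat (s j + len j)"
  proof -
    have "AE w in A.P. \<forall>u. mixture_llr g f L m (phase d u) (w (\<nu> + u)) = ereal (Z (phase d u) (w (\<nu> + u)))"
      unfolding P[symmetric] by (rule AE_llr_finite[OF S \<nu>])
    then show ?thesis
    proof (rule AE_mp, intro AE_I2 impI allI)
      fix w j
      assume w: "w \<in> space A.P" and llr: "\<forall>u. mixture_llr g f L m (phase d u) (w (\<nu> + u)) = ereal (Z (phase d u) (w (\<nu> + u)))"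
        and nF: "w \<notin> F j"
      show "?\<tau> w \<le> enat (s j + len j)"
      proof (rule WD_CuSum_le_block[OF \<rho> len1])
        fix u show "phase d (st j + u) \<in> {1..n - m + 1}" using phase_range by (simp add: N_def)
        show "phase d (st j + u) \<le> phase d (st j + v)" if "u \<le> v" for v using that by (intro phase_mono) simp
        show "mixture_llr g f L m (phase d (st j + u)) (w (s j + u + 1)) = ereal (Z (phase d (st j + u)) (w (\<nu> + (st j + u))))"
          unfolding s_eq using llr by blast
      next
        have "\<bar>\<Sum>u<len j. Z (phase d (st j + u)) (w (\<nu> + (st j + u))) - I (phase d (st j + u))\<bar> \<le> \<delta> * real (len j)"
          using nF w unfolding F_def s_eq A.space_P by simp
        moreover have "b + rho_penalty (n - m) \<rho> + real (len j) * stay_penalty (n - m) \<rho>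
            \<le> (\<Sum>u<len j. I (phase d (st j + u))) - \<delta> * real (len j)"
          using first later by (auto simp: len_def st_def)
        ultimately show "b + rho_penalty (n - m) \<rho> + real (len j) * stay_penalty (n - m) \<rho>
            \<le> (\<Sum>u<len j. Z (phase d (st j + u)) (w (\<nu> + (st j + u))))"
          by (simp add: sum_subtractf)
      qed
    qed
  qed
  have \<tau>m: "?\<tau> \<in> borel_measurable A.P"
    by (rule stopping_time_meas[OF stopping_time_WD_CuSum A.sets_P])
  have c: "1 \<le> real t0 + 2 * \<epsilon> * real l" using t0 \<epsilon> by (intro add_increasing2) auto
  have "worst_history_delay A.P L ?\<tau> \<nu> \<le> ennreal (real t0 + 2 * \<epsilon> * real l)"
  proof (rule worst_history_delay_le[OF A.prob_P A.sets_P \<tau>m _ c])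
    show "{w \<in> space A.P. enat \<nu> \<le> ?\<tau> w} \<in> sets (obs_filtration L (enat (\<nu> - 1)))"
      unfolding A.space_P by (rule stopping_time_ge_sets[OF stopping_time_WD_CuSum \<nu>])
    fix B assume BF: "B \<in> sets (obs_filtration L (enat (\<nu> - 1)))" and "B \<subseteq> {w \<in> space A.P. enat \<nu> \<le> ?\<tau> w}"
    have B_block: "block_event L {1..\<nu> - 1} B" by (rule obs_filtration_block_event[OF BF])
    have B_sets [measurable]: "B \<in> sets A.P" using obs_filtration_sets[OF BF] by (simp add: A.sets_P)
    define G where "G j = (\<Inter>i\<in>{..j}. F i)" for j
    have G_sets [measurable]: "G j \<in> sets A.P" for j
      unfolding G_def by (rule sets.finite_INT) (simp_all add: F_sets)
    have G_prob: "prob (G j \<inter> B) \<le> prob B * \<epsilon> ^ Suc j" for j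
    proof -
      \<comment> \<open>The history \<open>B\<close> is put in front of the deviation blocks as a
        block with index 0, so that one product formula covers them all.\<close>
      define K where "K i = (case i of 0 \<Rightarrow> {1..\<nu> - 1} | Suc i \<Rightarrow> {s i + 1..s i + len i})" for i
      define E where "E i = (case i of 0 \<Rightarrow> B | Suc i \<Rightarrow> F i)" for i
      have s_mono: "s i + len i \<le> s i'" if "i < i'" for i i'
      proof -
        have "st (Suc i) \<le> st i'" using that by (rule lift_Suc_mono_le[of st, rotated, OF Suc_leI]) (simp add: st_Suc)
        then show ?thesis by (simp add: st_Suc s_def)
      qed
      have K_disj: "K i \<inter> K i' = {}" if "i < i'" for i i'
      proof (cases i)
        case 0
        then show ?thesis using that by (auto simp: K_def s_def split: nat.splits)
      next
        case (Suc i0)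
        then obtain i0' where "i' = Suc i0'" using \<open>i < i'\<close> by (cases i') auto
        then show ?thesis using s_mono[of i0 i0'] that Suc by (auto simp: K_def)
      qed
      have "prob (\<Inter>i\<in>{..Suc j}. E i) = (\<Prod>i\<in>{..Suc j}. prob (E i))"
      proof (rule A.block_prob)
        show "K i \<subseteq> {1..}" for i by (auto simp: K_def split: nat.splits)
        show "disjoint_family_on K {..Suc j}"
          unfolding disjoint_family_on_def
        proof (intro ballI impI)
          fix i i' :: nat assume "i \<noteq> i'"
          then consider "i < i'" | "i' < i" by linarith
          then show "K i \<inter> K i' = {}" by cases (use K_disj in \<open>auto simp: Int_commute\<close>)
        qed
        show "block_event L (K i) (E i)" for i
          using B_block F_block by (auto simp: K_def E_def split: nat.splits)
      qed auto
      moreover have "(\<Inter>i\<in>{..Suc j}. E i) = G j \<inter> B"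
        unfolding atMost_Suc_eq_insert_0 by (auto simp: E_def G_def)
      moreover have "(\<Prod>i\<in>{..Suc j}. prob (E i)) = prob B * (\<Prod>i\<in>{..j}. prob (F i))"
        by (subst prod.atMost_Suc_shift) (simp add: E_def)
      moreover have "(\<Prod>i\<in>{..j}. prob (F i)) \<le> (\<Prod>i\<in>{..j}. \<epsilon>)"
        using F_prob by (intro prod_mono) auto
      ultimately show ?thesis by (simp add: mult_left_mono)
    qed
    \<comment> \<open>\<open>X\<close> counts the bad blocks before the first good one, since
      \<open>G j\<close> says that the blocks up to \<open>j\<close> are all bad. Its mean is a
      geometric series, in which no stopping rule appears.\<close>
    define X where "X w = (\<Sum>j. indicator (G j) w :: ennreal)" for w
    have delay: "AE w in A.P. ennreal_of_enat (?\<tau> w + 1 - enat \<nu>) \<le> of_nat t0 + of_nat l * X w"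
      using stop
    proof (rule AE_mp, intro AE_I2 impI)
      fix w assume w: "w \<in> space A.P" and st': "\<forall>j. w \<notin> F j \<longrightarrow> ?\<tau> w \<le> enat (s j + len j)"
      have X_ge: "of_nat j \<le> X w" if "\<And>i. i < j \<Longrightarrow> w \<in> F i" for j
      proof -
        have "of_nat j = (\<Sum>i<j. indicator (G i) w :: ennreal)"
          using that by (simp add: G_def indicator_def)
        also have "\<dots> \<le> X w" unfolding X_def by (rule sum_le_suminf) auto
        finally show ?thesis .
      qed
      show "ennreal_of_enat (?\<tau> w + 1 - enat \<nu>) \<le> of_nat t0 + of_nat l * X w"
      proof (cases "\<exists>j. w \<notin> F j")
        case True
        define j where "j = (LEAST j. w \<notin> F j)"
        have "w \<notin> F j" unfolding j_def using True by (rule LeastI_ex)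
        then have "?\<tau> w \<le> enat (s j + len j)" using st' by blast
        then have "?\<tau> w + 1 - enat \<nu> \<le> enat (t0 + j * l)"
          using \<nu> end_eq[of j] by (cases "?\<tau> w") (auto simp: s_def one_enat_def)
        then have "ennreal_of_enat (?\<tau> w + 1 - enat \<nu>) \<le> ennreal_of_enat (enat (t0 + j * l))"
          by (simp only: ennreal_of_enat_le_iff)
        also have "\<dots> = of_nat t0 + of_nat l * of_nat j" by (simp add: mult.commute)
        also have "\<dots> \<le> of_nat t0 + of_nat l * X w"
        proof (rule add_left_mono, rule mult_left_mono)
          show "of_nat j \<le> X w"
            using not_less_Least[of _ "\<lambda>j. w \<notin> F j"] unfolding j_def by (intro X_ge) blast
        qed simp
        finally show ?thesis .
      next
        \<comment> \<open>If every block is bad, the count is infinite and the bound is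
          trivial.\<close>
        case False
        have "X w = \<top>"
        proof (rule ccontr)
          assume "X w \<noteq> \<top>"
          then obtain k where "X w \<le> of_nat k"
            using ennreal_Ex_less_of_nat[of "X w"] by (auto simp: less_top intro: less_imp_le)
          with X_ge[of "Suc k"] False have "(of_nat (Suc k) :: ennreal) \<le> of_nat k" by (meson order_trans)
          then show False by (simp only: of_nat_le_iff)
        qed
        then show ?thesis using l by (simp add: ennreal_mult_top)
      qed
    qed
    have "(\<integral>\<^sup>+ w. ennreal_of_enat (?\<tau> w + 1 - enat \<nu>) * indicator B w \<partial>A.P)
        \<le> (\<integral>\<^sup>+ w. of_nat t0 * indicator B w + of_nat l * (\<Sum>j. indicator (G j \<inter> B) w) \<partial>A.P)"
    proof (rule nn_integral_mono_AE, rule eventually_mono[OF delay])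
      fix w assume "ennreal_of_enat (?\<tau> w + 1 - enat \<nu>) \<le> of_nat t0 + of_nat l * X w"
      then show "ennreal_of_enat (?\<tau> w + 1 - enat \<nu>) * indicator B w
          \<le> of_nat t0 * indicator B w + of_nat l * (\<Sum>j. indicator (G j \<inter> B) w)"
        by (cases "w \<in> B") (auto simp: X_def indicator_inter_arith)
    qed
    also have "\<dots> = of_nat t0 * emeasure A.P B + of_nat l * (\<Sum>j. emeasure A.P (G j \<inter> B))"
    proof -
      have "(\<integral>\<^sup>+ w. (\<Sum>j. indicator (G j \<inter> B) w) \<partial>A.P) = (\<Sum>j. \<integral>\<^sup>+ w. indicator (G j \<inter> B) w \<partial>A.P)"
        by (rule nn_integral_suminf) measurable
      then show ?thesis
        by (subst nn_integral_add) (auto simp: nn_integral_cmult nn_integral_cmult_indicator)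
    qed
    also have "(\<Sum>j. emeasure A.P (G j \<inter> B)) \<le> ennreal (prob B * (2 * \<epsilon>))"
    proof -
      \<comment> \<open>The series of \<epsilon>^(j + 1) has the sum \<epsilon> / (1 - \<epsilon>),
        which is at most \<open>2 * \<epsilon>\<close> because
        \<open>\<epsilon> \<le> 1 / 2\<close>.\<close>
      have sums: "(\<lambda>j. prob B * \<epsilon> ^ Suc j) sums (prob B * (\<epsilon> * (1 / (1 - \<epsilon>))))"
        unfolding power_Suc using \<epsilon> by (intro sums_mult geometric_sums) auto
      have "(\<Sum>j. emeasure A.P (G j \<inter> B)) \<le> (\<Sum>j. ennreal (prob B * \<epsilon> ^ Suc j))"
        using G_prob by (intro suminf_le) (auto simp: emeasure_eq_measure ennreal_leI simp del: power_Suc)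
      also have "\<dots> = ennreal (prob B * (\<epsilon> * (1 / (1 - \<epsilon>))))"
        using sums \<epsilon> by (intro suminf_ennreal_eq) auto
      also have "\<dots> \<le> ennreal (prob B * (2 * \<epsilon>))"
      proof (intro ennreal_leI mult_left_mono)
        have "1 / (1 - \<epsilon>) \<le> 2" using \<epsilon> by (simp add: field_simps)
        then show "\<epsilon> * (1 / (1 - \<epsilon>)) \<le> 2 * \<epsilon>" using \<epsilon> mult_left_mono[of "1 / (1 - \<epsilon>)" 2 \<epsilon>] by linarith
      qed simp
      finally show ?thesis .
    qed
    also have "of_nat t0 * emeasure A.P B + of_nat l * ennreal (prob B * (2 * \<epsilon>))
        = ennreal (real t0 + 2 * \<epsilon> * real l) * emeasure A.P B"
    proof -
      have "of_nat t0 * emeasure A.P B + of_nat l * ennreal (prob B * (2 * \<epsilon>))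
        = ennreal (real t0 * prob B + real l * (prob B * (2 * \<epsilon>)))"
        using \<epsilon> by (simp add: emeasure_eq_measure ennreal_of_nat_eq_real_of_nat ennreal_mult)
      also have "\<dots> = ennreal (real t0 + 2 * \<epsilon> * real l) * emeasure A.P B"
        unfolding emeasure_eq_measure using \<epsilon> by (subst ennreal_mult[symmetric]) (auto simp: algebra_simps)
      finally show ?thesis .
    qed
    finally show "(\<integral>\<^sup>+ w. ennreal_of_enat (?\<tau> w + 1 - enat \<nu>) * indicator B w \<partial>A.P)
      \<le> ennreal (real t0 + 2 * \<epsilon> * real l) * emeasure A.P B"
      by (simp add: add_left_mono mult_left_mono)
  qed
  then show ?thesis by (simp only: P)
qed

end

section \<open>Lower bound for the delay\<close>

text \<open>The sum counts the grid points \<open>1 + j * t\<close> up to \<open>x\<close>; for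
  finite \<open>x\<close> there are as many as the quotient \<open>x / t\<close> rounded up.\<close>

lemma le_mult_suminf_enat:
  assumes t: "1 \<le> t"
  shows "ennreal_of_enat x \<le> of_nat t * (\<Sum>j. indicator {y. enat (1 + j * t) \<le> y} x)"
proof -
  let ?X = "\<Sum>j. indicator {y. enat (1 + j * t) \<le> y} x :: ennreal"
  have X_ge: "of_nat J \<le> ?X" if "\<And>j. j < J \<Longrightarrow> enat (1 + j * t) \<le> x" for J
  proof -
    have "of_nat J = (\<Sum>j<J. indicator {y. enat (1 + j * t) \<le> y} x :: ennreal)"
      using that by (simp add: indicator_def)
    also have "\<dots> \<le> ?X" by (rule sum_le_suminf) auto
    finally show ?thesis .
  qed
  show ?thesis
  proof (cases x)
    case (enat k)
    define J where "J = (k + t - 1) div t"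
    have k: "k \<le> t * J"
    proof -
      have "k + t - 1 = t * J + (k + t - 1) mod t" unfolding J_def by simp
      moreover have "(k + t - 1) mod t < t" using t by simp
      ultimately show ?thesis by linarith
    qed
    have "1 + j * t \<le> k" if "j < J" for j
    proof -
      have "Suc j * t \<le> J * t" using that by (intro mult_le_mono1) simp
      also have "\<dots> \<le> k + t - 1" unfolding J_def by (rule div_times_less_eq_dividend)
      finally show ?thesis using t by (simp add: algebra_simps)
    qed
    then have "of_nat J \<le> ?X" by (intro X_ge) (simp add: enat)
    then have J: "of_nat t * of_nat J \<le> of_nat t * ?X" by (rule mult_left_mono) simp
    have "ennreal_of_enat x = of_nat k" by (simp add: enat)
    also have "\<dots> \<le> of_nat (t * J)" using k by (rule of_nat_mono)
    also have "\<dots> = of_nat t * of_nat J" by (rule of_nat_mult)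
    finally show ?thesis using J by (rule order_trans)
  next
    case infinity
    have "?X = \<top>"
    proof (rule ccontr)
      assume "?X \<noteq> \<top>"
      then obtain k where "?X < of_nat k"
        using ennreal_Ex_less_of_nat[of ?X] by (auto simp: less_top)
      moreover have "of_nat k \<le> ?X" by (rule X_ge) (simp add: infinity)
      ultimately show False by simp
    qed
    then show ?thesis using t by (simp add: ennreal_mult_top)
  qed
qed

text \<open>If in every window of length \<open>t\<close> the hazard of stopping were larger than \<open>2 t / \<gamma>\<close>, then the
  tail of \<open>\<tau>\<close> would decay geometrically and its mean would be at most \<open>\<gamma> / 2\<close>.\<close>

lemma ex_rare_window:
  fixes \<tau> :: "'a \<Rightarrow> enat"
  assumes "prob_space M" and [measurable]: "\<tau> \<in> borel_measurable M" and E: "ennreal \<gamma> \<le> (\<integral>\<^sup>+ w. ennreal_of_enat (\<tau> w) \<partial>M)"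
    and \<gamma>: "0 < \<gamma>" and t: "1 \<le> t" "2 * real t \<le> \<gamma>"
  obtains \<nu> where "1 \<le> \<nu>" "0 < measure M {w \<in> space M. enat \<nu> \<le> \<tau> w}"
    "measure M {w \<in> space M. enat \<nu> \<le> \<tau> w \<and> \<tau> w < enat (\<nu> + t)} \<le> 2 * real t / \<gamma> * measure M {w \<in> space M. enat \<nu> \<le> \<tau> w}"
proof (rule ccontr)
  note found = that
  interpret prob_space M by fact
  let ?p = "\<lambda>\<nu>. prob {w \<in> space M. enat \<nu> \<le> \<tau> w}"
  define \<alpha> where "\<alpha> = 2 * real t / \<gamma>"
  have \<alpha>: "0 < \<alpha>" "\<alpha> \<le> 1" using t \<gamma> by (auto simp: \<alpha>_def)
  assume nt: "\<not> thesis"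
  have *: "\<alpha> * ?p \<nu> < prob {w \<in> space M. enat \<nu> \<le> \<tau> w \<and> \<tau> w < enat (\<nu> + t)}" if "1 \<le> \<nu>" "0 < ?p \<nu>" for \<nu>
  proof (rule ccontr)
    assume "\<not> \<alpha> * ?p \<nu> < prob {w \<in> space M. enat \<nu> \<le> \<tau> w \<and> \<tau> w < enat (\<nu> + t)}"
    then have thesis using that by (intro found[of \<nu>]) (auto simp: \<alpha>_def not_less)
    then show False using nt by simp
  qed
  have step: "?p (\<nu> + t) \<le> (1 - \<alpha>) * ?p \<nu>" if "1 \<le> \<nu>" for \<nu>
  proof -
    have "?p \<nu> = ?p (\<nu> + t) + prob {w \<in> space M. enat \<nu> \<le> \<tau> w \<and> \<tau> w < enat (\<nu> + t)}"
    proof (subst finite_measure_Union[symmetric])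
      have "enat (\<nu> + t) \<le> y \<Longrightarrow> enat \<nu> \<le> y" for y by (cases y) auto
      then show "?p \<nu> = prob ({w \<in> space M. enat (\<nu> + t) \<le> \<tau> w} \<union> {w \<in> space M. enat \<nu> \<le> \<tau> w \<and> \<tau> w < enat (\<nu> + t)})"
        by (intro arg_cong[where f=prob]) (auto simp: not_le)
    qed (auto simp: not_le)
    moreover have "\<alpha> * ?p \<nu> \<le> prob {w \<in> space M. enat \<nu> \<le> \<tau> w \<and> \<tau> w < enat (\<nu> + t)}"
      using *[OF that] measure_nonneg[of M "{w \<in> space M. enat \<nu> \<le> \<tau> w}"]
      by (cases "?p \<nu> = 0") auto
    ultimately show ?thesis by (simp add: algebra_simps)
  qed
  have tail: "?p (1 + j * t) \<le> (1 - \<alpha>) ^ j" for j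
  proof (induction j)
    case (Suc j)
    have "?p (1 + Suc j * t) = ?p ((1 + j * t) + t)" by (simp add: algebra_simps)
    also have "\<dots> \<le> (1 - \<alpha>) * ?p (1 + j * t)" by (rule step) simp
    also have "\<dots> \<le> (1 - \<alpha>) * (1 - \<alpha>) ^ j" using Suc \<alpha> by (intro mult_left_mono) auto
    finally show ?case by simp
  qed simp
  have "(\<integral>\<^sup>+ w. ennreal_of_enat (\<tau> w) \<partial>M) \<le> (\<integral>\<^sup>+ w. of_nat t * (\<Sum>j. indicator {w \<in> space M. enat (1 + j * t) \<le> \<tau> w} w) \<partial>M)"
  proof (rule nn_integral_mono)
    fix w assume w: "w \<in> space M"
    have "(\<lambda>j. indicator {w \<in> space M. enat (1 + j * t) \<le> \<tau> w} w :: ennreal) = (\<lambda>j. indicator {y. enat (1 + j * t) \<le> y} (\<tau> w))"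
      using w by (auto simp: indicator_def)
    then show "ennreal_of_enat (\<tau> w) \<le> of_nat t * (\<Sum>j. indicator {w \<in> space M. enat (1 + j * t) \<le> \<tau> w} w)"
      using le_mult_suminf_enat[OF t(1), of "\<tau> w"] by simp
  qed
  also have "\<dots> = of_nat t * (\<Sum>j. emeasure M {w \<in> space M. enat (1 + j * t) \<le> \<tau> w})"
    by (simp add: nn_integral_cmult nn_integral_suminf)
  also have "\<dots> \<le> of_nat t * (\<Sum>j. ennreal ((1 - \<alpha>) ^ j))"
    using tail by (intro mult_left_mono suminf_le) (auto simp: emeasure_eq_measure ennreal_leI)
  also have "(\<Sum>j. ennreal ((1 - \<alpha>) ^ j)) = ennreal (1 / \<alpha>)"
    using geometric_sums[of "1 - \<alpha>"] \<alpha> by (intro suminf_ennreal_eq) auto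
  also have "of_nat t * ennreal (1 / \<alpha>) = ennreal (\<gamma> / 2)"
    using \<gamma> t by (simp add: ennreal_of_nat_eq_real_of_nat ennreal_mult[symmetric] \<alpha>_def)
  finally have "ennreal \<gamma> \<le> ennreal (\<gamma> / 2)" using E by order
  then show False using \<gamma> by (simp add: ennreal_le_iff)
qed

section \<open>Change of measure on a finite window\<close>

lemma block_event_measure_cong:
  assumes Q: "indep_coordinates Q L" and Q': "indep_coordinates Q' L"
    and eq: "\<And>k. k \<in> K \<Longrightarrow> Q k = Q' k" and K: "K \<subseteq> {1..}" and A: "block_event L K A"
  shows "measure (Pi\<^sub>M {1..} Q) A = measure (Pi\<^sub>M {1..} Q') A"
proof -
  obtain A' where A': "A' \<in> sets (Pi\<^sub>M K (\<lambda>_. obs_space L))" "A = {w \<in> space (seq_space L). restrict w K \<in> A'}"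
    using A unfolding block_event_def by blast
  have *: "measure (Pi\<^sub>M {1..} Q) A = measure (Pi\<^sub>M K Q) A'" if "indep_coordinates Q L" for Q
  proof -
    interpret B: indep_coordinates Q L by fact
    have A'': "A' \<in> sets (Pi\<^sub>M K Q)"
      using A'(1) K B.sets_Q sets_PiM_cong[of K K Q "\<lambda>_. obs_space L"] by auto
    have "distr B.P (Pi\<^sub>M K Q) (\<lambda>w. restrict w K) = Pi\<^sub>M K Q"
      unfolding B.P_def using K B.prob_Q by (intro distr_PiM_reindex[where f="\<lambda>x. x"]) auto
    then have "measure (Pi\<^sub>M K Q) A' = measure (distr B.P (Pi\<^sub>M K Q) (\<lambda>w. restrict w K)) A'" by simp
    also have "\<dots> = measure B.P ((\<lambda>w. restrict w K) -` A' \<inter> space B.P)"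
      unfolding B.P_def using K A'' by (intro measure_distr measurable_restrict_subset)
    also have "(\<lambda>w. restrict w K) -` A' \<inter> space B.P = A" unfolding A'(2) B.space_P by auto
    finally show ?thesis by (simp add: B.P_def)
  qed
  have "Pi\<^sub>M K Q = Pi\<^sub>M K Q'" using eq by (intro PiM_cong) auto
  then show ?thesis using *[OF Q] *[OF Q'] by simp
qed

text \<open>Two infinite products that differ in finitely many factors only are related by the
  finite product of the densities of these factors. It is enough to compare them on
  cylinders.\<close>

lemma PiM_density:
  fixes Q Q0 :: "nat \<Rightarrow> (nat \<Rightarrow> real) measure"
  assumes Q: "indep_coordinates Q L" and Q0: "indep_coordinates Q0 L" and J: "finite J" "J \<subseteq> {1..}"
    and \<phi>: "\<And>k. k \<in> J \<Longrightarrow> \<phi> k \<in> borel_measurable (obs_space L)"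
    and dens: "\<And>k. k \<in> J \<Longrightarrow> Q k = density (Q0 k) (\<phi> k)" and same: "\<And>k. 1 \<le> k \<Longrightarrow> k \<notin> J \<Longrightarrow> Q k = Q0 k"
  shows "Pi\<^sub>M {1..} Q = density (Pi\<^sub>M {1..} Q0) (\<lambda>w. \<Prod>k\<in>J. \<phi> k (w k))"
proof (rule measure_eqI_PiM_infinite)
  interpret A: indep_coordinates Q L by fact
  interpret B: indep_coordinates Q0 L by fact
  interpret prob_space B.P by (rule B.prob_P)
  show "finite_measure (Pi\<^sub>M {1..} Q)"
    using A.prob_P unfolding A.P_def by (simp add: prob_space_def)
  show "sets (Pi\<^sub>M {1..} Q) = sets (Pi\<^sub>M {1..} Q)" ..
  show "sets (density (Pi\<^sub>M {1..} Q0) (\<lambda>w. \<Prod>k\<in>J. \<phi> k (w k))) = sets (Pi\<^sub>M {1..} Q)"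
    using A.sets_P B.sets_P by (simp add: A.P_def B.P_def)
  fix E J' assume J': "finite J'" "J' \<subseteq> {1..}" and E: "\<And>i. i \<in> J' \<Longrightarrow> E i \<in> sets (Q i)"
  have E0: "E i \<in> sets (obs_space L)" if "i \<in> J'" for i
    using E[OF that] A.sets_Q[of i] J' that by auto
  let ?T = "J \<union> J'" and ?X = "prod_emb {1..} Q J' (Pi\<^sub>E J' E)"
  have T: "1 \<le> k" if "k \<in> ?T" for k using that J J' by auto
  \<comment> \<open>At each time the density factor and the cylinder indicator are merged into one
    function, with 1 for whichever is absent, so that the integral splits over the times.\<close>
  define \<psi> where "\<psi> k x = (if k \<in> J then \<phi> k x else 1) * (if k \<in> J' then indicator (E k) x else 1)" for k x
  have \<psi>m: "\<psi> k \<in> borel_measurable (obs_space L)" for k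
    using \<phi>[of k] E0[of k] unfolding \<psi>_def[abs_def] by (cases "k \<in> J"; cases "k \<in> J'") auto
  have "?X \<in> sets (Pi\<^sub>M {1..} Q)" using J' E by (intro sets_PiM_I) auto
  then have X: "?X \<in> sets B.P" using A.sets_P B.sets_P by (simp add: A.P_def)
  have dm: "(\<lambda>w. \<Prod>k\<in>J. \<phi> k (w k)) \<in> borel_measurable B.P"
  proof (rule borel_measurable_prod_ennreal)
    fix k assume "k \<in> J"
    then show "(\<lambda>w. \<phi> k (w k)) \<in> borel_measurable B.P"
      using J by (intro measurable_compose[OF B.coordinate_meas \<phi>]) auto
  qed
  have factor: "(\<integral>\<^sup>+ x. \<psi> k x \<partial>Q0 k) = (if k \<in> J' then emeasure (Q k) (E k) else 1)" if "k \<in> ?T" for k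
  proof -
    have sets0: "sets (Q0 k) = sets (obs_space L)" by (rule B.sets_Q[OF T[OF that]])
    have Q1: "emeasure (Q k) (space (obs_space L)) = 1"
      using prob_space.emeasure_space_1[OF A.prob_Q[OF T[OF that]]] sets_eq_imp_space_eq[OF A.sets_Q[OF T[OF that]]] by simp
    show ?thesis
    proof (cases "k \<in> J")
      case True
      have m: "\<phi> k \<in> borel_measurable (Q0 k)" using \<phi>[OF True] by (simp cong: measurable_cong_sets add: sets0)
      show ?thesis
      proof (cases "k \<in> J'")
        case True
        then show ?thesis
          using \<open>k \<in> J\<close> m E0[of k] by (simp add: \<psi>_def dens emeasure_density sets0)
      next
        case False
        have "(\<integral>\<^sup>+ x. \<psi> k x \<partial>Q0 k) = (\<integral>\<^sup>+ x. \<phi> k x * indicator (space (Q0 k)) x \<partial>Q0 k)"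
          using \<open>k \<in> J\<close> False by (intro nn_integral_cong) (simp add: \<psi>_def)
        also have "\<dots> = emeasure (Q k) (space (Q0 k))"
          using \<open>k \<in> J\<close> m by (simp add: dens emeasure_density)
        also have "\<dots> = 1" using Q1 sets_eq_imp_space_eq[OF sets0] by simp
        finally show ?thesis using False by simp
      qed
    next
      case False
      then have "k \<in> J'" using that by auto
      then show ?thesis
        using False E0[of k] same[OF T[OF that] False] by (simp add: \<psi>_def sets0)
    qed
  qed
  have "emeasure (density B.P (\<lambda>w. \<Prod>k\<in>J. \<phi> k (w k))) ?X = (\<integral>\<^sup>+ w. (\<Prod>k\<in>J. \<phi> k (w k)) * indicator ?X w \<partial>B.P)"
    using dm X by (rule emeasure_density)
  also have "\<dots> = (\<integral>\<^sup>+ w. (\<Prod>k\<in>?T. \<psi> k (w k)) \<partial>B.P)"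
  proof (rule nn_integral_cong)
    fix w assume w: "w \<in> space B.P"
    have "w \<in> space A.P" using w A.space_P B.space_P by simp
    then have "w \<in> ?X \<longleftrightarrow> (\<forall>k\<in>J'. w k \<in> E k)"
      using J' by (auto simp: prod_emb_def A.P_def space_PiM PiE_iff)
    then have "indicator ?X w = (\<Prod>k\<in>J'. indicator (E k) (w k) :: ennreal)"
      using J'(1) by (auto simp: indicator_def intro!: prod_zero[symmetric] prod.neutral[symmetric])
    also have "\<dots> = (\<Prod>k\<in>?T. if k \<in> J' then indicator (E k) (w k) else 1)"
      using J J' by (intro prod.mono_neutral_cong_left) auto
    moreover have "(\<Prod>k\<in>J. \<phi> k (w k)) = (\<Prod>k\<in>?T. if k \<in> J then \<phi> k (w k) else 1)"
      using J J' by (intro prod.mono_neutral_cong_left) auto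
    ultimately show "(\<Prod>k\<in>J. \<phi> k (w k)) * indicator ?X w = (\<Prod>k\<in>?T. \<psi> k (w k))"
      by (simp only: \<psi>_def prod.distrib)
  qed
  also have "\<dots> = (\<Prod>k\<in>?T. \<integral>\<^sup>+ w. \<psi> k (w k) \<partial>B.P)"
  proof (rule indep_vars_nn_integral)
    have "indep_vars (\<lambda>_. borel) (\<lambda>k w. \<psi> k (w k)) {1..}"
      using B.indep_coordinates \<psi>m by (rule indep_vars_compose2)
    then show "indep_vars (\<lambda>_. borel) (\<lambda>k w. \<psi> k (w k)) ?T"
      by (rule indep_vars_subset) (use T in auto)
  qed (use J J' in auto)
  also have "\<dots> = (\<Prod>k\<in>?T. if k \<in> J' then emeasure (Q k) (E k) else 1)"
  proof (rule prod.cong[OF refl])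
    fix k assume k: "k \<in> ?T"
    have "(\<integral>\<^sup>+ w. \<psi> k (w k) \<partial>B.P) = (\<integral>\<^sup>+ x. \<psi> k x \<partial>distr B.P (obs_space L) (\<lambda>w. w k))"
      using B.coordinate_meas[OF T[OF k]] \<psi>m by (intro nn_integral_distr[symmetric]) auto
    then show "(\<integral>\<^sup>+ w. \<psi> k (w k) \<partial>B.P) = (if k \<in> J' then emeasure (Q k) (E k) else 1)"
      using factor[OF k] B.distr_coordinate[OF T[OF k]] by simp
  qed
  also have "\<dots> = (\<Prod>k\<in>J'. emeasure (Q k) (E k))"
    using J J' by (intro prod.mono_neutral_cong_right) auto
  also have "\<dots> = emeasure (Pi\<^sub>M {1..} Q) ?X"
    using A.prob_Q J' E by (intro emeasure_PiM_emb[symmetric]) auto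
  finally show "emeasure (Pi\<^sub>M {1..} Q) ?X = emeasure (density (Pi\<^sub>M {1..} Q0) (\<lambda>w. \<Prod>k\<in>J. \<phi> k (w k))) ?X"
    by (simp only: B.P_def)
qed

context anomaly_model
begin

definition "null_seq = Pi\<^sub>M {1::nat..} (\<lambda>_. P0)"

lemma null_prob_eq: "null_prob g L = null_seq"
  by (simp add: null_prob_def null_seq_def P0_def)

text \<open>After the window the law returns to the null law, which keeps the change of measure
  finite. An event decided by the end of the window does not notice this.\<close>

definition "window_law \<nu> t Q k = (if \<nu> \<le> k \<and> k < \<nu> + t then Q k else P0)"

lemma indep_coordinates_window:
  assumes "\<And>k. \<nu> \<le> k \<Longrightarrow> prob_space (Q k) \<and> sets (Q k) = sets (obs_space L)"
  shows "indep_coordinates (window_law \<nu> t Q) L"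
  using assms prob_P0 by (intro indep_coordinates.intro) (auto simp: window_law_def)

lemma emeasure_window:
  assumes \<nu>: "1 \<le> \<nu>" and Q: "\<And>k. \<nu> \<le> k \<Longrightarrow> prob_space (Q k) \<and> sets (Q k) = sets (obs_space L)"
    and \<phi>: "\<And>k. \<nu> \<le> k \<Longrightarrow> \<phi> k \<in> borel_measurable (obs_space L)" "\<And>k. \<nu> \<le> k \<Longrightarrow> Q k = density P0 (\<phi> k)"
    and X: "X \<in> sets (seq_space L)"
  shows "emeasure (Pi\<^sub>M {1..} (window_law \<nu> t Q)) X = (\<integral>\<^sup>+ w. (\<Prod>k\<in>{\<nu>..<\<nu> + t}. \<phi> k (w k)) * indicator X w \<partial>null_seq)"
proof -
  interpret B: indep_coordinates "\<lambda>_. P0" L by (rule indep_coordinates_null)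
  have P: "null_seq = B.P" by (simp add: null_seq_def B.P_def)
  have "(\<lambda>w. \<Prod>k\<in>{\<nu>..<\<nu> + t}. \<phi> k (w k)) \<in> borel_measurable B.P"
  proof (rule borel_measurable_prod_ennreal)
    fix k assume "k \<in> {\<nu>..<\<nu> + t}"
    then show "(\<lambda>w. \<phi> k (w k)) \<in> borel_measurable B.P"
      using \<nu> by (intro measurable_compose[OF B.coordinate_meas \<phi>(1)]) auto
  qed
  moreover have D: "Pi\<^sub>M {1..} (window_law \<nu> t Q) = density B.P (\<lambda>w. \<Prod>k\<in>{\<nu>..<\<nu> + t}. \<phi> k (w k))"
    unfolding B.P_def using \<nu> \<phi> by (intro PiM_density[OF indep_coordinates_window[OF Q] indep_coordinates_null]) (auto simp: window_law_def)
  ultimately show ?thesis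
    unfolding D P using X B.sets_P by (intro emeasure_density) auto
qed

lemma mix_ratio_sum:
  "ennreal (mix i x / null x) = (\<Sum>A\<in>subsets i. ennreal (1 / real (card (subsets i))) * ennreal (anom A x / null x))"
proof -
  have "mix i x / null x = (\<Sum>A\<in>subsets i. 1 / real (card (subsets i)) * (anom A x / null x))"
    by (simp add: mix_eq sum_divide_distrib[symmetric] sum_distrib_left[symmetric] mult.commute)
  then show ?thesis
    using anom_nonneg null_nonneg by (simp add: sum_ennreal ennreal_mult[symmetric])
qed

text \<open>Multiplying out the product of the mixture densities, the law of the window with the mixtures is
  the average of its laws over all choices \<open>\<sigma>\<close> of anomalous sets.\<close>

lemma ex_window_le_mixture:
  assumes \<nu>: "1 \<le> \<nu>" and p: "\<And>k. \<nu> \<le> k \<Longrightarrow> p k \<in> {1..N}" and X: "X \<in> sets (seq_space L)"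
  obtains \<sigma> where "\<And>k. \<nu> \<le> k \<Longrightarrow> \<sigma> k \<in> subsets (p k)"
    "measure (Pi\<^sub>M {1..} (window_law \<nu> t (\<lambda>k. PA (\<sigma> k)))) X \<le> measure (Pi\<^sub>M {1..} (window_law \<nu> t (\<lambda>k. PM (p k)))) X"
proof -
  let ?J = "{\<nu>..<\<nu> + t}"
  let ?\<Sigma> = "Pi\<^sub>E ?J (\<lambda>k. subsets (p k))"
  \<comment> \<open>A choice is made on the window only; outside it any admissible set completes the
    assignment.\<close>
  define ext where "ext \<sigma> k = (if k \<in> ?J then \<sigma> k else (SOME A. A \<in> subsets (p k)))" for \<sigma> k
  have ext: "ext \<sigma> k \<in> subsets (p k)" if "\<sigma> \<in> ?\<Sigma>" "\<nu> \<le> k" for \<sigma> k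
    using that subsets_nonempty[OF p[OF that(2)]] by (auto simp: ext_def PiE_iff some_in_eq)
  have laws: "prob_space (PA (ext \<sigma> k)) \<and> sets (PA (ext \<sigma> k)) = sets (obs_space L)"
    "ext \<sigma> k \<subseteq> {1..L}" "PA (ext \<sigma> k) = density P0 (\<lambda>x. ennreal (anom (ext \<sigma> k) x / null x))"
    if "\<sigma> \<in> ?\<Sigma>" "\<nu> \<le> k" for \<sigma> k
  proof -
    show sub: "ext \<sigma> k \<subseteq> {1..L}" using ext[OF that] by (simp add: subsets_def)
    show "prob_space (PA (ext \<sigma> k)) \<and> sets (PA (ext \<sigma> k)) = sets (obs_space L)"
      using prob_PA[OF sub] by simp
    show "PA (ext \<sigma> k) = density P0 (\<lambda>x. ennreal (anom (ext \<sigma> k) x / null x))"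
      by (rule PA_density[OF p[OF that(2)] ext[OF that]])
  qed
  define C where "C = (\<Prod>k\<in>?J. 1 / real (card (subsets (p k))))"
  have card_pos: "0 < card (subsets (p k))" if "k \<in> ?J" for k using card_subsets_pos[OF p] that by auto
  have C: "0 < C" unfolding C_def using card_pos by (intro prod_pos) auto
  have fin: "finite ?\<Sigma>" using finite_subsets by (intro finite_PiE) auto
  have cardC: "C * real (card ?\<Sigma>) = 1"
  proof -
    have "C * real (card ?\<Sigma>) = (\<Prod>k\<in>?J. 1 / real (card (subsets (p k))) * real (card (subsets (p k))))"
    proof -
      have "real (card ?\<Sigma>) = (\<Prod>k\<in>?J. real (card (subsets (p k))))" by (simp add: card_PiE)
      then show ?thesis unfolding C_def by (simp only: prod.distrib)
    qed
    also have "\<dots> = 1" using card_pos by (intro prod.neutral) auto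
    finally show ?thesis .
  qed
  let ?PM = "Pi\<^sub>M {1..} (window_law \<nu> t (\<lambda>k. PM (p k)))" and ?PA = "\<lambda>\<sigma>. Pi\<^sub>M {1..} (window_law \<nu> t (\<lambda>k. PA (ext \<sigma> k)))"
  interpret B: indep_coordinates "\<lambda>_. P0" L by (rule indep_coordinates_null)
  have P: "null_seq = B.P" by (simp add: null_seq_def B.P_def)
  have ratio_meas: "(\<lambda>w. \<Prod>k\<in>?J. ennreal (anom (\<sigma> k) (w k) / null (w k))) \<in> borel_measurable B.P" if "\<sigma> \<in> ?\<Sigma>" for \<sigma>
  proof (rule borel_measurable_prod_ennreal)
    fix k assume k: "k \<in> ?J"
    then have "\<sigma> k \<subseteq> {1..L}" using that by (auto simp: PiE_iff subsets_def)
    then have "(\<lambda>x. ennreal (anom (\<sigma> k) x / null x)) \<in> borel_measurable (obs_space L)" by measurable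
    then show "(\<lambda>w. ennreal (anom (\<sigma> k) (w k) / null (w k))) \<in> borel_measurable B.P"
      using k \<nu> by (intro measurable_compose[OF B.coordinate_meas]) auto
  qed
  have "emeasure ?PM X = (\<integral>\<^sup>+ w. (\<Prod>k\<in>?J. ennreal (mix (p k) (w k) / null (w k))) * indicator X w \<partial>null_seq)"
    using \<nu> X p prob_PM PM_density by (intro emeasure_window) auto
  also have "\<dots> = (\<integral>\<^sup>+ w. (\<Sum>\<sigma>\<in>?\<Sigma>. ennreal C * ((\<Prod>k\<in>?J. ennreal (anom (\<sigma> k) (w k) / null (w k))) * indicator X w)) \<partial>null_seq)"
  proof (rule nn_integral_cong)
    fix w
    have "(\<Prod>k\<in>?J. ennreal (mix (p k) (w k) / null (w k)))
        = (\<Sum>\<sigma>\<in>?\<Sigma>. \<Prod>k\<in>?J. ennreal (1 / real (card (subsets (p k)))) * ennreal (anom (\<sigma> k) (w k) / null (w k)))"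
      unfolding mix_ratio_sum using finite_subsets by (intro prod_sum_PiE) auto
    also have "\<dots> = (\<Sum>\<sigma>\<in>?\<Sigma>. ennreal C * (\<Prod>k\<in>?J. ennreal (anom (\<sigma> k) (w k) / null (w k))))"
      unfolding C_def by (simp add: prod.distrib prod_ennreal)
    finally show "(\<Prod>k\<in>?J. ennreal (mix (p k) (w k) / null (w k))) * indicator X w
      = (\<Sum>\<sigma>\<in>?\<Sigma>. ennreal C * ((\<Prod>k\<in>?J. ennreal (anom (\<sigma> k) (w k) / null (w k))) * indicator X w))"
      by (simp add: sum_distrib_right mult.assoc)
  qed
  also have "\<dots> = (\<Sum>\<sigma>\<in>?\<Sigma>. ennreal C * (\<integral>\<^sup>+ w. (\<Prod>k\<in>?J. ennreal (anom (\<sigma> k) (w k) / null (w k))) * indicator X w \<partial>null_seq))"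
  proof -
    have m: "(\<lambda>w. (\<Prod>k\<in>?J. ennreal (anom (\<sigma> k) (w k) / null (w k))) * indicator X w) \<in> borel_measurable null_seq" if "\<sigma> \<in> ?\<Sigma>" for \<sigma>
      unfolding P using ratio_meas[OF that] X B.sets_P by (intro borel_measurable_times_ennreal) auto
    then show ?thesis by (subst nn_integral_sum) (auto simp: nn_integral_cmult)
  qed
  also have "\<dots> = (\<Sum>\<sigma>\<in>?\<Sigma>. ennreal C * emeasure (?PA \<sigma>) X)"
  proof (rule sum.cong[OF refl])
    fix \<sigma> assume \<sigma>: "\<sigma> \<in> ?\<Sigma>"
    have "emeasure (?PA \<sigma>) X = (\<integral>\<^sup>+ w. (\<Prod>k\<in>?J. ennreal (anom (ext \<sigma> k) (w k) / null (w k))) * indicator X w \<partial>null_seq)"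
      using \<nu> X laws[OF \<sigma>] by (intro emeasure_window) auto
    also have "\<dots> = (\<integral>\<^sup>+ w. (\<Prod>k\<in>?J. ennreal (anom (\<sigma> k) (w k) / null (w k))) * indicator X w \<partial>null_seq)"
      by (intro nn_integral_cong arg_cong2[where f="(*)"] prod.cong refl) (simp add: ext_def)
    finally show "ennreal C * (\<integral>\<^sup>+ w. (\<Prod>k\<in>?J. ennreal (anom (\<sigma> k) (w k) / null (w k))) * indicator X w \<partial>null_seq) = ennreal C * emeasure (?PA \<sigma>) X"
      by simp
  qed
  finally have avg: "emeasure ?PM X = (\<Sum>\<sigma>\<in>?\<Sigma>. ennreal C * emeasure (?PA \<sigma>) X)" .
  have em: "emeasure ?PM X = ennreal (measure ?PM X)"
  proof -
    interpret W: indep_coordinates "window_law \<nu> t (\<lambda>k. PM (p k))" L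
      using p prob_PM by (intro indep_coordinates_window) auto
    show ?thesis using prob_space.finite_measure[OF W.prob_P] unfolding W.P_def by (rule finite_measure.emeasure_eq_measure)
  qed
  have ea: "emeasure (?PA \<sigma>) X = ennreal (measure (?PA \<sigma>) X)" if "\<sigma> \<in> ?\<Sigma>" for \<sigma>
  proof -
    interpret W: indep_coordinates "window_law \<nu> t (\<lambda>k. PA (ext \<sigma> k))" L
      using laws[OF that] by (intro indep_coordinates_window) auto
    show ?thesis using prob_space.finite_measure[OF W.prob_P] unfolding W.P_def by (rule finite_measure.emeasure_eq_measure)
  qed
  have "ennreal (measure ?PM X) = (\<Sum>\<sigma>\<in>?\<Sigma>. ennreal (C * measure (?PA \<sigma>) X))"
    unfolding em[symmetric] avg
  proof (rule sum.cong[OF refl])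
    fix \<sigma> assume \<sigma>: "\<sigma> \<in> ?\<Sigma>"
    show "ennreal C * emeasure (?PA \<sigma>) X = ennreal (C * measure (?PA \<sigma>) X)"
      unfolding ea[OF \<sigma>] using C by (intro ennreal_mult[symmetric]) auto
  qed
  also have "\<dots> = ennreal (\<Sum>\<sigma>\<in>?\<Sigma>. C * measure (?PA \<sigma>) X)"
    using C by (intro sum_ennreal) auto
  finally have "ennreal (measure ?PM X) = ennreal (\<Sum>\<sigma>\<in>?\<Sigma>. C * measure (?PA \<sigma>) X)" .
  then have avg': "measure ?PM X = (\<Sum>\<sigma>\<in>?\<Sigma>. C * measure (?PA \<sigma>) X)"
    using C by (subst (asm) ennreal_inj) (auto intro!: sum_nonneg mult_nonneg_nonneg)
  \<comment> \<open>An average is at least its smallest term. This is where a deterministic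
    trajectory is selected.\<close>
  have "\<exists>\<sigma>\<in>?\<Sigma>. measure (?PA \<sigma>) X \<le> measure ?PM X"
  proof (rule ccontr)
    assume neg: "\<not> ?thesis"
    have "measure ?PM X = (\<Sum>\<sigma>\<in>?\<Sigma>. C * measure ?PM X)"
      using cardC by (simp add: mult.assoc[symmetric] mult.commute)
    also have "\<dots> < (\<Sum>\<sigma>\<in>?\<Sigma>. C * measure (?PA \<sigma>) X)"
    proof (rule sum_strict_mono[OF fin])
      show "?\<Sigma> \<noteq> {}" using cardC by (intro notI) simp
    qed (use neg C in \<open>auto simp: not_le\<close>)
    finally show False using avg' by simp
  qed
  then obtain \<sigma> where "\<sigma> \<in> ?\<Sigma>" "measure (?PA \<sigma>) X \<le> measure ?PM X" by blast
  then show thesis using ext by (intro that[of "ext \<sigma>"]) auto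
qed

text \<open>Only an inequality: where a density vanishes, \<open>Z\<close> is 0 while the quotient
  is 0. It suffices for bounding a likelihood ratio from above.\<close>

lemma ratio_le_exp_Z: "mix i x / null x \<le> exp (Z i x)"
proof (cases "0 < mix i x \<and> 0 < null x")
  case True
  then show ?thesis by (simp add: Z_pos)
next
  case False
  then have "mix i x / null x = 0" using mix_nonneg[of i x] null_nonneg[of x] by auto
  then show ?thesis by (simp only: exp_ge_zero)
qed

lemma obs_filtration_mono: "s \<le> t \<Longrightarrow> sets (obs_filtration L s) \<subseteq> sets (obs_filtration L t)"
proof -
  assume st: "s \<le> t"
  have sub: "(\<Union>k\<in>{k. 1 \<le> k \<and> enat k \<le> r}. {(\<lambda>w. w k) -` B \<inter> space (seq_space L) |B. B \<in> sets (obs_space L)})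
    \<subseteq> Pow (space (seq_space L))" for r by auto
  have "sets (obs_filtration L r) = sigma_sets (space (seq_space L))
    (\<Union>k\<in>{k. 1 \<le> k \<and> enat k \<le> r}. {(\<lambda>w. w k) -` B \<inter> space (seq_space L) |B. B \<in> sets (obs_space L)})" for r
    unfolding obs_filtration_def by (rule sets_measure_of[OF sub])
  then show ?thesis
    using st by (simp only:) (rule sigma_sets_mono', auto intro: order_trans)
qed

text \<open>Under the mixtures, \<open>?G\<close> is split by the deviation event. Off that event
  the likelihood ratio is at most the exponential in \<open>rare\<close>, so the cheap null
  probability of \<open>?G\<close> stays small. The deviation event itself is independent of
  \<open>?E\<close>, which lies in the past and has its null probability under every law involved.
  Each of the two parts costs at most \<open>\<epsilon>\<close> times the probability of
  \<open>?E\<close>.\<close>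

lemma ex_late_trajectory:
  assumes \<tau>: "stopping_time (obs_filtration L) \<tau>" and \<nu>: "1 \<le> \<nu>" and \<epsilon>: "0 \<le> \<epsilon>"
    and dev: "deviation_bound \<delta> \<epsilon> t"
    and rare: "measure null_seq {w \<in> space (seq_space L). enat \<nu> \<le> \<tau> w \<and> \<tau> w < enat (\<nu> + t)} * exp ((\<Sum>u<t. I (phase d u)) + \<delta> * real t)
      \<le> \<epsilon> * measure null_seq {w \<in> space (seq_space L). enat \<nu> \<le> \<tau> w}"
  obtains S where "S \<in> trajectories L m n"
    "measure (anomaly_prob g f L m n \<nu> d S) {w \<in> space (seq_space L). enat \<nu> \<le> \<tau> w} = measure null_seq {w \<in> space (seq_space L). enat \<nu> \<le> \<tau> w}"
    "measure (anomaly_prob g f L m n \<nu> d S) {w \<in> space (seq_space L). enat \<nu> \<le> \<tau> w \<and> \<tau> w < enat (\<nu> + t)}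
      \<le> 2 * \<epsilon> * measure null_seq {w \<in> space (seq_space L). enat \<nu> \<le> \<tau> w}"
proof -
  let ?E = "{w \<in> space (seq_space L). enat \<nu> \<le> \<tau> w}"
  let ?G = "{w \<in> space (seq_space L). enat \<nu> \<le> \<tau> w \<and> \<tau> w < enat (\<nu> + t)}"
  define p where "p k = phase d (k - \<nu>)" for k
  define a where "a = (\<Sum>u<t. I (phase d u)) + \<delta> * real t"
  let ?Dev = "{w \<in> space (seq_space L). \<delta> * real t < \<bar>\<Sum>u<t. Z (phase d u) (w (\<nu> - 1 + u + 1)) - I (phase d u)\<bar>}"
  have E_F: "?E \<in> sets (obs_filtration L (enat (\<nu> - 1)))" by (rule stopping_time_ge_sets[OF \<tau> \<nu>])
  have E_block: "block_event L {1..\<nu> - 1} ?E" by (rule obs_filtration_block_event[OF E_F])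
  \<comment> \<open>Stopping inside the window is decided by time \<open>\<nu> + t - 1\<close>, so
    the anomaly law may later replace the window law, from which it differs only afterwards.\<close>
  have G_block: "block_event L {1..\<nu> + t - 1} ?G"
  proof (rule obs_filtration_block_event)
    have "?E \<in> sets (obs_filtration L (enat (\<nu> + t - 1)))"
      by (rule subsetD[OF obs_filtration_mono E_F]) simp
    moreover have "{w \<in> space (seq_space L). enat (\<nu> + t) \<le> \<tau> w} \<in> sets (obs_filtration L (enat (\<nu> + t - 1)))"
      using \<nu> by (intro stopping_time_ge_sets[OF \<tau>]) simp
    ultimately have "?E - {w \<in> space (seq_space L). enat (\<nu> + t) \<le> \<tau> w} \<in> sets (obs_filtration L (enat (\<nu> + t - 1)))"
      by (rule sets.Diff)
    moreover have "?E - {w \<in> space (seq_space L). enat (\<nu> + t) \<le> \<tau> w} = ?G" by (auto simp: not_le)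
    ultimately show "?G \<in> sets (obs_filtration L (enat (\<nu> + t - 1)))" by simp
  qed
  have Dev_block: "block_event L {\<nu> - 1 + 1..\<nu> - 1 + t} ?Dev" by (rule block_event_deviation)
  have sets: "?E \<in> sets (seq_space L)" "?G \<in> sets (seq_space L)" "?Dev \<in> sets (seq_space L)"
    using block_event_sets[OF _ E_block] block_event_sets[OF _ G_block] block_event_sets[OF _ Dev_block] by auto
  have laws: "prob_space (PM (p k)) \<and> sets (PM (p k)) = sets (obs_space L)" for k
    using prob_PM[OF phase_range] by (simp add: p_def)
  let ?W = "window_law \<nu> t (\<lambda>k. PM (p k))"
  have W: "indep_coordinates ?W L" by (rule indep_coordinates_window[OF laws])
  then interpret W: indep_coordinates ?W L .
  interpret prob_space W.P by (rule W.prob_P)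
  have null_E: "measure (Pi\<^sub>M {1..} Q) ?E = measure null_seq ?E"
    if "indep_coordinates Q L" "\<And>k. k \<in> {1..\<nu> - 1} \<Longrightarrow> Q k = P0" for Q
    unfolding null_seq_def using that E_block
    by (intro block_event_measure_cong[OF _ indep_coordinates_null]) auto
  have W_E: "prob ?E = measure null_seq ?E"
    unfolding W.P_def by (rule null_E[OF W]) (auto simp: window_law_def)
  have "prob (?E \<inter> ?Dev) = prob ?E * prob ?Dev"
  proof -
    let ?K = "\<lambda>b. if b then {1..\<nu> - 1} else {\<nu> - 1 + 1..\<nu> - 1 + t}" and ?A = "\<lambda>b. if b then ?E else ?Dev"
    have "prob (\<Inter>b\<in>UNIV. ?A b) = (\<Prod>b\<in>UNIV. prob (?A b))"
      using E_block Dev_block by (intro W.block_prob[of UNIV ?K]) (auto simp: disjoint_family_on_def)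
    then show ?thesis by (simp add: UNIV_bool Int_commute mult.commute)
  qed
  also have "\<dots> \<le> measure null_seq ?E * \<epsilon>"
    unfolding W_E
  proof (rule mult_left_mono)
    show "prob ?Dev \<le> \<epsilon>"
      unfolding W.P_def
    proof (rule deviation_boundD[OF dev W])
      fix u assume "u < t"
      then have "?W (\<nu> - 1 + u + 1) = PM (phase d u)" using \<nu> by (simp add: window_law_def p_def)
      then show "phase d u \<in> {1..N} \<and> distr (?W (\<nu> - 1 + u + 1)) borel (Z (phase d u)) = law (phase d u)"
        using phase_range by (simp add: law_def)
    qed
  qed simp
  finally have E_Dev: "prob (?E \<inter> ?Dev) \<le> \<epsilon> * measure null_seq ?E" by (simp add: mult.commute)
  have "emeasure W.P (?G - ?Dev) = (\<integral>\<^sup>+ w. (\<Prod>k\<in>{\<nu>..<\<nu> + t}. ennreal (mix (p k) (w k) / null (w k))) * indicator (?G - ?Dev) w \<partial>null_seq)"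
    unfolding W.P_def using laws sets PM_density[OF phase_range] by (intro emeasure_window[OF \<nu>]) (auto simp: p_def)
  also have "\<dots> \<le> (\<integral>\<^sup>+ w. ennreal (exp a) * indicator ?G w \<partial>null_seq)"
  proof (rule nn_integral_mono)
    fix w
    show "(\<Prod>k\<in>{\<nu>..<\<nu> + t}. ennreal (mix (p k) (w k) / null (w k))) * indicator (?G - ?Dev) w \<le> ennreal (exp a) * indicator ?G w"
    proof (cases "w \<in> ?G - ?Dev")
      case True
      have "(\<Prod>k\<in>{\<nu>..<\<nu> + t}. ennreal (mix (p k) (w k) / null (w k))) \<le> (\<Prod>k\<in>{\<nu>..<\<nu> + t}. ennreal (exp (Z (p k) (w k))))"
        using mix_nonneg null_nonneg
        by (simp add: prod_ennreal) (intro ennreal_leI prod_mono conjI ratio_le_exp_Z divide_nonneg_nonneg)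
      also have "\<dots> = ennreal (exp (\<Sum>k\<in>{\<nu>..<\<nu> + t}. Z (p k) (w k)))"
        by (simp add: prod_ennreal exp_sum)
      also have "(\<Sum>k\<in>{\<nu>..<\<nu> + t}. Z (p k) (w k)) = (\<Sum>u<t. Z (phase d u) (w (\<nu> - 1 + u + 1)))"
        using \<nu> by (intro sum.reindex_bij_witness[of _ "\<lambda>u. \<nu> + u" "\<lambda>k. k - \<nu>"]) (auto simp: p_def)
      also have "ennreal (exp (\<Sum>u<t. Z (phase d u) (w (\<nu> - 1 + u + 1)))) \<le> ennreal (exp a)"
      proof -
        have "\<bar>\<Sum>u<t. Z (phase d u) (w (\<nu> - 1 + u + 1)) - I (phase d u)\<bar> \<le> \<delta> * real t" using True by auto
        then show ?thesis by (simp add: a_def sum_subtractf)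
      qed
      finally show ?thesis using True by simp
    qed simp
  qed
  also have "\<dots> = ennreal (exp a) * emeasure null_seq ?G"
  proof (rule nn_integral_cmult_indicator)
    interpret B: indep_coordinates "\<lambda>_. P0" L by (rule indep_coordinates_null)
    show "?G \<in> sets null_seq" using sets B.sets_P by (simp add: null_seq_def B.P_def)
  qed
  finally have "emeasure W.P (?G - ?Dev) \<le> ennreal (exp a * measure null_seq ?G)"
  proof -
    interpret B: indep_coordinates "\<lambda>_. P0" L by (rule indep_coordinates_null)
    interpret B: prob_space null_seq using B.prob_P by (simp add: null_seq_def B.P_def)
    assume "emeasure W.P (?G - ?Dev) \<le> ennreal (exp a) * emeasure null_seq ?G"
    then show ?thesis by (simp add: B.emeasure_eq_measure ennreal_mult)
  qed
  then have nodev: "prob (?G - ?Dev) \<le> exp a * measure null_seq ?G"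
    by (simp add: emeasure_eq_measure)
  have "prob ?G \<le> prob ((?E \<inter> ?Dev) \<union> (?G - ?Dev))"
    using sets W.sets_P by (intro finite_measure_mono) auto
  also have "\<dots> \<le> prob (?E \<inter> ?Dev) + prob (?G - ?Dev)"
    using sets W.sets_P by (intro measure_Un_le) auto
  also have "\<dots> \<le> 2 * \<epsilon> * measure null_seq ?E"
    using E_Dev nodev rare unfolding a_def[symmetric] by (simp add: mult.commute)
  finally have PM_G: "measure (Pi\<^sub>M {1..} ?W) ?G \<le> 2 * \<epsilon> * measure null_seq ?E" by (simp only: W.P_def)
  obtain \<sigma> where \<sigma>: "\<And>k. \<nu> \<le> k \<Longrightarrow> \<sigma> k \<in> subsets (p k)"
    "measure (Pi\<^sub>M {1..} (window_law \<nu> t (\<lambda>k. PA (\<sigma> k)))) ?G \<le> measure (Pi\<^sub>M {1..} ?W) ?G"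
    using ex_window_le_mixture[OF \<nu>, of p ?G t] phase_range sets(2) by (auto simp: p_def)
  \<comment> \<open>A trajectory must name sets for all phases and times. Those that occur in the
    window are the selected \<open>\<sigma>\<close>, and arbitrary sets of the right size fill the
    rest.\<close>
  define S where "S i k = (if \<nu> \<le> k \<and> i = p k then \<sigma> k else (SOME A. A \<in> subsets i))" for i k
  have "S i k \<in> subsets i" if "i \<in> {1..N}" for i k
    using \<sigma>(1) subsets_nonempty[OF that] by (auto simp: S_def some_in_eq)
  then have S: "S \<in> trajectories L m n"
    by (auto simp: trajectories_def subsets_def N_def)
  have IS: "indep_coordinates (coordinate_law \<nu> d S) L" by (rule indep_coordinates_anomaly[OF S])
  have p_eq: "phase_at m n \<nu> d k = p k" if "\<nu> \<le> k" for k
    using phase_at_shift[of \<nu> d "k - \<nu>"] that by (simp add: p_def)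
  show thesis
  proof (rule that[OF S])
    show "measure (anomaly_prob g f L m n \<nu> d S) ?E = measure null_seq ?E"
      unfolding anomaly_prob_eq using coordinate_law_before[of _ \<nu>] by (intro null_E[OF IS]) auto
    have "measure (anomaly_prob g f L m n \<nu> d S) ?G = measure (Pi\<^sub>M {1..} (window_law \<nu> t (\<lambda>k. PA (\<sigma> k)))) ?G"
      unfolding anomaly_prob_eq
    proof (rule block_event_measure_cong[OF IS _ _ _ G_block])
      show "indep_coordinates (window_law \<nu> t (\<lambda>k. PA (\<sigma> k))) L"
        using \<sigma>(1) prob_PA by (intro indep_coordinates_window) (auto simp: subsets_def)
      fix k assume "k \<in> {1..\<nu> + t - 1}"
      then show "coordinate_law \<nu> d S k = window_law \<nu> t (\<lambda>k. PA (\<sigma> k)) k"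
        by (cases "k < \<nu>") (auto simp: coordinate_law_before coordinate_law_after window_law_def p_eq S_def)
    qed auto
    then show "measure (anomaly_prob g f L m n \<nu> d S) ?G \<le> 2 * \<epsilon> * measure null_seq ?E"
      using \<sigma>(2) PM_G by simp
  qed
qed

text \<open>The changepoint is chosen after \<open>\<tau>\<close>, and the trajectory after both;
  this is legitimate because the delay takes the supremum over changepoints and
  trajectories.\<close>

lemma WADD_ge:
  fixes t :: nat and \<epsilon> \<delta> \<gamma> :: real
  assumes \<tau>: "\<tau> \<in> false_alarm_class g L \<gamma>" and \<gamma>: "0 < \<gamma>" and t: "1 \<le> t" "2 * real t \<le> \<gamma>" and \<epsilon>: "0 \<le> \<epsilon>" "2 * \<epsilon> \<le> 1"
    and dev: "deviation_bound \<delta> \<epsilon> t"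
    and rare: "2 * real t / \<gamma> * exp ((\<Sum>u<t. I (phase d u)) + \<delta> * real t) \<le> \<epsilon>"
  shows "ennreal ((1 - 2 * \<epsilon>) * real (t + 1)) \<le> WADD g f L m n d \<tau>"
proof -
  interpret B: indep_coordinates "\<lambda>_. P0" L by (rule indep_coordinates_null)
  have P: "null_seq = B.P" by (simp add: null_seq_def B.P_def)
  have st: "stopping_time (obs_filtration L) \<tau>" and mean: "ennreal \<gamma> \<le> (\<integral>\<^sup>+ w. ennreal_of_enat (\<tau> w) \<partial>B.P)"
    using \<tau> by (auto simp: false_alarm_class_def null_expectation_def null_prob_eq P)
  obtain \<nu> where \<nu>: "1 \<le> \<nu>" "0 < measure B.P {w \<in> space B.P. enat \<nu> \<le> \<tau> w}"
    "measure B.P {w \<in> space B.P. enat \<nu> \<le> \<tau> w \<and> \<tau> w < enat (\<nu> + t)} \<le> 2 * real t / \<gamma> * measure B.P {w \<in> space B.P. enat \<nu> \<le> \<tau> w}"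
    by (rule ex_rare_window[OF B.prob_P stopping_time_meas[OF st B.sets_P] mean \<gamma> t])
  let ?E = "{w \<in> space (seq_space L). enat \<nu> \<le> \<tau> w}"
  let ?G = "{w \<in> space (seq_space L). enat \<nu> \<le> \<tau> w \<and> \<tau> w < enat (\<nu> + t)}"
  let ?a = "(\<Sum>u<t. I (phase d u)) + \<delta> * real t"
  have "measure null_seq ?G * exp ?a \<le> 2 * real t / \<gamma> * measure null_seq ?E * exp ?a"
    using \<nu>(3) unfolding P B.space_P by (rule mult_right_mono) simp
  also have "\<dots> = 2 * real t / \<gamma> * exp ?a * measure null_seq ?E" by (simp only: mult_ac)
  also have "\<dots> \<le> \<epsilon> * measure null_seq ?E" by (rule mult_right_mono[OF rare]) simp
  finally have rare': "measure null_seq ?G * exp ?a \<le> \<epsilon> * measure null_seq ?E" .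
  obtain S where S: "S \<in> trajectories L m n"
    "measure (anomaly_prob g f L m n \<nu> d S) ?E = measure null_seq ?E"
    "measure (anomaly_prob g f L m n \<nu> d S) ?G \<le> 2 * \<epsilon> * measure null_seq ?E"
    by (rule ex_late_trajectory[OF st \<nu>(1) \<epsilon>(1) dev rare'])
  interpret A: indep_coordinates "coordinate_law \<nu> d S" L by (rule indep_coordinates_anomaly[OF S(1)])
  have PA: "anomaly_prob g f L m n \<nu> d S = A.P" by (simp add: anomaly_prob_eq A.P_def)
  interpret prob_space A.P by (rule A.prob_P)
  have \<tau>m [measurable]: "\<tau> \<in> borel_measurable A.P" by (rule stopping_time_meas[OF st A.sets_P])
  have Em [measurable]: "{w \<in> space A.P. enat \<nu> \<le> \<tau> w} \<in> sets A.P" by measurable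
  have "prob {w \<in> space A.P. enat \<nu> \<le> \<tau> w}
    = prob {w \<in> space A.P. enat (\<nu> + t) \<le> \<tau> w} + prob {w \<in> space A.P. enat \<nu> \<le> \<tau> w \<and> \<tau> w < enat (\<nu> + t)}"
  proof (subst finite_measure_Union[symmetric])
    have "enat (\<nu> + t) \<le> y \<Longrightarrow> enat \<nu> \<le> y" for y by (cases y) auto
    then show "prob {w \<in> space A.P. enat \<nu> \<le> \<tau> w}
      = prob ({w \<in> space A.P. enat (\<nu> + t) \<le> \<tau> w} \<union> {w \<in> space A.P. enat \<nu> \<le> \<tau> w \<and> \<tau> w < enat (\<nu> + t)})"
      by (intro arg_cong[where f=prob]) (auto simp: not_le)
  qed (auto simp: not_le)
  then have late: "(1 - 2 * \<epsilon>) * prob {w \<in> space A.P. enat \<nu> \<le> \<tau> w} \<le> prob {w \<in> space A.P. enat (\<nu> + t) \<le> \<tau> w}"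
    using S(2,3) unfolding PA A.space_P[symmetric] by (simp add: algebra_simps)
  have "ennreal ((1 - 2 * \<epsilon>) * real (t + 1)) \<le> worst_history_delay A.P L \<tau> \<nu>"
  proof (rule worst_history_delay_ge[OF A.prob_P A.sets_P \<tau>m Em _ _ late])
    show "0 < prob {w \<in> space A.P. enat \<nu> \<le> \<tau> w}"
      using \<nu>(2) S(2) unfolding PA A.space_P B.space_P P by simp
    show "0 \<le> 1 - 2 * \<epsilon>" using \<epsilon> by simp
  qed
  also have "\<dots> \<le> WADD g f L m n d \<tau>"
    unfolding WADD_def PA[symmetric] using S(1) \<nu>(1) by (intro SUP_upper2[of S] SUP_upper) auto
  finally show ?thesis .
qed

end

section \<open>First-order asymptotics\<close>

lemma tendsto_nat_floor_mult_ln: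
  assumes "0 \<le> y"
  shows "((\<lambda>\<gamma>. real (nat \<lfloor>y * ln \<gamma>\<rfloor>) / ln \<gamma>) \<longlongrightarrow> y) at_top"
proof (rule tendsto_sandwich)
  have "((\<lambda>\<gamma>::real. inverse (ln \<gamma>)) \<longlongrightarrow> 0) at_top"
    by (rule tendsto_inverse_0_at_top[OF ln_at_top])
  then have "((\<lambda>\<gamma>. y - inverse (ln \<gamma>)) \<longlongrightarrow> y - 0) at_top" by (intro tendsto_intros)
  then show "((\<lambda>\<gamma>. y - inverse (ln \<gamma>)) \<longlongrightarrow> y) at_top" by simp
  show "((\<lambda>\<gamma>::real. y) \<longlongrightarrow> y) at_top" by simp
  have pos: "\<forall>\<^sub>F \<gamma> in at_top. 0 < ln (\<gamma>::real)"
    using ln_at_top by (rule filterlim_at_top_dense[THEN iffD1, rule_format])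
  show "\<forall>\<^sub>F \<gamma> in at_top. y - inverse (ln \<gamma>) \<le> real (nat \<lfloor>y * ln \<gamma>\<rfloor>) / ln \<gamma>"
    using pos
  proof eventually_elim
    case (elim \<gamma>)
    have "y * ln \<gamma> - 1 \<le> real (nat \<lfloor>y * ln \<gamma>\<rfloor>)" using elim assms by linarith
    then have "(y * ln \<gamma> - 1) / ln \<gamma> \<le> real (nat \<lfloor>y * ln \<gamma>\<rfloor>) / ln \<gamma>"
      using elim by (intro divide_right_mono) auto
    then show ?case using elim by (simp add: diff_divide_distrib inverse_eq_divide)
  qed
  show "\<forall>\<^sub>F \<gamma> in at_top. real (nat \<lfloor>y * ln \<gamma>\<rfloor>) / ln \<gamma> \<le> y"
    using pos
  proof eventually_elim
    case (elim \<gamma>)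
    have "0 \<le> y * ln \<gamma>" using elim assms by simp
    then have "real (nat \<lfloor>y * ln \<gamma>\<rfloor>) \<le> y * ln \<gamma>" by simp
    then show ?case using elim by (simp add: field_simps)
  qed
qed

lemma eventually_ln_pos: "\<forall>\<^sub>F \<gamma> in at_top. 0 < ln (\<gamma>::real)"
  using ln_at_top by (rule filterlim_at_top_dense[THEN iffD1, rule_format])

lemma eventually_le_of_ln_ratio_less:
  fixes u v :: "real \<Rightarrow> real"
  assumes "((\<lambda>\<gamma>. u \<gamma> / ln \<gamma>) \<longlongrightarrow> a) at_top" "((\<lambda>\<gamma>. v \<gamma> / ln \<gamma>) \<longlongrightarrow> b) at_top" "a < b"
  shows "\<forall>\<^sub>F \<gamma> in at_top. u \<gamma> \<le> v \<gamma>"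
proof -
  have "((\<lambda>\<gamma>. v \<gamma> / ln \<gamma> - u \<gamma> / ln \<gamma>) \<longlongrightarrow> b - a) at_top"
    by (intro tendsto_diff assms)
  then have "\<forall>\<^sub>F \<gamma> in at_top. 0 < v \<gamma> / ln \<gamma> - u \<gamma> / ln \<gamma>"
    by (rule order_tendstoD) (use assms(3) in simp)
  with eventually_ln_pos show ?thesis
  proof eventually_elim
    case (elim \<gamma>)
    then have "0 < (v \<gamma> - u \<gamma>) / ln \<gamma>" by (simp add: diff_divide_distrib)
    with elim(1) show ?case by (simp add: zero_less_divide_iff)
  qed
qed

lemma eventually_ge_nat_of_ln_ratio:
  fixes t :: "real \<Rightarrow> nat"
  assumes "((\<lambda>\<gamma>. real (t \<gamma>) / ln \<gamma>) \<longlongrightarrow> a) at_top" "0 < a"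
  shows "\<forall>\<^sub>F \<gamma> in at_top. n0 \<le> t \<gamma>"
proof -
  have "((\<lambda>\<gamma>::real. real n0 * inverse (ln \<gamma>)) \<longlongrightarrow> real n0 * 0) at_top"
    by (intro tendsto_intros tendsto_inverse_0_at_top[OF ln_at_top])
  then have "((\<lambda>\<gamma>::real. real n0 / ln \<gamma>) \<longlongrightarrow> 0) at_top" by (simp add: divide_inverse)
  then have "\<forall>\<^sub>F \<gamma> in at_top. real n0 \<le> real (t \<gamma>)"
    by (rule eventually_le_of_ln_ratio_less) (use assms in auto)
  then show ?thesis by simp
qed

context anomaly_model
begin

text \<open>The divergence accumulated in the first \<open>t\<close> steps from the changepoint on,
  which is the typical value of the log-likelihood ratio along the true phases.\<close>

definition "info d t = (\<Sum>u<t. I (phase d u))"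

lemma info_mono: "s \<le> t \<Longrightarrow> info d s \<le> info d t"
  unfolding info_def using I_pos[OF phase_range] by (intro sum_mono2) (auto intro: less_imp_le)

lemma changepoint_Suc: "1 \<le> i \<Longrightarrow> changepoint \<nu> d (Suc i) = changepoint \<nu> d i + d i"
  by (simp add: changepoint_def)

lemma phase_in_block:
  assumes "i \<in> {1..N}" "i = N \<or> y < d i"
  shows "phase d (changepoint 0 d i + y) = i"
  using assms phase_at_eq_iff[of 0 "changepoint 0 d i + y" m n d i]
  by (auto simp: phase_def N_def changepoint_Suc)

lemma info_block:
  assumes "i \<in> {1..N}" "i = N \<or> y \<le> d i"
  shows "info d (changepoint 0 d i + y) = (\<Sum>j\<in>{1..<i}. real (d j) * I j) + real y * I i"
proof -
  have step: "info d (changepoint 0 d i + y) = info d (changepoint 0 d i) + real y * I i"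
    if "i \<in> {1..N}" "i = N \<or> y \<le> d i" for i y
    using that(2)
  proof (induction y)
    case (Suc y)
    then have "phase d (changepoint 0 d i + y) = i" using that(1) by (intro phase_in_block) auto
    then show ?case using Suc by (auto simp: info_def algebra_simps)
  qed simp
  have "info d (changepoint 0 d i) = (\<Sum>j\<in>{1..<i}. real (d j) * I j)" if "1 \<le> i" "i \<le> N" for i
    using that
  proof (induction i rule: dec_induct)
    case base
    then show ?case by (simp add: changepoint_1[unfolded One_nat_def] info_def)
  next
    case (step i)
    then show ?case using \<open>\<And>i y. _ \<Longrightarrow> _ \<Longrightarrow> info d (changepoint 0 d i + y) = _\<close>[of i "d i"]
      by (simp add: changepoint_Suc)
  qed
  then show ?thesis using step[OF assms] assms(1) by simp
qed

definition "I_min = Min (I ` {1..N})"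

lemma I_min_pos: "0 < I_min" and I_min_le: "i \<in> {1..N} \<Longrightarrow> I_min \<le> I i"
  unfolding I_min_def using I_pos N1 by (auto simp: Min_gr_iff)

text \<open>Past the crossing of the threshold the phases are no longer under control, but every
  phase contributes at least \<open>I_min\<close> per step.\<close>

lemma info_ge: "s \<le> t \<Longrightarrow> info d s + real (t - s) * I_min \<le> info d t"
proof (induction t rule: dec_induct)
  case (step t)
  have "I_min \<le> I (phase d t)" by (rule I_min_le[OF phase_range])
  with step show ?case by (simp add: info_def Suc_diff_le algebra_simps)
qed simp

lemma WD_CuSum_in_class:
  assumes "\<forall>i\<in>{1..n - m}. 0 < \<rho> i \<and> \<rho> i < 1" "0 < \<gamma>"
  shows "WD_CuSum g f L m n \<rho> (ln \<gamma>) \<in> false_alarm_class g L \<gamma>"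
  unfolding false_alarm_class_def
  using stopping_time_WD_CuSum null_expectation_WD_CuSum_ge[OF g f m1 mn nL assms] by simp

end

section \<open>The time at which the accumulated divergence reaches log \<gamma>\<close>

locale growing_durations = anomaly_model +
  fixes c :: "nat \<Rightarrow> ereal" and d :: "real \<Rightarrow> nat \<Rightarrow> nat"
  assumes c_nonneg: "\<And>i. i \<in> {1..n - m} \<Longrightarrow> 0 \<le> c i" and c_last: "c (n - m + 1) = \<infinity>"
    and d_lim: "\<And>i. i \<in> {1..n - m} \<Longrightarrow>
      ((\<lambda>\<gamma>. ereal (real (d \<gamma> i)) * KL_number g f L m i / ereal (ln \<gamma>)) \<longlongrightarrow> c i) at_top"
begin

definition "h = crossing_phase m n c"
definition "c' i = real_of_ereal (c i)"
text \<open>The share of log \<gamma> still to be collected, asymptotically, when phase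
  \<open>h\<close> begins.\<close>

definition "x = 1 - (\<Sum>i\<in>{1..<h}. c' i)"
definition "K = (\<Sum>i\<in>{1..<h}. c' i / I i) + x / I h"

lemma c_nonneg': "i \<in> {1..N} \<Longrightarrow> 0 \<le> c i"
  using c_nonneg[of i] c_last by (cases "i = n - m + 1") (auto simp: N_def)

lemma h_range: "h \<in> {1..N}" and h_cross: "1 \<le> (\<Sum>i\<in>{1..h}. c i)"
  and h_least: "j \<in> {1..N} \<Longrightarrow> j < h \<Longrightarrow> (\<Sum>i\<in>{1..j}. c i) < 1"
proof -
  let ?A = "{j \<in> {1..n - m + 1}. 1 \<le> (\<Sum>i\<in>{1..j}. c i)}"
  have "(\<Sum>i\<in>{1..n - m + 1}. c i) = \<infinity>"
    using c_last by (subst sum_Pinfty) (auto intro!: bexI[of _ "n - m + 1"])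
  then have ne: "?A \<noteq> {}" by (auto intro!: exI[of _ "n - m + 1"])
  have fin: "finite ?A" by simp
  have h: "h \<in> ?A" unfolding h_def crossing_phase_def by (rule Min_in[OF fin ne])
  then show "h \<in> {1..N}" "1 \<le> (\<Sum>i\<in>{1..h}. c i)" by (auto simp: N_def)
  assume "j \<in> {1..N}" "j < h"
  then have "j \<notin> ?A" using Min_le[OF fin] unfolding h_def crossing_phase_def by (meson not_le)
  then show "(\<Sum>i\<in>{1..j}. c i) < 1" using \<open>j \<in> {1..N}\<close> by (auto simp: N_def not_le)
qed

lemma sum_before_h: "(\<Sum>i\<in>{1..<h}. c i) < 1"
proof (cases "h = 1")
  case False
  then have "{1..<h} = {1..h - 1}" "h - 1 \<in> {1..N}" "h - 1 < h" using h_range by auto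
  then show ?thesis using h_least[of "h - 1"] by simp
qed simp

lemma c_eq: "i \<in> {1..<h} \<Longrightarrow> c i = ereal (c' i)"
proof -
  assume i: "i \<in> {1..<h}"
  have "c i \<le> (\<Sum>i\<in>{1..<h}. c i)"
    using i h_range c_nonneg' sum_mono2[of "{1..<h}" "{i}" c] by auto
  then have "c i < 1" using sum_before_h by (rule le_less_trans)
  moreover have "0 \<le> c i" using i h_range by (intro c_nonneg') auto
  ultimately show ?thesis unfolding c'_def by (cases "c i") auto
qed

lemma sum_c_eq: "(\<Sum>i\<in>{1..<h}. c i) = ereal (\<Sum>i\<in>{1..<h}. c' i)"
  by (simp add: c_eq)

lemma x_pos: "0 < x"
  using sum_before_h unfolding sum_c_eq by (simp add: x_def)

lemma c'_nonneg: "i \<in> {1..<h} \<Longrightarrow> 0 \<le> c' i"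
  using c_nonneg'[of i] c_eq[of i] h_range by simp

text \<open>Phase \<open>h\<close> is long enough to supply the missing share, by the choice of
  \<open>h\<close>.\<close>

lemma x_le_c: "ereal x \<le> c h"
proof -
  have "{1..h} = insert h {1..<h}" using h_range by auto
  then have "1 \<le> c h + ereal (\<Sum>i\<in>{1..<h}. c' i)" using h_cross sum_c_eq by simp
  then show ?thesis unfolding x_def by (cases "c h") auto
qed

lemma K_pos: "0 < K"
proof -
  have "0 \<le> (\<Sum>i\<in>{1..<h}. c' i / I i)"
    using c'_nonneg I_pos h_range by (intro sum_nonneg divide_nonneg_nonneg) (auto intro: less_imp_le)
  moreover have "0 < x / I h" using x_pos I_pos[OF h_range] by simp
  ultimately show ?thesis unfolding K_def by simp
qed

lemma delay_constant_eq: "delay_constant m n c (KL_number g f L m) = ereal K"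
proof -
  have 1: "c i / KL_number g f L m i = ereal (c' i / I i)" if "i \<in> {1..<h}" for i
    using that h_range I_pos[of i] by (simp add: c_eq KL_eq)
  have 2: "(1 - ereal (\<Sum>i\<in>{1..<h}. c' i)) / ereal (I h) = ereal (x / I h)"
    using I_pos[OF h_range] by (simp add: x_def one_ereal_def)
  have "delay_constant m n c (KL_number g f L m)
     = (\<Sum>i\<in>{1..<h}. c i / KL_number g f L m i) + (1 - (\<Sum>i\<in>{1..<h}. c i)) / KL_number g f L m h"
    by (simp add: delay_constant_def h_def Let_def)
  also have "\<dots> = (\<Sum>i\<in>{1..<h}. ereal (c' i / I i)) + ereal (x / I h)"
    using 1 unfolding sum_c_eq KL_eq[OF h_range] 2 by (intro arg_cong2[where f="(+)"] sum.cong) auto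
  finally show ?thesis by (simp add: K_def)
qed

lemma d_lim_ereal:
  assumes "i \<in> {1..n - m}"
  shows "((\<lambda>\<gamma>. ereal (real (d \<gamma> i) * I i / ln \<gamma>)) \<longlongrightarrow> c i) at_top"
proof (rule Lim_transform_eventually[OF d_lim[OF assms]])
  show "\<forall>\<^sub>F \<gamma> in at_top. ereal (real (d \<gamma> i)) * KL_number g f L m i / ereal (ln \<gamma>) = ereal (real (d \<gamma> i) * I i / ln \<gamma>)"
    using eventually_ln_pos by eventually_elim (use assms in \<open>simp add: KL_eq N_def\<close>)
qed

lemma d_lim_real:
  assumes "i \<in> {1..<h}"
  shows "((\<lambda>\<gamma>. real (d \<gamma> i) * I i / ln \<gamma>) \<longlongrightarrow> c' i) at_top"
proof -
  have "i \<in> {1..n - m}" using assms h_range by (auto simp: N_def)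
  from d_lim_ereal[OF this] show ?thesis unfolding c_eq[OF assms] by simp
qed

text \<open>If \<open>c h = x\<close>, the actual duration of phase \<open>h\<close> may end
  slightly before the crossing. Stopping short by \<open>\<theta>\<close> keeps the time
  \<open>T\<close> inside phase \<open>h\<close> for large \<gamma>, where the divergence is an
  explicit linear expression; \<open>\<theta> \<le> x / I h\<close> keeps \<open>T\<close> from
  falling before the start of that phase.\<close>

lemma info_at_crossing:
  assumes \<theta>: "0 < \<theta>" "\<theta> \<le> x / I h"
  obtains T :: "real \<Rightarrow> nat" where "((\<lambda>\<gamma>. real (T \<gamma>) / ln \<gamma>) \<longlongrightarrow> K - \<theta>) at_top"
    "((\<lambda>\<gamma>. info (d \<gamma>) (T \<gamma>) / ln \<gamma>) \<longlongrightarrow> 1 - \<theta> * I h) at_top"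
proof -
  have Ih: "0 < I h" by (rule I_pos[OF h_range])
  define y where "y = x / I h - \<theta>"
  have y: "0 \<le> y" using \<theta> by (simp add: y_def)
  define Y where "Y \<gamma> = nat \<lfloor>y * ln \<gamma>\<rfloor>" for \<gamma>
  have Y: "((\<lambda>\<gamma>. real (Y \<gamma>) / ln \<gamma>) \<longlongrightarrow> y) at_top"
    unfolding Y_def by (rule tendsto_nat_floor_mult_ln[OF y])
  define T where "T \<gamma> = changepoint 0 (d \<gamma>) h + Y \<gamma>" for \<gamma>
  have block: "\<forall>\<^sub>F \<gamma> in at_top. h = N \<or> Y \<gamma> \<le> d \<gamma> h"
  proof (cases "h = N")
    case False
    then have h: "h \<in> {1..n - m}" using h_range by (auto simp: N_def)
    have "y * I h < x" using \<theta> Ih by (simp add: y_def field_simps)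
    then have "ereal (y * I h) < c h" using x_le_c by (metis ereal_less(2) less_le_trans less_ereal.simps(1))
    from order_tendstoD(1)[OF d_lim_ereal[OF h] this]
    have "\<forall>\<^sub>F \<gamma> in at_top. y * I h < real (d \<gamma> h) * I h / ln \<gamma>" by simp
    with eventually_ln_pos show ?thesis
    proof eventually_elim
      case (elim \<gamma>)
      have "0 \<le> y * ln \<gamma>" using y elim(1) by simp
      then have "real (Y \<gamma>) \<le> y * ln \<gamma>" by (simp add: Y_def)
      also have "y * ln \<gamma> < real (d \<gamma> h)"
        using elim Ih by (simp add: field_simps)
      finally show ?case by simp
    qed
  qed simp
  have nz: "I i \<noteq> 0" if "i \<in> {1..<h}" for i
    using I_pos[of i] h_range that by auto
  have T_lim: "((\<lambda>\<gamma>. real (T \<gamma>) / ln \<gamma>) \<longlongrightarrow> K - \<theta>) at_top"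
  proof -
    have "((\<lambda>\<gamma>. (\<Sum>i\<in>{1..<h}. (real (d \<gamma> i) * I i / ln \<gamma>) / I i) + real (Y \<gamma>) / ln \<gamma>) \<longlongrightarrow> (\<Sum>i\<in>{1..<h}. c' i / I i) + y) at_top"
      by (intro tendsto_add tendsto_sum tendsto_divide d_lim_real Y tendsto_const nz)
    moreover have "(\<Sum>i\<in>{1..<h}. (real (d \<gamma> i) * I i / ln \<gamma>) / I i) + real (Y \<gamma>) / ln \<gamma> = real (T \<gamma>) / ln \<gamma>" for \<gamma>
    proof -
      have "(\<Sum>i\<in>{1..<h}. (real (d \<gamma> i) * I i / ln \<gamma>) / I i) = (\<Sum>i\<in>{1..<h}. real (d \<gamma> i) / ln \<gamma>)"
        using h_range I_pos by (intro sum.cong) (force simp: field_simps)+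
      then show ?thesis by (simp add: T_def changepoint_def sum_divide_distrib add_divide_distrib)
    qed
    moreover have "(\<Sum>i\<in>{1..<h}. c' i / I i) + y = K - \<theta>" by (simp add: K_def y_def)
    ultimately show ?thesis by simp
  qed
  have "((\<lambda>\<gamma>. info (d \<gamma>) (T \<gamma>) / ln \<gamma>) \<longlongrightarrow> 1 - \<theta> * I h) at_top"
  proof (rule Lim_transform_eventually)
    have "((\<lambda>\<gamma>. (\<Sum>i\<in>{1..<h}. real (d \<gamma> i) * I i / ln \<gamma>) + real (Y \<gamma>) / ln \<gamma> * I h) \<longlongrightarrow> (\<Sum>i\<in>{1..<h}. c' i) + y * I h) at_top"
      by (intro tendsto_add tendsto_sum tendsto_mult d_lim_real Y tendsto_const)
    moreover have "(\<Sum>i\<in>{1..<h}. c' i) + y * I h = 1 - \<theta> * I h"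
      using Ih by (simp add: y_def x_def field_simps)
    ultimately show "((\<lambda>\<gamma>. (\<Sum>i\<in>{1..<h}. real (d \<gamma> i) * I i / ln \<gamma>) + real (Y \<gamma>) / ln \<gamma> * I h) \<longlongrightarrow> 1 - \<theta> * I h) at_top" by simp
    show "\<forall>\<^sub>F \<gamma> in at_top. (\<Sum>i\<in>{1..<h}. real (d \<gamma> i) * I i / ln \<gamma>) + real (Y \<gamma>) / ln \<gamma> * I h = info (d \<gamma>) (T \<gamma>) / ln \<gamma>"
      using block
    proof eventually_elim
      case (elim \<gamma>)
      then show ?case
        unfolding T_def by (subst info_block[OF h_range]) (auto simp: sum_divide_distrib add_divide_distrib)
    qed
  qed
  then show thesis using T_lim by (rule that[rotated])
qed

lemma info_lower:
  fixes t :: "real \<Rightarrow> nat"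
  assumes t: "((\<lambda>\<gamma>. real (t \<gamma>) / ln \<gamma>) \<longlongrightarrow> \<kappa>) at_top" and \<kappa>: "K < \<kappa>"
  obtains \<eta> where "0 < \<eta>" "\<forall>\<^sub>F \<gamma> in at_top. (1 + \<eta>) * ln \<gamma> \<le> info (d \<gamma>) (t \<gamma>)"
proof -
  have Ih: "0 < I h" by (rule I_pos[OF h_range])
  \<comment> \<open>Stopping early loses \<open>\<theta> * I h\<close>, at most
    \<open>\<eta>\<close>, while the time left after \<open>T\<close> brings in at least
    \<open>4 * \<eta>\<close>. The balance exceeds \<open>\<eta>\<close>.\<close>
  define \<eta> where "\<eta> = (\<kappa> - K) * I_min / 4"
  have \<eta>: "0 < \<eta>" using \<kappa> I_min_pos by (simp add: \<eta>_def)
  define \<theta> where "\<theta> = min (\<eta> / I h) (x / I h)"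
  have \<theta>: "0 < \<theta>" "\<theta> \<le> x / I h" "\<theta> \<le> \<eta> / I h" using \<eta> x_pos Ih by (auto simp: \<theta>_def)
  obtain T where T: "((\<lambda>\<gamma>. real (T \<gamma>) / ln \<gamma>) \<longlongrightarrow> K - \<theta>) at_top"
    "((\<lambda>\<gamma>. info (d \<gamma>) (T \<gamma>) / ln \<gamma>) \<longlongrightarrow> 1 - \<theta> * I h) at_top"
    using info_at_crossing[OF \<theta>(1,2)] by blast
  have Tt: "\<forall>\<^sub>F \<gamma> in at_top. T \<gamma> \<le> t \<gamma>"
    using eventually_le_of_ln_ratio_less[OF T(1) t] \<theta>(1) \<kappa> by simp
  have "\<forall>\<^sub>F \<gamma> in at_top. (1 + \<eta>) * ln \<gamma> \<le> info (d \<gamma>) (T \<gamma>) + (real (t \<gamma>) - real (T \<gamma>)) * I_min"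
  proof (rule eventually_le_of_ln_ratio_less)
    show "((\<lambda>\<gamma>. (1 + \<eta>) * ln \<gamma> / ln \<gamma>) \<longlongrightarrow> 1 + \<eta>) at_top"
      by (rule tendsto_eventually) (use eventually_ln_pos in eventually_elim, simp)
    have "((\<lambda>\<gamma>. info (d \<gamma>) (T \<gamma>) / ln \<gamma> + (real (t \<gamma>) / ln \<gamma> - real (T \<gamma>) / ln \<gamma>) * I_min)
      \<longlongrightarrow> (1 - \<theta> * I h) + (\<kappa> - (K - \<theta>)) * I_min) at_top"
      by (intro tendsto_intros T t)
    then show "((\<lambda>\<gamma>. (info (d \<gamma>) (T \<gamma>) + (real (t \<gamma>) - real (T \<gamma>)) * I_min) / ln \<gamma>)
      \<longlongrightarrow> (1 - \<theta> * I h) + (\<kappa> - (K - \<theta>)) * I_min) at_top"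
      by (simp add: add_divide_distrib diff_divide_distrib left_diff_distrib)
    have "\<theta> * I h \<le> \<eta>" using \<theta>(3) Ih by (simp add: field_simps)
    moreover have "(\<kappa> - (K - \<theta>)) * I_min = 4 * \<eta> + \<theta> * I_min" by (simp add: \<eta>_def field_simps)
    moreover have "0 < \<theta> * I_min" using \<theta>(1) I_min_pos by simp
    ultimately show "1 + \<eta> < (1 - \<theta> * I h) + (\<kappa> - (K - \<theta>)) * I_min" using \<eta> by linarith
  qed
  with Tt have "\<forall>\<^sub>F \<gamma> in at_top. (1 + \<eta>) * ln \<gamma> \<le> info (d \<gamma>) (t \<gamma>)"
  proof eventually_elim
    case (elim \<gamma>)
    then show ?case using info_ge[OF elim(1), of "d \<gamma>"] by (simp add: of_nat_diff)
  qed
  with \<eta> show thesis by (rule that)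
qed

lemma info_upper:
  fixes t :: "real \<Rightarrow> nat"
  assumes t: "((\<lambda>\<gamma>. real (t \<gamma>) / ln \<gamma>) \<longlongrightarrow> \<kappa>) at_top" and \<kappa>: "\<kappa> < K"
  obtains \<eta> where "0 < \<eta>" "\<forall>\<^sub>F \<gamma> in at_top. info (d \<gamma>) (t \<gamma>) \<le> (1 - \<eta>) * ln \<gamma>"
proof -
  have Ih: "0 < I h" by (rule I_pos[OF h_range])
  \<comment> \<open>Half of the gap at most, so that \<open>\<kappa> < K - \<theta>\<close> and
    \<open>t\<close> eventually comes before \<open>T\<close>; monotonicity of the divergence does
    the rest.\<close>
  define \<theta> where "\<theta> = min ((K - \<kappa>) / 2) (x / I h)"
  have \<theta>: "0 < \<theta>" "\<theta> \<le> x / I h" "\<theta> \<le> (K - \<kappa>) / 2"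
    unfolding \<theta>_def by (use \<kappa> x_pos Ih in simp, rule min.cobounded2, rule min.cobounded1)
  obtain T where T: "((\<lambda>\<gamma>. real (T \<gamma>) / ln \<gamma>) \<longlongrightarrow> K - \<theta>) at_top"
    "((\<lambda>\<gamma>. info (d \<gamma>) (T \<gamma>) / ln \<gamma>) \<longlongrightarrow> 1 - \<theta> * I h) at_top"
    using info_at_crossing[OF \<theta>(1,2)] by blast
  have Tt: "\<forall>\<^sub>F \<gamma> in at_top. t \<gamma> \<le> T \<gamma>"
    using eventually_le_of_ln_ratio_less[OF t T(1)] \<theta>(3) \<kappa> by simp
  define \<eta> where "\<eta> = \<theta> * I h / 2"
  have \<eta>: "0 < \<eta>" using \<theta> Ih by (simp add: \<eta>_def)
  have "\<forall>\<^sub>F \<gamma> in at_top. info (d \<gamma>) (T \<gamma>) \<le> (1 - \<eta>) * ln \<gamma>"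
  proof (rule eventually_le_of_ln_ratio_less[OF T(2)])
    show "((\<lambda>\<gamma>. (1 - \<eta>) * ln \<gamma> / ln \<gamma>) \<longlongrightarrow> 1 - \<eta>) at_top"
      by (rule tendsto_eventually) (use eventually_ln_pos in eventually_elim, simp)
    show "1 - \<theta> * I h < 1 - \<eta>" using \<theta>(1) Ih by (simp add: \<eta>_def)
  qed
  with Tt have "\<forall>\<^sub>F \<gamma> in at_top. info (d \<gamma>) (t \<gamma>) \<le> (1 - \<eta>) * ln \<gamma>"
    by eventually_elim (blast intro: info_mono order_trans)
  with \<eta> show thesis by (rule that)
qed

end

section \<open>The two delay bounds on the scale of log \<gamma>\<close>

context growing_durations
begin

lemma eventually_WADD_WD_CuSum_le:
  assumes \<rho>: "\<And>\<gamma> i. 0 < \<gamma> \<Longrightarrow> i \<in> {1..n - m} \<Longrightarrow> 0 < \<rho> \<gamma> i \<and> \<rho> \<gamma> i < 1"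
    and \<rho>_lim: "\<And>i. i \<in> {1..n - m} \<Longrightarrow> ((\<lambda>\<gamma>. \<rho> \<gamma> i) \<longlongrightarrow> 0) at_top"
    and ln_\<rho>_lim: "\<And>i. i \<in> {1..n - m} \<Longrightarrow> ((\<lambda>\<gamma>. - ln (\<rho> \<gamma> i) / ln \<gamma>) \<longlongrightarrow> 0) at_top"
    and r: "K < r"
  shows "\<forall>\<^sub>F \<gamma> in at_top. WADD g f L m n (d \<gamma>) (WD_CuSum g f L m n (\<rho> \<gamma>) (ln \<gamma>)) \<le> ennreal (r * ln \<gamma>)"
proof -
  define \<kappa> where "\<kappa> = (K + r) / 2"
  have \<kappa>: "K < \<kappa>" "\<kappa> < r" "0 < \<kappa>" using r K_pos by (auto simp: \<kappa>_def)
  \<comment> \<open>With \<open>\<delta> \<le> I_min / 2\<close>, a block of length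
    \<open>C * ln \<gamma>\<close> has a guaranteed gain of about \<open>2 * ln \<gamma>\<close> in
    whatever phases it lies. This exceeds the threshold with its penalties, which is only about
    \<open>ln \<gamma>\<close>.\<close>
  define C where "C = 4 / I_min"
  have C: "0 < C" using I_min_pos by (simp add: C_def)
  define t0 l where "t0 \<gamma> = nat \<lfloor>\<kappa> * ln \<gamma>\<rfloor>" and "l \<gamma> = nat \<lfloor>C * ln \<gamma>\<rfloor>" for \<gamma>
  have t0: "((\<lambda>\<gamma>. real (t0 \<gamma>) / ln \<gamma>) \<longlongrightarrow> \<kappa>) at_top" and l: "((\<lambda>\<gamma>. real (l \<gamma>) / ln \<gamma>) \<longlongrightarrow> C) at_top"
    unfolding t0_def l_def using \<kappa> C by (auto intro!: tendsto_nat_floor_mult_ln)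
  obtain \<eta> where \<eta>: "0 < \<eta>" "\<forall>\<^sub>F \<gamma> in at_top. (1 + \<eta>) * ln \<gamma> \<le> info (d \<gamma>) (t0 \<gamma>)"
    using info_lower[OF t0 \<kappa>(1)] by blast
  \<comment> \<open>On the first block the allowed deviation is about
    \<open>\<delta> * \<kappa> * ln \<gamma>\<close>, hence at most half of the surplus
    \<open>\<eta> * ln \<gamma>\<close>.\<close>
  define \<delta> where "\<delta> = min (\<eta> / (2 * \<kappa>)) (I_min / 2)"
  have \<delta>: "0 < \<delta>" "\<delta> \<le> \<eta> / (2 * \<kappa>)" "\<delta> \<le> I_min / 2" using \<eta> \<kappa> I_min_pos by (auto simp: \<delta>_def)
  \<comment> \<open>The further blocks add about \<open>2 * \<epsilon> * C * ln \<gamma>\<close> to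
    the mean delay, at most half of the gap between \<open>\<kappa>\<close> and
    \<open>r\<close>.\<close>
  define \<epsilon> where "\<epsilon> = min (1 / 2) ((r - \<kappa>) / (4 * C))"
  have \<epsilon>: "0 < \<epsilon>" "\<epsilon> \<le> 1 / 2" "\<epsilon> \<le> (r - \<kappa>) / (4 * C)" using \<kappa> C by (auto simp: \<epsilon>_def)
  obtain n0 where n0: "\<And>t. n0 \<le> t \<Longrightarrow> deviation_bound \<delta> \<epsilon> t"
    using ex_deviation_bound[OF \<delta>(1) \<epsilon>(1)] by blast
  let ?pen = "\<lambda>\<gamma>. rho_penalty (n - m) (\<rho> \<gamma>)" and ?stay = "\<lambda>\<gamma>. stay_penalty (n - m) (\<rho> \<gamma>)"
  have pen: "((\<lambda>\<gamma>. ?pen \<gamma> / ln \<gamma>) \<longlongrightarrow> 0) at_top"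
  proof -
    have "((\<lambda>\<gamma>. \<Sum>i\<in>{1..n - m}. - ln (\<rho> \<gamma> i) / ln \<gamma>) \<longlongrightarrow> (\<Sum>i\<in>{1..n - m}. 0)) at_top"
      by (intro tendsto_sum ln_\<rho>_lim)
    then show ?thesis by (simp add: rho_penalty_def sum_divide_distrib)
  qed
  have stay: "(?stay \<longlongrightarrow> 0) at_top"
  proof -
    have "((\<lambda>\<gamma>. \<Sum>i\<in>{1..n - m}. - ln (1 - \<rho> \<gamma> i)) \<longlongrightarrow> (\<Sum>i\<in>{1..n - m}. - ln (1 - 0))) at_top"
      by (intro tendsto_sum tendsto_minus tendsto_ln tendsto_diff tendsto_const \<rho>_lim) auto
    then show ?thesis by (simp add: stay_penalty_def)
  qed
  \<comment> \<open>The transition costs are of smaller order than \<open>ln \<gamma>\<close> by the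
    assumption on their logarithms. The staying costs are small as well, since O(log \<gamma>) steps
    each cost o(1). The two assumptions on \<rho> enter here through these two terms.\<close>
  have load: "((\<lambda>\<gamma>. (ln \<gamma> + ?pen \<gamma> + real (t \<gamma>) * ?stay \<gamma>) / ln \<gamma>) \<longlongrightarrow> 1) at_top"
    if t: "((\<lambda>\<gamma>. real (t \<gamma>) / ln \<gamma>) \<longlongrightarrow> a) at_top" for t :: "real \<Rightarrow> nat" and a
  proof (rule Lim_transform_eventually)
    have "((\<lambda>\<gamma>. 1 + ?pen \<gamma> / ln \<gamma> + real (t \<gamma>) / ln \<gamma> * ?stay \<gamma>) \<longlongrightarrow> 1 + 0 + a * 0) at_top"
      by (intro tendsto_intros pen stay t)
    then show "((\<lambda>\<gamma>. 1 + ?pen \<gamma> / ln \<gamma> + real (t \<gamma>) / ln \<gamma> * ?stay \<gamma>) \<longlongrightarrow> 1) at_top" by simp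
    show "\<forall>\<^sub>F \<gamma> in at_top. 1 + ?pen \<gamma> / ln \<gamma> + real (t \<gamma>) / ln \<gamma> * ?stay \<gamma> = (ln \<gamma> + ?pen \<gamma> + real (t \<gamma>) * ?stay \<gamma>) / ln \<gamma>"
      using eventually_ln_pos by eventually_elim (simp add: add_divide_distrib)
  qed
  have first: "\<forall>\<^sub>F \<gamma> in at_top. ln \<gamma> + ?pen \<gamma> + real (t0 \<gamma>) * ?stay \<gamma> \<le> (1 + \<eta>) * ln \<gamma> - \<delta> * real (t0 \<gamma>)"
  proof (rule eventually_le_of_ln_ratio_less[OF load[OF t0]])
    show "((\<lambda>\<gamma>. ((1 + \<eta>) * ln \<gamma> - \<delta> * real (t0 \<gamma>)) / ln \<gamma>) \<longlongrightarrow> (1 + \<eta>) - \<delta> * \<kappa>) at_top"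
    proof (rule Lim_transform_eventually)
      show "((\<lambda>\<gamma>. (1 + \<eta>) - \<delta> * (real (t0 \<gamma>) / ln \<gamma>)) \<longlongrightarrow> (1 + \<eta>) - \<delta> * \<kappa>) at_top" by (intro tendsto_intros t0)
      show "\<forall>\<^sub>F \<gamma> in at_top. (1 + \<eta>) - \<delta> * (real (t0 \<gamma>) / ln \<gamma>) = ((1 + \<eta>) * ln \<gamma> - \<delta> * real (t0 \<gamma>)) / ln \<gamma>"
        using eventually_ln_pos by eventually_elim (simp add: diff_divide_distrib)
    qed
    have "\<delta> * \<kappa> \<le> \<eta> / 2" using mult_right_mono[OF \<delta>(2), of \<kappa>] \<kappa>(3) by simp
    then show "1 < (1 + \<eta>) - \<delta> * \<kappa>" using \<eta>(1) by linarith
  qed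
  have later: "\<forall>\<^sub>F \<gamma> in at_top. ln \<gamma> + ?pen \<gamma> + real (l \<gamma>) * ?stay \<gamma> \<le> real (l \<gamma>) * (I_min - \<delta>)"
  proof (rule eventually_le_of_ln_ratio_less[OF load[OF l]])
    have "((\<lambda>\<gamma>. real (l \<gamma>) / ln \<gamma> * (I_min - \<delta>)) \<longlongrightarrow> C * (I_min - \<delta>)) at_top" by (intro tendsto_intros l)
    then show "((\<lambda>\<gamma>. real (l \<gamma>) * (I_min - \<delta>) / ln \<gamma>) \<longlongrightarrow> C * (I_min - \<delta>)) at_top" by simp
    have "C * (I_min / 2) \<le> C * (I_min - \<delta>)" using C \<delta>(3) by (intro mult_left_mono) auto
    moreover have "C * (I_min / 2) = 2" using I_min_pos by (simp add: C_def)
    ultimately show "1 < C * (I_min - \<delta>)" by linarith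
  qed
  have total: "\<forall>\<^sub>F \<gamma> in at_top. real (t0 \<gamma>) + 2 * \<epsilon> * real (l \<gamma>) \<le> r * ln \<gamma>"
  proof (rule eventually_le_of_ln_ratio_less)
    have "((\<lambda>\<gamma>. real (t0 \<gamma>) / ln \<gamma> + 2 * \<epsilon> * (real (l \<gamma>) / ln \<gamma>)) \<longlongrightarrow> \<kappa> + 2 * \<epsilon> * C) at_top"
      by (intro tendsto_intros t0 l)
    then show "((\<lambda>\<gamma>. (real (t0 \<gamma>) + 2 * \<epsilon> * real (l \<gamma>)) / ln \<gamma>) \<longlongrightarrow> \<kappa> + 2 * \<epsilon> * C) at_top"
      by (simp add: add_divide_distrib)
    show "((\<lambda>\<gamma>. r * ln \<gamma> / ln \<gamma>) \<longlongrightarrow> r) at_top"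
      by (rule tendsto_eventually) (use eventually_ln_pos in eventually_elim, simp)
    define e where "e = \<epsilon> * C"
    have "e \<le> (r - \<kappa>) / 4" using mult_right_mono[OF \<epsilon>(3), of C] C by (simp add: e_def)
    then have "2 * e \<le> (r - \<kappa>) / 2" by simp
    also have "\<dots> < r - \<kappa>" using \<kappa>(2) by simp
    finally have "\<kappa> + 2 * e < r" by simp
    then show "\<kappa> + 2 * \<epsilon> * C < r" by (simp add: e_def mult.assoc)
  qed
  note long = eventually_ge_nat_of_ln_ratio[OF t0 \<kappa>(3), of "max 1 n0"] eventually_ge_nat_of_ln_ratio[OF l C, of "max 1 n0"]
  show ?thesis
    using eventually_gt_at_top[of 0] \<eta>(2) first later total long
  proof eventually_elim
    case (elim \<gamma>)
    have "worst_history_delay (anomaly_prob g f L m n \<nu> (d \<gamma>) S) L (WD_CuSum g f L m n (\<rho> \<gamma>) (ln \<gamma>)) \<nu>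
        \<le> ennreal (real (t0 \<gamma>) + 2 * \<epsilon> * real (l \<gamma>))" if S: "S \<in> trajectories L m n" and \<nu>: "1 \<le> \<nu>" for S \<nu>
    proof (rule worst_history_delay_WD_CuSum_le[OF S \<nu> \<rho>[OF elim(1)]])
      show "deviation_bound \<delta> \<epsilon> (t0 \<gamma>)" "deviation_bound \<delta> \<epsilon> (l \<gamma>)" using elim(6,7) by (auto intro: n0)
      show "1 \<le> t0 \<gamma>" "1 \<le> l \<gamma>" "0 \<le> \<epsilon>" "\<epsilon> \<le> 1 / 2" using elim(6,7) \<epsilon> by auto
      show "ln \<gamma> + ?pen \<gamma> + real (t0 \<gamma>) * ?stay \<gamma> \<le> (\<Sum>u<t0 \<gamma>. I (phase (d \<gamma>) u)) - \<delta> * real (t0 \<gamma>)"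
        using elim(2,3) unfolding info_def by linarith
      fix s
      have "real (card {..<l \<gamma>}) * I_min \<le> (\<Sum>u<l \<gamma>. I (phase (d \<gamma>) (s + u)))"
        by (intro sum_bounded_below I_min_le phase_range)
      then show "ln \<gamma> + ?pen \<gamma> + real (l \<gamma>) * ?stay \<gamma> \<le> (\<Sum>u<l \<gamma>. I (phase (d \<gamma>) (s + u))) - \<delta> * real (l \<gamma>)"
        using elim(4) by (simp add: algebra_simps)
    qed
    then have "WADD g f L m n (d \<gamma>) (WD_CuSum g f L m n (\<rho> \<gamma>) (ln \<gamma>)) \<le> ennreal (real (t0 \<gamma>) + 2 * \<epsilon> * real (l \<gamma>))"
      unfolding WADD_def by (intro SUP_least) auto
    also have "\<dots> \<le> ennreal (r * ln \<gamma>)" using elim(5) by (rule ennreal_leI)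
    finally show ?case .
  qed
qed

lemma eventually_INF_WADD_ge:
  assumes r: "0 < r" "r < K"
  shows "\<forall>\<^sub>F \<gamma> in at_top. ennreal (r * ln \<gamma>) \<le> (INF \<tau>\<in>false_alarm_class g L \<gamma>. WADD g f L m n (d \<gamma>) \<tau>)"
proof -
  define \<kappa> where "\<kappa> = (r + K) / 2"
  have \<kappa>: "r < \<kappa>" "\<kappa> < K" "0 < \<kappa>" using r by (auto simp: \<kappa>_def)
  define t where "t \<gamma> = nat \<lfloor>\<kappa> * ln \<gamma>\<rfloor>" for \<gamma>
  have t: "((\<lambda>\<gamma>. real (t \<gamma>) / ln \<gamma>) \<longlongrightarrow> \<kappa>) at_top"
    unfolding t_def using \<kappa> by (intro tendsto_nat_floor_mult_ln) auto
  obtain \<eta> where \<eta>: "0 < \<eta>" "\<forall>\<^sub>F \<gamma> in at_top. info (d \<gamma>) (t \<gamma>) \<le> (1 - \<eta>) * ln \<gamma>"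
    using info_upper[OF t \<kappa>(2)] by blast
  \<comment> \<open>The deviation uses up half of the margin \<open>\<eta>\<close> in the exponent.
    Of the other half, a quarter of \<open>\<eta>\<close> absorbs the error of the limits, and a
    quarter remains to beat the factor \<open>ln \<gamma>\<close>.\<close>
  define \<delta> where "\<delta> = \<eta> / (2 * \<kappa>)"
  have \<delta>: "0 < \<delta>" "\<delta> * \<kappa> = \<eta> / 2" using \<eta>(1) \<kappa>(3) by (auto simp: \<delta>_def)
  \<comment> \<open>Chosen so that \<open>(1 - 2 * \<epsilon>) * \<kappa>\<close> is still at least
    \<open>r\<close>.\<close>
  define \<epsilon> where "\<epsilon> = min (1 / 4) ((\<kappa> - r) / (2 * \<kappa>))"
  have \<epsilon>: "0 < \<epsilon>" "2 * \<epsilon> \<le> 1" "\<epsilon> \<le> (\<kappa> - r) / (2 * \<kappa>)" using \<kappa> by (auto simp: \<epsilon>_def)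
  have "\<epsilon> * (2 * \<kappa>) \<le> \<kappa> - r" using \<epsilon>(3) \<kappa>(3) by (simp add: pos_le_divide_eq)
  then have r_le: "r \<le> (1 - 2 * \<epsilon>) * \<kappa>" by (simp add: algebra_simps)
  obtain n0 where n0: "\<And>t. n0 \<le> t \<Longrightarrow> deviation_bound \<delta> \<epsilon> t"
    using ex_deviation_bound[OF \<delta>(1) \<epsilon>(1)] by blast
  have expo: "\<forall>\<^sub>F \<gamma> in at_top. (1 - \<eta>) * ln \<gamma> + \<delta> * real (t \<gamma>) \<le> (1 - \<eta> / 4) * ln \<gamma>"
  proof (rule eventually_le_of_ln_ratio_less)
    show "((\<lambda>\<gamma>. ((1 - \<eta>) * ln \<gamma> + \<delta> * real (t \<gamma>)) / ln \<gamma>) \<longlongrightarrow> (1 - \<eta>) + \<delta> * \<kappa>) at_top"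
    proof (rule Lim_transform_eventually)
      show "((\<lambda>\<gamma>. (1 - \<eta>) + \<delta> * (real (t \<gamma>) / ln \<gamma>)) \<longlongrightarrow> (1 - \<eta>) + \<delta> * \<kappa>) at_top" by (intro tendsto_intros t)
      show "\<forall>\<^sub>F \<gamma> in at_top. (1 - \<eta>) + \<delta> * (real (t \<gamma>) / ln \<gamma>) = ((1 - \<eta>) * ln \<gamma> + \<delta> * real (t \<gamma>)) / ln \<gamma>"
        using eventually_ln_pos by eventually_elim (simp add: add_divide_distrib)
    qed
    show "((\<lambda>\<gamma>. (1 - \<eta> / 4) * ln \<gamma> / ln \<gamma>) \<longlongrightarrow> 1 - \<eta> / 4) at_top"
      by (rule tendsto_eventually) (use eventually_ln_pos in eventually_elim, simp)
    show "(1 - \<eta>) + \<delta> * \<kappa> < 1 - \<eta> / 4" using \<delta>(2) \<eta>(1) by simp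
  qed
  \<comment> \<open>The expression bounds the hazard 2 t / \<gamma> of the rare window times the
    change-of-measure factor \<gamma>^(1 - \<eta> / 4).\<close>
  have small: "\<forall>\<^sub>F \<gamma> in at_top. 2 * \<kappa> * ln \<gamma> * exp (- (\<eta> / 4) * ln \<gamma>) \<le> \<epsilon>"
  proof -
    have "filterlim (\<lambda>\<gamma>::real. \<eta> / 4 * ln \<gamma>) at_top at_top"
      using \<eta>(1) by (intro filterlim_tendsto_pos_mult_at_top[OF tendsto_const] ln_at_top) simp
    from filterlim_compose[OF tendsto_power_div_exp_0[of 1] this]
    have "((\<lambda>\<gamma>. 8 * \<kappa> / \<eta> * ((\<eta> / 4 * ln \<gamma>) ^ 1 / exp (\<eta> / 4 * ln \<gamma>))) \<longlongrightarrow> 8 * \<kappa> / \<eta> * 0) at_top"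
      by (intro tendsto_mult tendsto_const)
    moreover have "8 * \<kappa> / \<eta> * ((\<eta> / 4 * ln \<gamma>) ^ 1 / exp (\<eta> / 4 * ln \<gamma>)) = 2 * \<kappa> * ln \<gamma> * exp (- (\<eta> / 4) * ln \<gamma>)" for \<gamma>
    proof -
      have "exp (- (\<eta> / 4) * ln \<gamma>) = 1 / exp (\<eta> / 4 * ln \<gamma>)"
        by (simp only: mult_minus_left exp_minus inverse_eq_divide)
      then show ?thesis using \<eta>(1) by (simp only: power_one_right) simp
    qed
    ultimately have "((\<lambda>\<gamma>. 2 * \<kappa> * ln \<gamma> * exp (- (\<eta> / 4) * ln \<gamma>)) \<longlongrightarrow> 0) at_top"
      by (simp only: mult_zero_right)
    then have "\<forall>\<^sub>F \<gamma> in at_top. 2 * \<kappa> * ln \<gamma> * exp (- (\<eta> / 4) * ln \<gamma>) < \<epsilon>"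
      by (rule order_tendstoD) (rule \<epsilon>(1))
    then show ?thesis by (rule eventually_mono) simp
  qed
  have slow: "\<forall>\<^sub>F \<gamma> in at_top. 2 * \<kappa> * ln \<gamma> \<le> \<gamma>"
  proof -
    have "((\<lambda>\<gamma>::real. 2 * \<kappa> * (ln \<gamma> / \<gamma>)) \<longlongrightarrow> 2 * \<kappa> * 0) at_top"
      by (intro tendsto_mult tendsto_const ln_x_over_x_tendsto_0)
    then have "((\<lambda>\<gamma>::real. 2 * \<kappa> * ln \<gamma> / \<gamma>) \<longlongrightarrow> 0) at_top" by simp
    then have "\<forall>\<^sub>F \<gamma> in at_top. 2 * \<kappa> * ln \<gamma> / \<gamma> < 1" by (rule order_tendstoD) simp
    with eventually_gt_at_top[of 0] show ?thesis
      by eventually_elim (simp add: field_simps)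
  qed
  show ?thesis
    using eventually_gt_at_top[of 0] eventually_ln_pos \<eta>(2) expo small slow eventually_ge_nat_of_ln_ratio[OF t \<kappa>(3), of "max 1 n0"]
  proof eventually_elim
    case (elim \<gamma>)
    have "0 \<le> \<kappa> * ln \<gamma>" using elim(2) \<kappa>(3) by simp
    then have t_bounds: "real (t \<gamma>) \<le> \<kappa> * ln \<gamma>" "\<kappa> * ln \<gamma> \<le> real (t \<gamma> + 1)" unfolding t_def by linarith+
    show ?case
    proof (rule INF_greatest)
      fix \<tau> assume \<tau>: "\<tau> \<in> false_alarm_class g L \<gamma>"
      have "r * ln \<gamma> \<le> (1 - 2 * \<epsilon>) * (\<kappa> * ln \<gamma>)"
        using mult_right_mono[OF r_le, of "ln \<gamma>"] elim(2) by (simp add: mult.assoc)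
      also have "\<dots> \<le> (1 - 2 * \<epsilon>) * real (t \<gamma> + 1)"
        using t_bounds(2) \<epsilon>(2) by (intro mult_left_mono) auto
      finally have "ennreal (r * ln \<gamma>) \<le> ennreal ((1 - 2 * \<epsilon>) * real (t \<gamma> + 1))" by (rule ennreal_leI)
      also have "\<dots> \<le> WADD g f L m n (d \<gamma>) \<tau>"
      proof (rule WADD_ge[OF \<tau> elim(1)])
        show "deviation_bound \<delta> \<epsilon> (t \<gamma>)" using elim(7) by (auto intro: n0)
        show "1 \<le> t \<gamma>" "0 \<le> \<epsilon>" "2 * \<epsilon> \<le> 1" using elim(7) \<epsilon> by auto
        show "2 * real (t \<gamma>) \<le> \<gamma>" using t_bounds(1) elim(6) by linarith
        have "2 * real (t \<gamma>) / \<gamma> * exp ((\<Sum>u<t \<gamma>. I (phase (d \<gamma>) u)) + \<delta> * real (t \<gamma>))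
            \<le> 2 * (\<kappa> * ln \<gamma>) / \<gamma> * exp ((1 - \<eta> / 4) * ln \<gamma>)"
        proof (rule mult_mono)
          show "2 * real (t \<gamma>) / \<gamma> \<le> 2 * (\<kappa> * ln \<gamma>) / \<gamma>"
            using t_bounds(1) elim(1) by (intro divide_right_mono) auto
          show "exp ((\<Sum>u<t \<gamma>. I (phase (d \<gamma>) u)) + \<delta> * real (t \<gamma>)) \<le> exp ((1 - \<eta> / 4) * ln \<gamma>)"
            using elim(3,4) unfolding info_def by (subst exp_le_cancel_iff) linarith
        qed (use elim(1,2) \<kappa>(3) in auto)
        also have "\<dots> = 2 * \<kappa> * ln \<gamma> * exp (- (\<eta> / 4) * ln \<gamma>)"
        proof -
          have "exp ((1 - \<eta> / 4) * ln \<gamma>) = \<gamma> * exp (- (\<eta> / 4) * ln \<gamma>)"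
            using elim(1) by (simp only: left_diff_distrib mult_1_left exp_diff mult_minus_left exp_minus exp_ln divide_inverse)
          then show ?thesis using elim(1) by simp
        qed
        also have "\<dots> \<le> \<epsilon>" by (rule elim(5))
        finally show "2 * real (t \<gamma>) / \<gamma> * exp ((\<Sum>u<t \<gamma>. I (phase (d \<gamma>) u)) + \<delta> * real (t \<gamma>)) \<le> \<epsilon>" .
      qed
      finally show "ennreal (r * ln \<gamma>) \<le> WADD g f L m n (d \<gamma>) \<tau>" .
    qed
  qed
qed

end

section \<open>From eventual bounds to asymptotic equivalence, and the conclusion\<close>

lemma tendsto_enn2real_div_ln:
  fixes W :: "real \<Rightarrow> ennreal"
  assumes K: "0 < K"
    and low: "\<And>r. 0 < r \<Longrightarrow> r < K \<Longrightarrow> \<forall>\<^sub>F \<gamma> in at_top. ennreal (r * ln \<gamma>) \<le> W \<gamma>"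
    and up: "\<And>r. K < r \<Longrightarrow> \<forall>\<^sub>F \<gamma> in at_top. W \<gamma> \<le> ennreal (r * ln \<gamma>)"
  shows "((\<lambda>\<gamma>. enn2real (W \<gamma>) / ln \<gamma>) \<longlongrightarrow> K) at_top" "\<forall>\<^sub>F \<gamma> in at_top. W \<gamma> < \<top>"
proof -
  show fin: "\<forall>\<^sub>F \<gamma> in at_top. W \<gamma> < \<top>"
    using up[of "K + 1"] by (auto elim!: eventually_mono intro: le_less_trans)
  show "((\<lambda>\<gamma>. enn2real (W \<gamma>) / ln \<gamma>) \<longlongrightarrow> K) at_top"
  proof (rule order_tendstoI)
    fix a assume a: "a < K"
    define r where "r = (max a 0 + K) / 2"
    have r: "0 < r" "r < K" "a < r" using a K by (auto simp: r_def max_def)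
    from low[OF r(1,2)] fin eventually_ln_pos show "\<forall>\<^sub>F \<gamma> in at_top. a < enn2real (W \<gamma>) / ln \<gamma>"
    proof eventually_elim
      case (elim \<gamma>)
      then have "r * ln \<gamma> \<le> enn2real (W \<gamma>)"
        using r(1) enn2real_mono[OF elim(1,2)] by simp
      then have "r \<le> enn2real (W \<gamma>) / ln \<gamma>" using elim(3) by (simp add: field_simps)
      with r(3) show ?case by simp
    qed
  next
    fix a assume a: "K < a"
    define r where "r = (a + K) / 2"
    have r: "K < r" "r < a" using a by (auto simp: r_def)
    from up[OF r(1)] eventually_ln_pos show "\<forall>\<^sub>F \<gamma> in at_top. enn2real (W \<gamma>) / ln \<gamma> < a"
    proof eventually_elim
      case (elim \<gamma>)
      have "enn2real (W \<gamma>) \<le> r * ln \<gamma>" using elim r K by (intro enn2real_leI) auto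
      then have "enn2real (W \<gamma>) / ln \<gamma> \<le> r" using elim(2) by (simp add: field_simps)
      with r(2) show ?case by simp
    qed
  qed
qed

text \<open>A lower bound for the infimum and an upper bound for the test suffice, as the infimum is
  at most the value of the test. Both quantities are then eventually finite, so that the
  extended-real quotients are real ones, and both tend to \<open>K\<close> after division by
  \<open>ln \<gamma>\<close>.\<close>

lemma asymp_at_infinity_sandwich:
  fixes U V :: "real \<Rightarrow> ennreal"
  assumes K: "0 < K"
    and low: "\<And>r. 0 < r \<Longrightarrow> r < K \<Longrightarrow> \<forall>\<^sub>F \<gamma> in at_top. ennreal (r * ln \<gamma>) \<le> U \<gamma>"
    and le: "\<forall>\<^sub>F \<gamma> in at_top. U \<gamma> \<le> V \<gamma>"
    and up: "\<And>r. K < r \<Longrightarrow> \<forall>\<^sub>F \<gamma> in at_top. V \<gamma> \<le> ennreal (r * ln \<gamma>)"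
  shows "asymp_at_infinity (\<lambda>\<gamma>. enn2ereal (U \<gamma>)) (\<lambda>\<gamma>. enn2ereal (V \<gamma>))"
    "asymp_at_infinity (\<lambda>\<gamma>. enn2ereal (V \<gamma>)) (\<lambda>\<gamma>. ereal (ln \<gamma>) * ereal K)"
proof -
  have U_up: "\<forall>\<^sub>F \<gamma> in at_top. U \<gamma> \<le> ennreal (r * ln \<gamma>)" if "K < r" for r
    using le up[OF that] by eventually_elim (rule order_trans)
  have U: "((\<lambda>\<gamma>. enn2real (U \<gamma>) / ln \<gamma>) \<longlongrightarrow> K) at_top" "\<forall>\<^sub>F \<gamma> in at_top. U \<gamma> < \<top>"
    by (rule tendsto_enn2real_div_ln[OF K], erule (1) low, erule U_up)+
  have V_low: "\<forall>\<^sub>F \<gamma> in at_top. ennreal (r * ln \<gamma>) \<le> V \<gamma>" if "0 < r" "r < K" for r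
    using low[OF that] le by eventually_elim (rule order_trans)
  have V: "((\<lambda>\<gamma>. enn2real (V \<gamma>) / ln \<gamma>) \<longlongrightarrow> K) at_top" "\<forall>\<^sub>F \<gamma> in at_top. V \<gamma> < \<top>"
    by (rule tendsto_enn2real_div_ln[OF K], erule (1) V_low, erule up)+
  have enn: "enn2ereal y = ereal (enn2real y)" if "y < \<top>" for y
    using that by (cases y) auto
  have V_pos: "\<forall>\<^sub>F \<gamma> in at_top. 0 < enn2real (V \<gamma>) / ln \<gamma>"
    by (rule order_tendstoD(1)[OF V(1) K])
  show "asymp_at_infinity (\<lambda>\<gamma>. enn2ereal (U \<gamma>)) (\<lambda>\<gamma>. enn2ereal (V \<gamma>))"
    unfolding asymp_at_infinity_def
  proof (rule Lim_transform_eventually)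
    have "((\<lambda>\<gamma>. (enn2real (U \<gamma>) / ln \<gamma>) / (enn2real (V \<gamma>) / ln \<gamma>)) \<longlongrightarrow> K / K) at_top"
      using K by (intro tendsto_divide U V) auto
    then show "((\<lambda>\<gamma>. ereal ((enn2real (U \<gamma>) / ln \<gamma>) / (enn2real (V \<gamma>) / ln \<gamma>))) \<longlongrightarrow> 1) at_top"
      using K by (simp add: one_ereal_def)
    show "\<forall>\<^sub>F \<gamma> in at_top. ereal ((enn2real (U \<gamma>) / ln \<gamma>) / (enn2real (V \<gamma>) / ln \<gamma>)) = enn2ereal (U \<gamma>) / enn2ereal (V \<gamma>)"
      using U(2) V(2) V_pos eventually_ln_pos
    proof eventually_elim
      case (elim \<gamma>)
      then have "0 < enn2real (V \<gamma>)" by (simp add: zero_less_divide_iff)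
      then show ?case using elim by (simp add: enn)
    qed
  qed
  show "asymp_at_infinity (\<lambda>\<gamma>. enn2ereal (V \<gamma>)) (\<lambda>\<gamma>. ereal (ln \<gamma>) * ereal K)"
    unfolding asymp_at_infinity_def
  proof (rule Lim_transform_eventually)
    have "((\<lambda>\<gamma>. (enn2real (V \<gamma>) / ln \<gamma>) / K) \<longlongrightarrow> K / K) at_top"
      using K by (intro tendsto_divide V tendsto_const) auto
    then show "((\<lambda>\<gamma>. ereal ((enn2real (V \<gamma>) / ln \<gamma>) / K)) \<longlongrightarrow> 1) at_top"
      using K by (simp add: one_ereal_def)
    show "\<forall>\<^sub>F \<gamma> in at_top. ereal ((enn2real (V \<gamma>) / ln \<gamma>) / K) = enn2ereal (V \<gamma>) / (ereal (ln \<gamma>) * ereal K)"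
      using V(2) eventually_ln_pos
    proof eventually_elim
      case (elim \<gamma>)
      then show ?case using K by (simp add: enn)
    qed
  qed
qed

theorem theorem1:
  fixes g f :: "real \<Rightarrow> real" and L m n :: nat
  assumes "is_pdf g" and "is_pdf f"
    and "1 \<le> m" and "m \<le> n" and "n \<le> L"
  shows
    "(\<forall>(\<rho> :: nat \<Rightarrow> real) (\<gamma> :: real) (b :: real).
        (\<forall>i\<in>{1..n - m}. 0 < \<rho> i \<and> \<rho> i < 1) \<longrightarrow> 0 < \<gamma> \<longrightarrow> b = ln \<gamma> \<longrightarrow>
        null_expectation g L (WD_CuSum g f L m n \<rho> b) \<ge> ennreal \<gamma>)
   \<and>
     (\<forall>(c :: nat \<Rightarrow> ereal) (d :: real \<Rightarrow> nat \<Rightarrow> nat) (\<rho> :: real \<Rightarrow> nat \<Rightarrow> real) (b :: real \<Rightarrow> real).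
        (\<forall>i\<in>{1..n - m + 1}. 0 < KL_number g f L m i \<and> KL_number g f L m i < \<infinity>) \<longrightarrow>
        (\<forall>\<gamma>>0. b \<gamma> = ln \<gamma>) \<longrightarrow>
        (\<forall>i\<in>{1..n - m}. 0 \<le> c i) \<longrightarrow> c (n - m + 1) = \<infinity> \<longrightarrow>
        (\<forall>i\<in>{1..n - m}.
           ((\<lambda>\<gamma>. ereal (real (d \<gamma> i)) * KL_number g f L m i / ereal (ln \<gamma>)) \<longlongrightarrow> c i) at_top) \<longrightarrow>
        (\<forall>\<gamma>>0. \<forall>i\<in>{1..n - m}. 0 < \<rho> \<gamma> i \<and> \<rho> \<gamma> i < 1) \<longrightarrow>
        (\<forall>i\<in>{1..n - m}. ((\<lambda>\<gamma>. \<rho> \<gamma> i) \<longlongrightarrow> 0) at_top) \<longrightarrow>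
        (\<forall>i\<in>{1..n - m}. ((\<lambda>\<gamma>. - ln (\<rho> \<gamma> i) / ln \<gamma>) \<longlongrightarrow> 0) at_top) \<longrightarrow>
        asymp_at_infinity
          (\<lambda>\<gamma>. enn2ereal (INF \<tau>\<in>false_alarm_class g L \<gamma>. WADD g f L m n (d \<gamma>) \<tau>))
          (\<lambda>\<gamma>. enn2ereal (WADD g f L m n (d \<gamma>) (WD_CuSum g f L m n (\<rho> \<gamma>) (b \<gamma>)))) \<and>
        asymp_at_infinity
          (\<lambda>\<gamma>. enn2ereal (WADD g f L m n (d \<gamma>) (WD_CuSum g f L m n (\<rho> \<gamma>) (b \<gamma>))))
          (\<lambda>\<gamma>. ereal (ln \<gamma>) * delay_constant m n c (KL_number g f L m)))"
  proof (intro conjI allI impI)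
  fix \<rho> :: "nat \<Rightarrow> real" and \<gamma> b :: real
  assume "\<forall>i\<in>{1..n - m}. 0 < \<rho> i \<and> \<rho> i < 1" "0 < \<gamma>" "b = ln \<gamma>"
  then show "ennreal \<gamma> \<le> null_expectation g L (WD_CuSum g f L m n \<rho> b)"
    using null_expectation_WD_CuSum_ge[OF assms] by simp
next
  fix c :: "nat \<Rightarrow> ereal" and d :: "real \<Rightarrow> nat \<Rightarrow> nat" and \<rho> :: "real \<Rightarrow> nat \<Rightarrow> real" and b :: "real \<Rightarrow> real"
  assume KL: "\<forall>i\<in>{1..n - m + 1}. 0 < KL_number g f L m i \<and> KL_number g f L m i < \<infinity>"
    and b: "\<forall>\<gamma>>0. b \<gamma> = ln \<gamma>"
    and c: "\<forall>i\<in>{1..n - m}. 0 \<le> c i" "c (n - m + 1) = \<infinity>"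
    and d: "\<forall>i\<in>{1..n - m}. ((\<lambda>\<gamma>. ereal (real (d \<gamma> i)) * KL_number g f L m i / ereal (ln \<gamma>)) \<longlongrightarrow> c i) at_top"
    and \<rho>: "\<forall>\<gamma>>0. \<forall>i\<in>{1..n - m}. 0 < \<rho> \<gamma> i \<and> \<rho> \<gamma> i < 1"
    and \<rho>_lim: "\<forall>i\<in>{1..n - m}. ((\<lambda>\<gamma>. \<rho> \<gamma> i) \<longlongrightarrow> 0) at_top"
    and ln_\<rho>_lim: "\<forall>i\<in>{1..n - m}. ((\<lambda>\<gamma>. - ln (\<rho> \<gamma> i) / ln \<gamma>) \<longlongrightarrow> 0) at_top"
  interpret growing_durations g f L m n c d
  proof (intro growing_durations.intro anomaly_model.intro growing_durations_axioms.intro)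
    show "0 < KL_number g f L m i \<and> KL_number g f L m i < \<infinity>" if "i \<in> {1..n - m + 1}" for i
      using KL that by blast
    show "0 \<le> c i" if "i \<in> {1..n - m}" for i using c(1) that by blast
    show "((\<lambda>\<gamma>. ereal (real (d \<gamma> i)) * KL_number g f L m i / ereal (ln \<gamma>)) \<longlongrightarrow> c i) at_top" if "i \<in> {1..n - m}" for i
      using d that by blast
  qed (fact assms c(2))+
  let ?U = "\<lambda>\<gamma>. INF \<tau>\<in>false_alarm_class g L \<gamma>. WADD g f L m n (d \<gamma>) \<tau>"
  let ?V = "\<lambda>\<gamma>. WADD g f L m n (d \<gamma>) (WD_CuSum g f L m n (\<rho> \<gamma>) (b \<gamma>))"
  \<comment> \<open>The false alarm bound puts the test itself into the class over which the infimum
    is taken.\<close>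
  have le: "\<forall>\<^sub>F \<gamma> in at_top. ?U \<gamma> \<le> ?V \<gamma>"
    using eventually_gt_at_top[of 0]
  proof eventually_elim
    case (elim \<gamma>)
    have "WD_CuSum g f L m n (\<rho> \<gamma>) (b \<gamma>) \<in> false_alarm_class g L \<gamma>"
      using WD_CuSum_in_class[of "\<rho> \<gamma>" \<gamma>] \<rho> b elim by simp
    then show ?case by (rule INF_lower)
  qed
  have up: "\<forall>\<^sub>F \<gamma> in at_top. ?V \<gamma> \<le> ennreal (r * ln \<gamma>)" if "K < r" for r
  proof -
    have "\<forall>\<^sub>F \<gamma> in at_top. WADD g f L m n (d \<gamma>) (WD_CuSum g f L m n (\<rho> \<gamma>) (ln \<gamma>)) \<le> ennreal (r * ln \<gamma>)"
      by (rule eventually_WADD_WD_CuSum_le[OF _ _ _ that]) (use \<rho> \<rho>_lim ln_\<rho>_lim in blast)+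
    with eventually_gt_at_top[of 0] show ?thesis
      by eventually_elim (use b in simp)
  qed
  show "asymp_at_infinity (\<lambda>\<gamma>. enn2ereal (?U \<gamma>)) (\<lambda>\<gamma>. enn2ereal (?V \<gamma>))"
    by (rule asymp_at_infinity_sandwich(1)[OF K_pos _ le]) (erule (1) eventually_INF_WADD_ge, erule up)
  show "asymp_at_infinity (\<lambda>\<gamma>. enn2ereal (?V \<gamma>)) (\<lambda>\<gamma>. ereal (ln \<gamma>) * delay_constant m n c (KL_number g f L m))"
    unfolding delay_constant_eq
    by (rule asymp_at_infinity_sandwich(2)[OF K_pos _ le]) (erule (1) eventually_INF_WADD_ge, erule up)
qed

end
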